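(* There exists a universal constant $\alpha>0$ such that the following holds. Let $n\ge 1$, let $B\subset\mathbb{R}^n$ be an isotropic convex body satisfying KLS with constant $C$, and let $\rho:\mathbb{R}^+\to\mathbb{R}^+$ be log-concave and non-increasing and such that $\mu(dx)=\rho(|x|_B)\,dx$ is a probability measure on $\mathbb{R}^n$. Then $\mu$ satisfies KLS with constant $\alpha C$, i.e. $C_{\mathrm P}(\mu)\le \alpha C\,\frac{\mathrm{E}_\mu|X|^2}{n}$.
   Context: $|\cdot|$ is the Euclidean norm and $\langle\cdot,\cdot\rangle$ the Euclidean scalar product on $\mathbb{R}^n$; $\mathbb{R}^+=[0,\infty)$; $\mathrm{E}_\mu$ is expectation for $X$ of law $\mu$. A convex body is a compact convex set with non-empty interior; $\mu_B$ is the uniform probability measure on $B$. A probability measure $\mu$ on $\mathbb{R}^n$ is isotropic if its barycenter $\int x\,d\mu(x)$ is $0$ and $\int\langle x,\theta\rangle^2d\mu(x)$ is constant over the unit vectors $\theta\in\mathbb{S}^{n-1}$ (the constant, which is then $\mathrm{E}_\mu|X|^2/n$, is not required to be $1$). A convex body $B$ is isotropic if $\mu_B$ is. (For such $B$, the origin is an interior point.) For a convex body $B$ with $0$ in its interior, $|x|_B=\inf\{\lambda>0:\ x/\lambda\in B\}$ (not necessarily symmetric). The Poincaré constant $C_{\mathrm P}(\mu)$ is the best constant $A$ such that $\mathrm{Var}_\mu f\le A\int|\nabla f|^2\,d\mu$ for every smooth function $f$, where $\mathrm{Var}_\mu f=\int\big(f-\int f\,d\mu\big)^2d\mu$. An isotropic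 log-concave probability measure $\mu$ on $\mathbb{R}^n$ is said to satisfy KLS with constant $C$ if $C_{\mathrm P}(\mu)\le C\,\mathrm{E}_\mu|X|^2/n$; an isotropic convex body $B$ satisfies KLS with constant $C$ if $\mu_B$ does. (A measure $\rho(|x|_B)dx$ with $\rho$ log-concave and non-increasing is log-concave, and it is isotropic when $B$ is.) "Universal" means independent of $n$, $B$, $C$, $\rho$. *)

theory Defs
  imports "HOL-Analysis.Analysis" "HOL-Probability.Probability_Measure"
begin

text \<open>
  The constant \<open>\<alpha>\<close> of the theorem must not depend on the dimension, so \<open>n\<close> has to be quantified
  inside the formula and cannot be a type. A point of \<open>\<real>\<^sup>n\<close> is therefore a function in the carrier
  \<open>{..<n} \<rightarrow>\<^sub>E UNIV\<close>, which is both the carrier of \<open>product_topology (\<lambda>_. euclideanreal) {..<n}\<close>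
  and the space of the product Lebesgue measure \<open>\<Pi>\<^sub>M i\<in>{..<n}. lborel\<close>.
\<close>

definition euclid_top :: "nat \<Rightarrow> (nat \<Rightarrow> real) topology" where
  "euclid_top n = product_topology (\<lambda>_. euclideanreal) {..<n}"

definition lborel_n :: "nat \<Rightarrow> (nat \<Rightarrow> real) measure" where
  "lborel_n n = Pi\<^sub>M {..<n} (\<lambda>_. lborel)"

definition inner_n :: "nat \<Rightarrow> (nat \<Rightarrow> real) \<Rightarrow> (nat \<Rightarrow> real) \<Rightarrow> real" where
  "inner_n n x y = (\<Sum>i<n. x i * y i)"

definition norm_n :: "nat \<Rightarrow> (nat \<Rightarrow> real) \<Rightarrow> real" where
  "norm_n n x = sqrt (inner_n n x x)"

definition sphere_n :: "nat \<Rightarrow> (nat \<Rightarrow> real) set" where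
  "sphere_n n = {\<theta> \<in> {..<n} \<rightarrow>\<^sub>E UNIV. norm_n n \<theta> = 1}"

definition convex_n :: "nat \<Rightarrow> (nat \<Rightarrow> real) set \<Rightarrow> bool" where
  "convex_n n S \<longleftrightarrow>
     (\<forall>x\<in>S. \<forall>y\<in>S. \<forall>u\<ge>0. \<forall>v\<ge>0. u + v = 1 \<longrightarrow> (\<lambda>i\<in>{..<n}. u * x i + v * y i) \<in> S)"

definition convex_body :: "nat \<Rightarrow> (nat \<Rightarrow> real) set \<Rightarrow> bool" where
  "convex_body n B \<longleftrightarrow>
     compactin (euclid_top n) B \<and> convex_n n B \<and> euclid_top n interior_of B \<noteq> {}"

definition gauge_n :: "nat \<Rightarrow> (nat \<Rightarrow> real) set \<Rightarrow> (nat \<Rightarrow> real) \<Rightarrow> real" where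
  "gauge_n n B x = Inf {l. 0 < l \<and> (\<lambda>i\<in>{..<n}. x i / l) \<in> B}"

text \<open>
  The integrability clause in \<open>isotropic\<close> excludes spurious zero values of the Bochner integral;
  it holds automatically for measures with bounded support.
\<close>

definition isotropic :: "nat \<Rightarrow> (nat \<Rightarrow> real) measure \<Rightarrow> bool" where
  "isotropic n \<mu> \<longleftrightarrow>
     integrable \<mu> (\<lambda>x. (norm_n n x)\<^sup>2) \<and>
     (\<forall>i<n. (\<integral>x. x i \<partial>\<mu>) = 0) \<and>
     (\<exists>c. \<forall>\<theta>\<in>sphere_n n. (\<integral>x. (inner_n n x \<theta>)\<^sup>2 \<partial>\<mu>) = c)"

definition uniform_on_body :: "nat \<Rightarrow> (nat \<Rightarrow> real) set \<Rightarrow> (nat \<Rightarrow> real) measure" where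
  "uniform_on_body n B = uniform_measure (lborel_n n) B"

definition isotropic_body :: "nat \<Rightarrow> (nat \<Rightarrow> real) set \<Rightarrow> bool" where
  "isotropic_body n B \<longleftrightarrow> isotropic n (uniform_on_body n B)"

definition partial_deriv :: "nat \<Rightarrow> ((nat \<Rightarrow> real) \<Rightarrow> real) \<Rightarrow> (nat \<Rightarrow> real) \<Rightarrow> real" where
  "partial_deriv i f x = deriv (\<lambda>t. f (x(i := t))) (x i)"

definition gradient :: "nat \<Rightarrow> ((nat \<Rightarrow> real) \<Rightarrow> real) \<Rightarrow> (nat \<Rightarrow> real) \<Rightarrow> (nat \<Rightarrow> real)" where
  "gradient n f x = (\<lambda>i\<in>{..<n}. partial_deriv i f x)"

primrec Ck :: "nat \<Rightarrow> nat \<Rightarrow> ((nat \<Rightarrow> real) \<Rightarrow> real) \<Rightarrow> bool" where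
  "Ck n 0 f \<longleftrightarrow> continuous_map (euclid_top n) euclideanreal f"
| "Ck n (Suc k) f \<longleftrightarrow> continuous_map (euclid_top n) euclideanreal f \<and>
     (\<forall>i<n. (\<forall>x \<in> {..<n} \<rightarrow>\<^sub>E UNIV. (\<lambda>t. f (x(i := t))) differentiable at (x i)) \<and>
            Ck n k (partial_deriv i f))"

definition smooth :: "nat \<Rightarrow> ((nat \<Rightarrow> real) \<Rightarrow> real) \<Rightarrow> bool" where
  "smooth n f \<longleftrightarrow> (\<forall>k. Ck n k f)"

text \<open>
  Variance and energy take values in \<open>[0, \<infinity>]\<close>. The variance is defined through the mean of \<open>f\<close>,
  so the Poincare inequality is required of all smooth functions that have a mean; functions with
  infinite variance are not exempted.
\<close>

definition variance_of :: "(nat \<Rightarrow> real) measure \<Rightarrow> ((nat \<Rightarrow> real) \<Rightarrow> real) \<Rightarrow> ennreal" where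
  "variance_of \<mu> f = (\<integral>\<^sup>+x. ennreal ((f x - (\<integral>y. f y \<partial>\<mu>))\<^sup>2) \<partial>\<mu>)"

definition energy :: "nat \<Rightarrow> (nat \<Rightarrow> real) measure \<Rightarrow> ((nat \<Rightarrow> real) \<Rightarrow> real) \<Rightarrow> ennreal" where
  "energy n \<mu> f = (\<integral>\<^sup>+x. ennreal ((norm_n n (gradient n f x))\<^sup>2) \<partial>\<mu>)"

definition poincare_constant :: "nat \<Rightarrow> (nat \<Rightarrow> real) measure \<Rightarrow> ennreal" where
  "poincare_constant n \<mu> =
     Inf {A. \<forall>f. smooth n f \<and> integrable \<mu> f \<longrightarrow> variance_of \<mu> f \<le> A * energy n \<mu> f}"

text \<open>
  The defining inequality of KLS, to be read for isotropic log-concave probability measures.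
  It is stated in \<open>ereal\<close> because \<open>ennreal\<close> would truncate a negative right-hand side to \<open>0\<close>.
\<close>

definition satisfies_KLS :: "nat \<Rightarrow> (nat \<Rightarrow> real) measure \<Rightarrow> real \<Rightarrow> bool" where
  "satisfies_KLS n \<mu> C \<longleftrightarrow>
     enn2ereal (poincare_constant n \<mu>) \<le> ereal (C * (\<integral>x. (norm_n n x)\<^sup>2 \<partial>\<mu>) / real n)"

text \<open>
  Since \<open>0 powr 0 = 0\<close>, the weights are taken in the open interval; the endpoint cases are trivial.
\<close>

definition log_concave_on :: "real set \<Rightarrow> (real \<Rightarrow> real) \<Rightarrow> bool" where
  "log_concave_on S f \<longleftrightarrow>
     (\<forall>s\<in>S. \<forall>t\<in>S. \<forall>u>0. \<forall>v>0. u + v = 1 \<longrightarrow>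
        f s powr u * f t powr v \<le> f (u * s + v * t))"

definition gauge_measure ::
    "nat \<Rightarrow> (nat \<Rightarrow> real) set \<Rightarrow> (real \<Rightarrow> real) \<Rightarrow> (nat \<Rightarrow> real) measure" where
  "gauge_measure n B \<rho> = density (lborel_n n) (\<lambda>x. ennreal (\<rho> (gauge_n n B x)))"

end

theory Submission
  imports Defs "HOL-Probability.Distributions"
begin

text \<open>
  Write \<open>r = |x|\<^sub>B\<close>, let \<open>Y\<close> be uniform on \<open>B\<close> and \<open>\<theta>(y) = y / |y|\<^sub>B\<close>. A non-increasing radial weight is
  a mixture of uniform measures on dilates of \<open>B\<close>, so \<open>\<mu>\<close> is the law of \<open>S Y\<close> with an independent
  \<open>S > 0\<close>; it is also the law of \<open>R \<theta>(Y)\<close> with an independent \<open>R\<close> of density proportional to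
  \<open>t\<^sup>n\<^sup>-\<^sup>1 \<rho>(t)\<close>. Each picture is used where it is strong. The target is to bound the quadratic deviation
  of \<open>f\<close> from some constant by a multiple of \<open>s\<^sup>2 A \<integral> |\<nabla>f|\<^sup>2 d\<mu>\<close>, where \<open>A\<close> is a
  Poincare constant of \<open>B\<close> and \<open>s\<close> is a fixed multiple of the typical size of \<open>r\<close> (\<open>typical_scale\<close>).

  Bulk \<open>r \<le> 2s\<close>. On each dilate \<open>qB\<close> with \<open>q \<le> 2s\<close> the inequality of \<open>B\<close> controls \<open>f\<close> up to its mean over
  \<open>qB\<close> (\<open>poincare_on_dilate\<close>). That mean is an average of the means \<open>m(t)\<close> of \<open>f\<close> over the boundaries
  of the dilates \<open>tB\<close>, \<open>t \<le> q\<close>, taken with the cone measure, so by convexity only the deviation of \<open>m(R)\<close> is left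
  (\<open>poincare_mixture\<close>). The point of this detour is that \<open>R\<close>, unlike \<open>S\<close>, has a log-concave
  density of a form that limits its relative fluctuations to order \<open>1 / \<surd>n\<close>, while
  \<open>|m'(t)|\<^sup>2 \<le> E|\<theta>|\<^sup>2 E|\<nabla>f(t\<theta>)|\<^sup>2\<close> involves the average of \<open>|\<theta>|\<^sup>2\<close> only and not its maximum. A weighted
  Hardy inequality then gives the right order (\<open>radial_mean_concentration\<close>).

  Tail \<open>r > 2s\<close>. There \<open>t\<^sup>n\<^sup>-\<^sup>1 \<rho>(t)\<close> decays at rate \<open>n / s\<close>, so a Hardy inequality along each ray bounds
  \<open>f\<close> by its values on \<open>r \<le> 2s\<close> plus \<open>(s / n)\<^sup>2\<close> times the square of the derivative along the ray
  (\<open>tail_bound\<close>). The derivative is at most \<open>|\<theta>| |\<nabla>f|\<close>, and now the maximum of \<open>|\<theta>|\<close> does matter;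
  the factor \<open>1 / n\<^sup>2\<close> compensates it exactly because an isotropic body has diameter at most
  of order \<open>n\<close> times the standard deviation of a coordinate (\<open>diameter_bound\<close>).

  Testing coordinate functions shows \<open>C \<ge> 1\<close>, so the terms without \<open>A\<close> are absorbed, and \<open>s\<^sup>2 E|Y|\<^sup>2\<close> is at
  most a multiple of \<open>E|X|\<^sup>2\<close> (\<open>second_moment_lower_bound\<close>). No deep theorem on log-concave measures
  enters.
\<close>

section \<open>Weighted Hardy inequalities on an interval\<close>

text \<open>
  Since \<open>h\<close> vanishes at \<open>a\<close>, \<open>h\<^sup>2\<close> is the integral of \<open>2 h h'\<close>; exchanging the integrals puts the tail of \<open>p\<close>
  next to \<open>h h'\<close>, where it is at most \<open>l p\<close>. Young's inequality leaves half of the left-hand side to be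
  absorbed, which is why \<open>p\<close> has to be bounded: the left-hand side must be finite.
\<close>

lemma hardy_right:
  fixes h h' p :: "real \<Rightarrow> real"
  assumes deriv: "\<And>x. (h has_real_derivative h' x) (at x)"
    and cont: "continuous_on UNIV h'"
    and p[measurable]: "p \<in> borel_measurable borel"
    and p0: "\<And>x. x \<in> {a..b} \<Longrightarrow> 0 \<le> p x" and pP: "\<And>x. x \<in> {a..b} \<Longrightarrow> p x \<le> P"
    and l0: "0 \<le> l"
    and tail: "\<And>w. w \<in> {a<..b} \<Longrightarrow> (\<integral>\<^sup>+u\<in>{w..b}. ennreal (p u) \<partial>lborel) \<le> ennreal (l * p w)"
    and ha: "h a = 0"
  shows "(\<integral>\<^sup>+u\<in>{a..b}. ennreal ((h u)\<^sup>2 * p u) \<partial>lborel)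
    \<le> ennreal (4 * l\<^sup>2) * (\<integral>\<^sup>+u\<in>{a..b}. ennreal ((h' u)\<^sup>2 * p u) \<partial>lborel)"
proof -
  have conth: "continuous_on UNIV h"
    using deriv by (meson DERIV_isCont continuous_at_imp_continuous_on)
  note [measurable] = borel_measurable_continuous_onI[OF conth] borel_measurable_continuous_onI[OF cont]
  let ?g = "\<lambda>w. \<bar>2 * h w * h' w\<bar>"
  define I where "I = (\<integral>\<^sup>+u\<in>{a..b}. ennreal ((h u)\<^sup>2 * p u) \<partial>lborel)"
  define J where "J = (\<integral>\<^sup>+u\<in>{a..b}. ennreal ((h' u)\<^sup>2 * p u) \<partial>lborel)"
  have e: "ennreal (x / 2 + c * y) = ennreal (1/2) * ennreal x + ennreal c * ennreal y"
    if "0 \<le> x" "0 \<le> y" "0 \<le> c" for x y c :: real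
  proof -
    have "ennreal (1/2) * ennreal x = ennreal (1/2 * x)" "ennreal c * ennreal y = ennreal (c * y)"
      using that by (auto simp only: ennreal_mult[symmetric])
    moreover have "ennreal (1/2 * x) + ennreal (c * y) = ennreal (1/2 * x + c * y)"
      using that by (intro ennreal_plus[symmetric]) auto
    ultimately show ?thesis by simp
  qed
  have sq: "ennreal ((h u)\<^sup>2) \<le> (\<integral>\<^sup>+w. indicator {a..u} w * ennreal (?g w) \<partial>lborel)" if "a \<le> u" for u
  proof -
    have c: "continuous_on {a..u} (\<lambda>w. 2 * h w * h' w)"
      by (intro continuous_intros continuous_on_subset[OF conth] continuous_on_subset[OF cont]) auto
    have "((\<lambda>w. 2 * h w * h' w) has_integral (h u)\<^sup>2 - (h a)\<^sup>2) {a..u}"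
    proof (rule fundamental_theorem_of_calculus[OF that])
      fix x
      have "((\<lambda>w. (h w)\<^sup>2) has_real_derivative 2 * h x * h' x) (at x)"
        by (rule derivative_eq_intros deriv)+ simp
      then show "((\<lambda>w. (h w)\<^sup>2) has_vector_derivative 2 * h x * h' x) (at x within {a..u})"
        by (meson has_field_derivative_at_within has_real_derivative_iff_has_vector_derivative)
    qed
    then have 1: "integral {a..u} (\<lambda>w. 2 * h w * h' w) = (h u)\<^sup>2"
      using ha by (simp add: integral_unique)
    have i: "?g integrable_on {a..u}"
      by (intro integrable_continuous_real continuous_intros c)
    have le: "(h u)\<^sup>2 \<le> integral {a..u} ?g"
      unfolding 1[symmetric] by (intro integral_le integrable_continuous_real c i) auto
    have "ennreal (integral {a..u} ?g) = (\<integral>\<^sup>+w. ennreal (indicator {a..u} w * ?g w) \<partial>lborel)"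
    proof (rule nn_integral_has_integral_lborel[symmetric])
      have "((\<lambda>w. if w \<in> {a..u} then ?g w else 0) has_integral integral {a..u} ?g) UNIV"
        by (subst has_integral_restrict_UNIV) (rule integrable_integral[OF i])
      then show "((\<lambda>w. indicator {a..u} w * ?g w) has_integral integral {a..u} ?g) UNIV"
        by (rule has_integral_eq[rotated]) (auto simp: indicator_def)
    qed auto
    then show ?thesis
      using ennreal_leI[OF le] by (simp add: ennreal_mult ennreal_indicator)
  qed
  have "I \<le> (\<integral>\<^sup>+u. (\<integral>\<^sup>+w. indicator {a..u} w * ennreal (?g w) \<partial>lborel) * ennreal (p u) * indicator {a..b} u \<partial>lborel)"
    unfolding I_def
  proof (intro nn_integral_mono)
    fix u show "ennreal ((h u)\<^sup>2 * p u) * indicator {a..b} u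
      \<le> (\<integral>\<^sup>+w. indicator {a..u} w * ennreal (?g w) \<partial>lborel) * ennreal (p u) * indicator {a..b} u"
      using sq[of u] p0[of u] by (auto simp: indicator_def ennreal_mult intro!: mult_right_mono)
  qed
  also have "\<dots> = (\<integral>\<^sup>+u. (\<integral>\<^sup>+w. indicator {(w,u). a \<le> w \<and> w \<le> u \<and> u \<le> b} (w,u) * ennreal (?g w) * ennreal (p u) \<partial>lborel) \<partial>lborel)"
  proof (intro nn_integral_cong)
    fix u
    have "(\<integral>\<^sup>+w. indicator {a..u} w * ennreal (?g w) \<partial>lborel) * ennreal (p u) * indicator {a..b} u
      = (\<integral>\<^sup>+w. indicator {a..u} w * ennreal (?g w) * (ennreal (p u) * indicator {a..b} u) \<partial>lborel)"
      by (subst mult.assoc, rule nn_integral_multc[symmetric]) measurable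
    also have "\<dots> = (\<integral>\<^sup>+w. indicator {(w,u). a \<le> w \<and> w \<le> u \<and> u \<le> b} (w,u) * ennreal (?g w) * ennreal (p u) \<partial>lborel)"
      by (intro nn_integral_cong) (auto simp: indicator_def)
    finally show "(\<integral>\<^sup>+w. indicator {a..u} w * ennreal (?g w) \<partial>lborel) * ennreal (p u) * indicator {a..b} u
      = (\<integral>\<^sup>+w. indicator {(w,u). a \<le> w \<and> w \<le> u \<and> u \<le> b} (w,u) * ennreal (?g w) * ennreal (p u) \<partial>lborel)" .
  qed
  also have "\<dots> = (\<integral>\<^sup>+w. (\<integral>\<^sup>+u. indicator {(w,u). a \<le> w \<and> w \<le> u \<and> u \<le> b} (w,u) * ennreal (?g w) * ennreal (p u) \<partial>lborel) \<partial>lborel)"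
    by (rule lborel_pair.Fubini') measurable
  also have "\<dots> = (\<integral>\<^sup>+w. (ennreal (?g w) * indicator {a..b} w) * (\<integral>\<^sup>+u\<in>{w..b}. ennreal (p u) \<partial>lborel) \<partial>lborel)"
    by (intro nn_integral_cong, subst nn_integral_cmult[symmetric], measurable, intro nn_integral_cong)
       (auto simp: indicator_def)
  also have "\<dots> \<le> (\<integral>\<^sup>+w. ennreal ((h w)\<^sup>2 * p w / 2 + 2 * l\<^sup>2 * ((h' w)\<^sup>2 * p w)) * indicator {a..b} w \<partial>lborel)"
  proof (intro nn_integral_mono)
    fix w
    show "(ennreal (?g w) * indicator {a..b} w) * (\<integral>\<^sup>+u\<in>{w..b}. ennreal (p u) \<partial>lborel)
      \<le> ennreal ((h w)\<^sup>2 * p w / 2 + 2 * l\<^sup>2 * ((h' w)\<^sup>2 * p w)) * indicator {a..b} w"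
    proof (cases "w \<in> {a..b}")
      case True
      have "ennreal (?g w) * (\<integral>\<^sup>+u\<in>{w..b}. ennreal (p u) \<partial>lborel) \<le> ennreal (?g w) * ennreal (l * p w)"
      proof (cases "w = a")
        case False
        then show ?thesis using True by (intro mult_left_mono tail) auto
      qed (simp add: ha)
      also have "\<dots> = ennreal (?g w * (l * p w))"
        using l0 p0[OF True] by (simp add: ennreal_mult)
      also have "\<dots> \<le> ennreal ((h w)\<^sup>2 * p w / 2 + 2 * l\<^sup>2 * ((h' w)\<^sup>2 * p w))"
      proof (intro ennreal_leI)
        have "2 * \<bar>h w\<bar> * (l * \<bar>h' w\<bar>) \<le> (h w)\<^sup>2 / 2 + 2 * (l * h' w)\<^sup>2"
          using sum_squares_bound[of "\<bar>h w\<bar>" "2 * (l * \<bar>h' w\<bar>)"] by (simp add: power_mult_distrib)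
        then have "2 * \<bar>h w\<bar> * (l * \<bar>h' w\<bar>) * p w \<le> ((h w)\<^sup>2 / 2 + 2 * (l * h' w)\<^sup>2) * p w"
          using p0[OF True] by (intro mult_right_mono)
        then show "?g w * (l * p w) \<le> (h w)\<^sup>2 * p w / 2 + 2 * l\<^sup>2 * ((h' w)\<^sup>2 * p w)"
          by (simp add: abs_mult algebra_simps power_mult_distrib)
      qed
      finally show ?thesis using True by simp
    qed simp
  qed
  also have "\<dots> = (\<integral>\<^sup>+w. ennreal (1/2) * (ennreal ((h w)\<^sup>2 * p w) * indicator {a..b} w) + ennreal (2 * l\<^sup>2) * (ennreal ((h' w)\<^sup>2 * p w) * indicator {a..b} w) \<partial>lborel)"
  proof (intro nn_integral_cong)
    fix w
    show "ennreal ((h w)\<^sup>2 * p w / 2 + 2 * l\<^sup>2 * ((h' w)\<^sup>2 * p w)) * indicator {a..b} w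
      = ennreal (1/2) * (ennreal ((h w)\<^sup>2 * p w) * indicator {a..b} w) + ennreal (2 * l\<^sup>2) * (ennreal ((h' w)\<^sup>2 * p w) * indicator {a..b} w)"
    proof (cases "w \<in> {a..b}")
      case True
      then show ?thesis
        using e[of "(h w)\<^sup>2 * p w" "(h' w)\<^sup>2 * p w" "2 * l\<^sup>2"] p0[OF True] by (simp del: ennreal_half)
    qed simp
  qed
  also have "\<dots> = ennreal (1/2) * I + ennreal (2 * l\<^sup>2) * J"
    unfolding I_def J_def by (simp add: nn_integral_add nn_integral_cmult)
  finally have main: "I \<le> ennreal (1/2) * I + ennreal (2 * l\<^sup>2) * J" .
  \<comment> \<open>finiteness permits the absorption of half of the left-hand side\<close>
  have "I < \<infinity>"
  proof -
    have "compact (h ` {a..b})"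
      by (intro compact_continuous_image continuous_on_subset[OF conth]) auto
    then obtain H where H: "\<And>u. u \<in> {a..b} \<Longrightarrow> \<bar>h u\<bar> \<le> H"
      using compact_imp_bounded bounded_real by (metis imageI)
    have "(h u)\<^sup>2 * p u \<le> H\<^sup>2 * P" if "u \<in> {a..b}" for u
      using H[OF that] p0[OF that] pP[OF that] by (intro mult_mono) (auto simp: abs_le_square_iff[symmetric])
    then have "I \<le> (\<integral>\<^sup>+u. ennreal (H\<^sup>2 * P) * indicator {a..b} u \<partial>lborel)"
      unfolding I_def by (intro nn_integral_mono) (auto simp: indicator_def intro!: ennreal_leI)
    also have "\<dots> < \<infinity>"
      by (simp add: nn_integral_cmult_indicator ennreal_mult_less_top emeasure_lborel_Icc_eq)
    finally show ?thesis .
  qed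
  then obtain i where i: "0 \<le> i" "I = ennreal i"
    by (metis ennreal_cases infinity_ennreal_def less_irrefl)
  show ?thesis
  proof (cases "J = \<infinity>")
    case True
    show ?thesis
    proof (cases "l = 0")
      case True
      then have "I \<le> ennreal (1/2) * I" using main by simp
      then have "ennreal i \<le> ennreal (i / 2)" using i e[of i 0 0] by (simp del: ennreal_half)
      then have "i \<le> i / 2" using i by (subst (asm) ennreal_le_iff) auto
      then have "I = 0" using i by simp
      then show ?thesis by (simp add: I_def)
    next
      case False
      then show ?thesis using True l0 unfolding J_def by (simp add: ennreal_mult_top)
    qed
  next
    case False
    then obtain j where j: "0 \<le> j" "J = ennreal j" by (metis ennreal_cases infinity_ennreal_def)
    have "ennreal i \<le> ennreal (i / 2 + 2 * l\<^sup>2 * j)"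
      using main i j e[of i j "2 * l\<^sup>2"] by (simp del: ennreal_half)
    then have "i \<le> i / 2 + 2 * l\<^sup>2 * j"
      using i j by (subst (asm) ennreal_le_iff) auto
    then have "i \<le> 4 * l\<^sup>2 * j" by simp
    then have "I \<le> ennreal (4 * l\<^sup>2) * J"
      using i j by (simp add: ennreal_mult[symmetric])
    then show ?thesis by (simp add: I_def J_def)
  qed
qed

lemma hardy_left:
  fixes h h' p :: "real \<Rightarrow> real"
  assumes deriv: "\<And>x. (h has_real_derivative h' x) (at x)"
    and cont: "continuous_on UNIV h'"
    and p[measurable]: "p \<in> borel_measurable borel"
    and p0: "\<And>x. x \<in> {a..b} \<Longrightarrow> 0 \<le> p x" and pP: "\<And>x. x \<in> {a..b} \<Longrightarrow> p x \<le> P"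
    and l0: "0 \<le> l"
    and tail: "\<And>w. w \<in> {a..<b} \<Longrightarrow> (\<integral>\<^sup>+u\<in>{a..w}. ennreal (p u) \<partial>lborel) \<le> ennreal (l * p w)"
    and hb: "h b = 0"
  shows "(\<integral>\<^sup>+u\<in>{a..b}. ennreal ((h u)\<^sup>2 * p u) \<partial>lborel)
    \<le> ennreal (4 * l\<^sup>2) * (\<integral>\<^sup>+u\<in>{a..b}. ennreal ((h' u)\<^sup>2 * p u) \<partial>lborel)"
proof -
  have conth: "continuous_on UNIV h"
    using deriv by (meson DERIV_isCont continuous_at_imp_continuous_on)
  note [measurable] = borel_measurable_continuous_onI[OF conth] borel_measurable_continuous_onI[OF cont]
  have refl: "(\<integral>\<^sup>+u\<in>{c..d}. ennreal (F u) \<partial>lborel) = (\<integral>\<^sup>+u\<in>{-d..-c}. ennreal (F (-u)) \<partial>lborel)"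
    if [measurable]: "F \<in> borel_measurable borel" for F :: "real \<Rightarrow> real" and c d
    by (subst nn_integral_real_affine[where c="-1" and t=0])
       (auto intro!: nn_integral_cong simp: indicator_def)
  have "(\<integral>\<^sup>+u\<in>{-b..-a}. ennreal ((h (-u))\<^sup>2 * p (-u)) \<partial>lborel)
    \<le> ennreal (4 * l\<^sup>2) * (\<integral>\<^sup>+u\<in>{-b..-a}. ennreal ((- h' (-u))\<^sup>2 * p (-u)) \<partial>lborel)"
  proof (rule hardy_right)
    show "((\<lambda>u. h (- u)) has_real_derivative - h' (- x)) (at x)" for x
      using DERIV_chain2[OF deriv[of "-x"] DERIV_minus[OF DERIV_ident]] by simp
    show "continuous_on UNIV (\<lambda>x. - h' (- x))"
      by (intro continuous_intros continuous_on_compose2[OF cont]) auto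
    show "(\<integral>\<^sup>+u\<in>{w..- a}. ennreal (p (-u)) \<partial>lborel) \<le> ennreal (l * p (-w))" if "w \<in> {- b<..- a}" for w
      using tail[of "-w"] that refl[of p a "-w"] by auto
    show "p (- x) \<le> P" if "x \<in> {- b..- a}" for x using pP[of "-x"] that by auto
  qed (use p0 l0 hb in auto)
  then show ?thesis by (subst (1 2) refl) auto
qed


text \<open>
  The two tail conditions say that \<open>l p(w)\<close> dominates the mass on the far side of \<open>w\<close> as seen from \<open>c\<close>. The
  conclusion is a Poincare inequality in which the value at \<open>c\<close> replaces the mean.
\<close>

lemma hardy_centred:
  fixes h h' p :: "real \<Rightarrow> real"
  assumes deriv: "\<And>x. (h has_real_derivative h' x) (at x)"
    and cont: "continuous_on UNIV h'"
    and p[measurable]: "p \<in> borel_measurable borel"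
    and p0: "\<And>x. x \<in> {a..b} \<Longrightarrow> 0 \<le> p x" and pP: "\<And>x. x \<in> {a..b} \<Longrightarrow> p x \<le> P"
    and l0: "0 \<le> l" and c: "c \<in> {a..b}"
    and right: "\<And>w. w \<in> {c<..b} \<Longrightarrow> (\<integral>\<^sup>+u\<in>{w..b}. ennreal (p u) \<partial>lborel) \<le> ennreal (l * p w)"
    and left: "\<And>w. w \<in> {a..<c} \<Longrightarrow> (\<integral>\<^sup>+u\<in>{a..w}. ennreal (p u) \<partial>lborel) \<le> ennreal (l * p w)"
  shows "(\<integral>\<^sup>+u\<in>{a..b}. ennreal ((h u - h c)\<^sup>2 * p u) \<partial>lborel)
    \<le> ennreal (4 * l\<^sup>2) * (\<integral>\<^sup>+u\<in>{a..b}. ennreal ((h' u)\<^sup>2 * p u) \<partial>lborel)"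
proof -
  have conth: "continuous_on UNIV h"
    using deriv by (meson DERIV_isCont continuous_at_imp_continuous_on)
  note [measurable] = borel_measurable_continuous_onI[OF conth] borel_measurable_continuous_onI[OF cont]
  have split: "(\<integral>\<^sup>+u\<in>{a..b}. F u \<partial>lborel) = (\<integral>\<^sup>+u\<in>{a..c}. F u \<partial>lborel) + (\<integral>\<^sup>+u\<in>{c..b}. F u \<partial>lborel)"
    if [measurable]: "F \<in> borel_measurable borel" for F :: "real \<Rightarrow> ennreal"
    using AE_lborel_singleton[of c] c
    by (subst nn_integral_add[symmetric]) (auto intro!: nn_integral_cong_AE simp: indicator_def)
  have deriv': "((\<lambda>u. h u - h c) has_real_derivative h' x) (at x)" for x
    using DERIV_diff[OF deriv DERIV_const] by simp
  have "(\<integral>\<^sup>+u\<in>{a..c}. ennreal ((h u - h c)\<^sup>2 * p u) \<partial>lborel)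
    \<le> ennreal (4 * l\<^sup>2) * (\<integral>\<^sup>+u\<in>{a..c}. ennreal ((h' u)\<^sup>2 * p u) \<partial>lborel)"
    by (rule hardy_left[OF deriv' cont p p0 pP l0 left]) (use c in auto)
  moreover have "(\<integral>\<^sup>+u\<in>{c..b}. ennreal ((h u - h c)\<^sup>2 * p u) \<partial>lborel)
    \<le> ennreal (4 * l\<^sup>2) * (\<integral>\<^sup>+u\<in>{c..b}. ennreal ((h' u)\<^sup>2 * p u) \<partial>lborel)"
    by (rule hardy_right[OF deriv' cont p p0 pP l0 right]) (use c in auto)
  ultimately show ?thesis
    by (subst (1 2) split) (auto simp: distrib_left intro: add_mono)
qed

text \<open>
  If at every point \<open>l p\<close> dominates the mass on one of the two sides, then it dominates the smaller
  one. A median of \<open>p\<close> therefore is a centre from which all far sides are dominated. The supremum of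
  the points with at most as much mass to the left as to the right serves as the median.
\<close>

lemma dichotomy_centre:
  fixes p :: "real \<Rightarrow> real"
  assumes ab: "a \<le> b"
    and dich: "\<And>w. w \<in> {a<..b} \<Longrightarrow> (\<integral>\<^sup>+u\<in>{w..b}. ennreal (p u) \<partial>lborel) \<le> ennreal (l * p w)
       \<or> (\<integral>\<^sup>+u\<in>{a..w}. ennreal (p u) \<partial>lborel) \<le> ennreal (l * p w)"
  obtains c where "c \<in> {a..b}"
    "\<And>w. w \<in> {c<..b} \<Longrightarrow> (\<integral>\<^sup>+u\<in>{w..b}. ennreal (p u) \<partial>lborel) \<le> ennreal (l * p w)"
    "\<And>w. w \<in> {a..<c} \<Longrightarrow> (\<integral>\<^sup>+u\<in>{a..w}. ennreal (p u) \<partial>lborel) \<le> ennreal (l * p w)"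
proof -
  define L where "L w = (\<integral>\<^sup>+u\<in>{a..w}. ennreal (p u) \<partial>lborel)" for w
  define R where "R w = (\<integral>\<^sup>+u\<in>{w..b}. ennreal (p u) \<partial>lborel)" for w
  have L: "L w \<le> L w'" and R: "R w' \<le> R w" if "w \<le> w'" for w w'
    unfolding L_def R_def using that by (auto intro!: nn_integral_mono simp: indicator_def)
  define A where "A = {w \<in> {a..b}. L w \<le> R w}"
  have "L a = 0" unfolding L_def
    by (rule nn_integral_null_set) (simp add: null_sets_def)
  then have aA: "a \<in> A" using ab by (simp add: A_def)
  have bdd: "bdd_above A" by (auto simp: A_def)
  define c where "c = Sup A"
  have "a \<le> c" unfolding c_def by (rule cSup_upper[OF aA bdd])
  moreover have "c \<le> b" unfolding c_def by (rule cSup_least) (use aA in \<open>auto simp: A_def\<close>)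
  ultimately have c: "c \<in> {a..b}" by simp
  show thesis
  proof (rule that[OF c])
    fix w assume w: "w \<in> {c<..b}"
    then have "w \<notin> A" using cSup_upper[OF _ bdd, of w] unfolding c_def by force
    then have "R w \<le> L w" using w c by (auto simp: A_def)
    moreover have "R w \<le> ennreal (l * p w) \<or> L w \<le> ennreal (l * p w)"
      unfolding L_def R_def by (rule dich) (use w c in auto)
    ultimately show "(\<integral>\<^sup>+u\<in>{w..b}. ennreal (p u) \<partial>lborel) \<le> ennreal (l * p w)"
      unfolding R_def[symmetric] by (meson order_trans)
  next
    fix w assume w: "w \<in> {a..<c}"
    show "(\<integral>\<^sup>+u\<in>{a..w}. ennreal (p u) \<partial>lborel) \<le> ennreal (l * p w)"
      unfolding L_def[symmetric]
    proof (cases "w = a")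
      case False
      obtain w' where "w' \<in> A" "w < w'"
        using less_cSup_iff[of A w] aA bdd w unfolding c_def by auto
      then have "L w \<le> R w" using L[of w w'] R[of w w'] by (auto simp: A_def)
      moreover have "R w \<le> ennreal (l * p w) \<or> L w \<le> ennreal (l * p w)"
        unfolding L_def R_def by (rule dich) (use w c False in auto)
      ultimately show "L w \<le> ennreal (l * p w)" by (meson order_trans)
    qed (simp add: \<open>L a = 0\<close>)
  qed
qed

section \<open>Log-concave profiles\<close>

locale log_concave_profile =
  fixes \<rho> :: "real \<Rightarrow> real"
  assumes nonneg: "0 \<le> t \<Longrightarrow> 0 \<le> \<rho> t"
    and log_concave: "log_concave_on {0..} \<rho>"
    and antimono: "antimono_on {0..} \<rho>"
begin

lemma antimonoD: "0 \<le> s \<Longrightarrow> s \<le> t \<Longrightarrow> \<rho> t \<le> \<rho> s"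
  using antimono by (auto simp: monotone_on_def)

text \<open>
  Concavity of \<open>log \<rho>\<close>: if its slope from \<open>w\<close> to \<open>r\<close> is at most \<open>-k\<close>, then so is its slope from \<open>r\<close> to \<open>u\<close>.
\<close>

lemma decay_rate_propagates:
  assumes w: "0 \<le> w" "w < r" and u: "r < u" and rate: "\<rho> r * exp (k * (r - w)) \<le> \<rho> w"
  shows "\<rho> u \<le> \<rho> r * exp (- k * (u - r))"
proof (rule ccontr)
  assume "\<not> ?thesis"
  then have gt: "\<rho> r * exp (- k * (u - r)) < \<rho> u" by simp
  have "0 \<le> \<rho> r" "\<rho> u \<le> \<rho> r" using nonneg[of r] antimonoD[of r u] w u by auto
  moreover have "\<rho> r \<noteq> 0" using gt antimonoD[of r u] w u by auto
  ultimately have r0: "0 < \<rho> r" by simp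
  define \<alpha> where "\<alpha> = (u - r) / (u - w)"
  define \<beta> where "\<beta> = (r - w) / (u - w)"
  have ab: "0 < \<alpha>" "0 < \<beta>" using w u by (auto simp: \<alpha>_def \<beta>_def)
  have ab1: "\<alpha> + \<beta> = 1" using w u by (simp add: \<alpha>_def \<beta>_def add_divide_distrib[symmetric])
  have "\<alpha> * w + \<beta> * u = r * (u - w) / (u - w)"
    by (simp add: \<alpha>_def \<beta>_def add_divide_distrib[symmetric] algebra_simps)
  then have comb: "\<alpha> * w + \<beta> * u = r" using w u by simp
  have bal: "\<alpha> * (r - w) = \<beta> * (u - r)"
    using w u by (simp add: \<alpha>_def \<beta>_def field_simps)
  have "\<rho> r = (\<rho> r * exp (k * (r - w))) powr \<alpha> * (\<rho> r * exp (- k * (u - r))) powr \<beta>"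
  proof -
    have "(\<rho> r * exp (k * (r - w))) powr \<alpha> * (\<rho> r * exp (- k * (u - r))) powr \<beta>
      = (\<rho> r powr \<alpha> * \<rho> r powr \<beta>) * exp (k * (\<alpha> * (r - w) - \<beta> * (u - r)))"
      using r0 by (simp add: powr_def ln_mult exp_add[symmetric] algebra_simps)
    then show ?thesis using bal ab1 r0 by (simp add: powr_add[symmetric])
  qed
  also have "\<dots> < \<rho> w powr \<alpha> * \<rho> u powr \<beta>"
  proof (rule mult_le_less_imp_less)
    show "(\<rho> r * exp (k * (r - w))) powr \<alpha> \<le> \<rho> w powr \<alpha>"
      using rate ab r0 by (intro powr_mono2) auto
    show "(\<rho> r * exp (- k * (u - r))) powr \<beta> < \<rho> u powr \<beta>"
      using gt ab r0 by (intro powr_less_mono2) auto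
    show "0 < (\<rho> r * exp (k * (r - w))) powr \<alpha>" using r0 by simp
  qed auto
  also have "\<dots> \<le> \<rho> (\<alpha> * w + \<beta> * u)"
    using log_concave ab ab1 w u unfolding log_concave_on_def by auto
  finally show False by (simp add: comb)
qed

text \<open>
  At every point the graph of \<open>log \<rho>\<close> lies, on at least one side, below the line of slope \<open>-k\<close>.
\<close>

lemma slope_dichotomy:
  assumes "0 \<le> r"
  shows "(\<forall>u>r. \<rho> u \<le> \<rho> r * exp (- k * (u - r))) \<or> (\<forall>w. 0 \<le> w \<and> w < r \<longrightarrow> \<rho> w \<le> \<rho> r * exp (k * (r - w)))"
  using decay_rate_propagates[of _ r _ k] by (meson linorder_not_le order_less_imp_le)

lemma borel_measurable_profile [measurable]:
  "(\<lambda>t. \<rho> (max 0 t)) \<in> borel_measurable borel"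
proof -
  have "mono (\<lambda>t. - \<rho> (max 0 t))"
    by (intro monoI) (auto intro!: antimonoD)
  then have "(\<lambda>t. - (- \<rho> (max 0 t))) \<in> borel_measurable borel"
    by (intro borel_measurable_uminus borel_measurable_mono)
  then show ?thesis by simp
qed

end

text \<open>
  This and the next inequality quantify how \<open>k log t\<close> bends away from its tangents. They turn the factor
  \<open>t\<^sup>k\<close> of the radial density into Gaussian decay.
\<close>

lemma one_minus_le_exp_gaussian:
  assumes "0 \<le> y" "y \<le> (1::real)"
  shows "1 - y \<le> exp (- y - y\<^sup>2 / 2)"
proof (cases "y = 1")
  case False
  then have y: "y < 1" using assms by simp
  have "(\<lambda>y::real. - y - y\<^sup>2/2 - ln (1 - y)) 0 \<le> (\<lambda>y. - y - y\<^sup>2/2 - ln (1 - y)) y"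
  proof (rule DERIV_nonneg_imp_nondecreasing[OF assms(1)])
    fix x :: real assume x: "0 \<le> x" "x \<le> y"
    have "((\<lambda>y. - y - y\<^sup>2/2 - ln (1 - y)) has_real_derivative (- 1 - x + 1 / (1 - x))) (at x)"
      using x y by (auto intro!: derivative_eq_intros simp: field_simps)
    moreover have "0 \<le> - 1 - x + 1 / (1 - x)"
      using x y by (simp add: field_simps power2_eq_square)
    ultimately show "\<exists>D. ((\<lambda>y. - y - y\<^sup>2/2 - ln (1 - y)) has_real_derivative D) (at x) \<and> 0 \<le> D" by blast
  qed
  then have "ln (1 - y) \<le> - y - y\<^sup>2 / 2" by simp
  then have le: "exp (ln (1 - y)) \<le> exp (- y - y\<^sup>2 / 2)" by (simp only: exp_le_cancel_iff)
  have "exp (ln (1 - y)) = 1 - y" using y by (intro exp_ln) simp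
  then show ?thesis using le by metis
next
  case True
  have "0 \<le> exp (- y - y\<^sup>2 / 2)" by (rule exp_ge_zero)
  moreover have "1 - y = 0" using True by (simp only: diff_self)
  ultimately show ?thesis by metis
qed

lemma one_plus_le_exp_gaussian:
  assumes "0 \<le> (x::real)"
  shows "1 + x \<le> exp (x - x\<^sup>2 / (2 * (1 + x)))"
proof -
  let ?f = "\<lambda>x::real. x / 2 + 1 / 2 - inverse (1 + x) / 2 - ln (1 + x)"
  have "?f 0 \<le> ?f x"
  proof (rule DERIV_nonneg_imp_nondecreasing[OF assms(1)])
    fix z :: real assume z: "0 \<le> z" "z \<le> x"
    have a: "((\<lambda>x. 1 + x) has_real_derivative 1) (at z)"
      by (auto intro!: derivative_eq_intros)
    have b: "((\<lambda>x. inverse (1 + x)) has_real_derivative - (inverse (1 + z) * 1 * inverse (1 + z))) (at z)"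
      by (rule DERIV_inverse'[OF a]) (use z in simp)
    have c: "((\<lambda>x. ln (1 + x)) has_real_derivative inverse (1 + z) * 1) (at z)"
      by (rule DERIV_chain2[OF DERIV_ln a]) (use z in simp)
    have d: "(?f has_real_derivative (1 / 2 + inverse (1 + z) ^ 2 / 2 - inverse (1 + z))) (at z)"
      by (rule DERIV_cong[OF DERIV_diff[OF DERIV_diff[OF DERIV_add[OF DERIV_cdivide[OF DERIV_ident] DERIV_const] DERIV_cdivide[OF b]] c]])
         (simp add: power2_eq_square)
    have e: "1 / 2 + inverse (1 + z) ^ 2 / 2 - inverse (1 + z) = (1 - inverse (1 + z))\<^sup>2 / 2"
      by (simp add: power2_eq_square algebra_simps)
    have "0 \<le> 1 / 2 + inverse (1 + z) ^ 2 / 2 - inverse (1 + z)" unfolding e by simp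
    with d show "\<exists>D. (?f has_real_derivative D) (at z) \<and> 0 \<le> D"
      by blast
  qed
  moreover have "x - x\<^sup>2 / (2 * (1 + x)) = x / 2 + 1 / 2 - inverse (1 + x) / 2"
  proof -
    define q where "q = inverse (1 + x)"
    have q1: "(1 + x) * q = 1" using assms by (simp add: q_def)
    have "x\<^sup>2 * q = (x - 1) * ((1 + x) * q) + q"
      by (simp add: power2_eq_square algebra_simps)
    then have "x\<^sup>2 * q = (x - 1) + q" by (simp only: q1 mult_1_right)
    moreover have "x\<^sup>2 / (2 * (1 + x)) = x\<^sup>2 * q / 2"
      by (simp only: q_def divide_inverse inverse_mult_distrib mult_ac)
    ultimately show ?thesis by (simp only: q_def[symmetric]) argo
  qed
  ultimately have le: "ln (1 + x) \<le> x - x\<^sup>2 / (2 * (1 + x))" by simp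
  have "1 + x = exp (ln (1 + x))" using assms by simp
  also have "\<dots> \<le> exp (x - x\<^sup>2 / (2 * (1 + x)))" using le by (simp only: exp_le_cancel_iff)
  finally show ?thesis .
qed


text \<open>
  Half of a Gaussian integral, since \<open>r\<close> is an end point of the interval.
\<close>

lemma nn_integral_gaussian_Icc:
  assumes k: "0 < k" and r: "r \<in> {c..d}" and lr: "c = r \<or> d = r"
  shows "(\<integral>\<^sup>+u\<in>{c..d}. ennreal (exp (- (u - r)\<^sup>2 / k)) \<partial>lborel) \<le> ennreal (sqrt (pi * k) / 2)"
proof -
  have half: "(\<integral>\<^sup>+x. indicator {0..} x * ennreal (exp (- x\<^sup>2)) \<partial>lborel) = ennreal (sqrt pi / 2)"
  proof -
    have "has_bochner_integral lborel (\<lambda>x. indicator {0..} x *\<^sub>R exp (- x\<^sup>2 :: real)) (sqrt pi / 2)"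
      by (rule gaussian_moment_0)
    then have "(\<integral>\<^sup>+x. ennreal (indicator {0..} x *\<^sub>R exp (- x\<^sup>2)) \<partial>lborel) = ennreal (sqrt pi / 2)"
      by (intro nn_integral_eq_integral[THEN trans])
         (auto simp: has_bochner_integral_iff)
    then show ?thesis by (simp add: ennreal_mult ennreal_indicator)
  qed
  have main: "(\<integral>\<^sup>+u\<in>S. ennreal (exp (- (u - r)\<^sup>2 / k)) \<partial>lborel) \<le> ennreal (sqrt (pi * k) / 2)"
    if s: "s = 1 \<or> s = -1" and S: "\<And>u. u \<in> S \<Longrightarrow> 0 \<le> s * (u - r)" and [measurable]: "S \<in> sets borel" for S s
  proof -
    let ?c = "s * sqrt k"
    have c: "\<bar>?c\<bar> = sqrt k" "?c \<noteq> 0" using s k by auto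
    have "(\<integral>\<^sup>+u\<in>S. ennreal (exp (- (u - r)\<^sup>2 / k)) \<partial>lborel)
      = ennreal \<bar>?c\<bar> * (\<integral>\<^sup>+x. ennreal (exp (- (r + ?c * x - r)\<^sup>2 / k)) * indicator S (r + ?c * x) \<partial>lborel)"
      by (rule nn_integral_real_affine[OF _ c(2)]) measurable
    also have "\<dots> \<le> ennreal (sqrt k) * (\<integral>\<^sup>+x. indicator {0..} x * ennreal (exp (- x\<^sup>2)) \<partial>lborel)"
      unfolding c(1)
    proof (intro mult_left_mono nn_integral_mono)
      fix x
      have "0 \<le> x" if "r + ?c * x \<in> S"
        using S[OF that] s k by (auto simp: zero_le_mult_iff)
      moreover have "(r + ?c * x - r)\<^sup>2 / k = x\<^sup>2" using s k by (auto simp: power_mult_distrib)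
      ultimately show "ennreal (exp (- (r + ?c * x - r)\<^sup>2 / k)) * indicator S (r + ?c * x) \<le> indicator {0..} x * ennreal (exp (- x\<^sup>2))"
        by (simp add: indicator_def)
    qed simp
    also have "\<dots> = ennreal (sqrt (pi * k) / 2)"
      unfolding half using k by (simp add: ennreal_mult[symmetric] real_sqrt_mult mult.commute)
    finally show ?thesis .
  qed
  show ?thesis using lr
  proof
    assume "c = r" then show ?thesis by (intro main[of 1]) auto
  next
    assume "d = r" then show ?thesis by (intro main[of "-1"]) auto
  qed
qed

lemma nn_integral_exp_decay_Icc:
  assumes "0 < k"
  shows "(\<integral>\<^sup>+u\<in>{r..b}. ennreal (exp (- k * (u - r))) \<partial>lborel) \<le> ennreal (1 / k)"
proof (cases "r \<le> b")
  case True
  have "(\<integral>\<^sup>+u. ennreal (exp (- k * (u - r))) * indicator {r..b} u \<partial>lborel)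
    = ennreal (- exp (- k * (b - r)) / k - (- exp (- k * (r - r)) / k))"
    by (rule nn_integral_FTC_Icc[where F="\<lambda>u. - exp (- k * (u - r)) / k"])
       (use True assms in \<open>auto intro!: derivative_eq_intros\<close>)
  also have "\<dots> \<le> ennreal (1 / k)"
    using assms by (intro ennreal_leI) (simp add: field_simps)
  finally show ?thesis .
qed simp

lemma nn_integral_power_Ioc:
  assumes "0 \<le> b"
  shows "(\<integral>\<^sup>+t\<in>{0<..b}. ennreal (t ^ k) \<partial>lborel) = ennreal (b ^ (k + 1) / (k + 1))"
proof -
  have "(\<integral>\<^sup>+t\<in>{0<..b}. ennreal (t ^ k) \<partial>lborel) = (\<integral>\<^sup>+t\<in>{0..b}. ennreal (t ^ k) \<partial>lborel)"
    using AE_lborel_singleton[of "0::real"] by (intro nn_integral_cong_AE) (auto simp: indicator_def)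
  also have "\<dots> = ennreal (b ^ (k + 1) / (k + 1) - 0 ^ (k + 1) / (k + 1))"
  proof (rule nn_integral_FTC_Icc[where F="\<lambda>t. t ^ (k + 1) / (k + 1)"])
    show "((\<lambda>t. t ^ (k + 1) / (k + 1)) has_real_derivative x ^ k) (at x)" for x :: real
      by (rule DERIV_cong[OF DERIV_cdivide[OF DERIV_pow]]) simp
  qed (use assms in auto)
  finally show ?thesis by simp
qed

context log_concave_profile begin

text \<open>
  Apply the slope dichotomy with \<open>k = (n - 1) / r\<close>, the logarithmic slope of \<open>t\<^sup>n\<^sup>-\<^sup>1\<close> at \<open>r\<close>. On the side where
  \<open>\<rho>\<close> lies below the exponential, the linear terms cancel and the curvature of \<open>(n - 1) log t\<close>, at least
  \<open>(n - 1) / s\<^sup>2\<close> on \<open>(0, s]\<close>, leaves a Gaussian.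
\<close>

lemma radial_density_gaussian_bound:
  assumes n: "1 \<le> n" and r: "0 < r" "r \<le> s"
  shows "(\<forall>u. r < u \<and> u \<le> s \<longrightarrow> u ^ (n - 1) * \<rho> u \<le> r ^ (n - 1) * \<rho> r * exp (- real (n - 1) * (u - r)\<^sup>2 / (2 * s\<^sup>2)))
    \<or> (\<forall>w. 0 \<le> w \<and> w < r \<longrightarrow> w ^ (n - 1) * \<rho> w \<le> r ^ (n - 1) * \<rho> r * exp (- real (n - 1) * (w - r)\<^sup>2 / (2 * s\<^sup>2)))"
  using slope_dichotomy[OF less_imp_le[OF r(1)], of "real (n - 1) / r"]
proof (elim disj_forward)
  define k where "k = n - 1"
  assume A: "\<forall>u>r. \<rho> u \<le> \<rho> r * exp (- (real (n - 1) / r) * (u - r))"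
  show "\<forall>u. r < u \<and> u \<le> s \<longrightarrow> u ^ (n - 1) * \<rho> u \<le> r ^ (n - 1) * \<rho> r * exp (- real (n - 1) * (u - r)\<^sup>2 / (2 * s\<^sup>2))"
    unfolding k_def[symmetric]
  proof safe
    fix u assume u: "r < u" "u \<le> s"
    define x where "x = u / r - 1"
    have x: "0 \<le> x" "u = r * (1 + x)" using u r by (auto simp: x_def)
    have "(u - r)\<^sup>2 / (2 * (r * u)) = (r\<^sup>2 * x\<^sup>2) / (r\<^sup>2 * (2 * (1 + x)))"
      by (simp add: x(2) power2_eq_square algebra_simps)
    then have "x\<^sup>2 / (2 * (1 + x)) = (u - r)\<^sup>2 / (2 * (r * u))"
      using r by simp
    moreover have "(u - r)\<^sup>2 / (2 * s\<^sup>2) \<le> (u - r)\<^sup>2 / (2 * (r * u))"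
    proof (rule divide_left_mono)
      have "r * u \<le> s * s" using r u by (intro mult_mono) auto
      then show "2 * (r * u) \<le> 2 * s\<^sup>2" by (simp add: power2_eq_square)
      show "0 < 2 * s\<^sup>2 * (2 * (r * u))" using r u by auto
    qed simp
    ultimately have "1 + x \<le> exp (x - (u - r)\<^sup>2 / (2 * s\<^sup>2))"
      using one_plus_le_exp_gaussian[OF x(1)] by (smt (verit) exp_le_cancel_iff)
    then have "(1 + x) ^ k \<le> exp (x - (u - r)\<^sup>2 / (2 * s\<^sup>2)) ^ k"
      using x by (intro power_mono) auto
    also have "\<dots> = exp (real k * (x - (u - r)\<^sup>2 / (2 * s\<^sup>2)))" by (simp add: exp_of_nat_mult)
    finally have 1: "(1 + x) ^ k \<le> exp (real k * (x - (u - r)\<^sup>2 / (2 * s\<^sup>2)))" .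
    have "\<rho> u \<le> \<rho> r * exp (- (real k / r) * (u - r))" using A u by (auto simp: k_def)
    also have "- (real k / r) * (u - r) = - real k * x" using r by (simp add: x_def field_simps)
    finally have 2: "\<rho> u \<le> \<rho> r * exp (- real k * x)" .
    have "u ^ k * \<rho> u = r ^ k * ((1 + x) ^ k * \<rho> u)" by (simp add: x(2) power_mult_distrib)
    also have "\<dots> \<le> r ^ k * (exp (real k * (x - (u - r)\<^sup>2 / (2 * s\<^sup>2))) * (\<rho> r * exp (- real k * x)))"
      using 1 2 r x nonneg[of u] u by (intro mult_left_mono mult_mono) auto
    also have "\<dots> = r ^ k * \<rho> r * (exp (real k * (x - (u - r)\<^sup>2 / (2 * s\<^sup>2))) * exp (- real k * x))"
      by (simp only: mult_ac)
    also have "exp (real k * (x - (u - r)\<^sup>2 / (2 * s\<^sup>2))) * exp (- real k * x) = exp (- real k * (u - r)\<^sup>2 / (2 * s\<^sup>2))"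
      unfolding exp_add[symmetric] by (rule arg_cong[of _ _ exp]) (simp add: algebra_simps)
    finally show "u ^ k * \<rho> u \<le> r ^ k * \<rho> r * exp (- real k * (u - r)\<^sup>2 / (2 * s\<^sup>2))" .
  qed
next
  define k where "k = n - 1"
  assume A: "\<forall>w. 0 \<le> w \<and> w < r \<longrightarrow> \<rho> w \<le> \<rho> r * exp (real (n - 1) / r * (r - w))"
  show "\<forall>w. 0 \<le> w \<and> w < r \<longrightarrow> w ^ (n - 1) * \<rho> w \<le> r ^ (n - 1) * \<rho> r * exp (- real (n - 1) * (w - r)\<^sup>2 / (2 * s\<^sup>2))"
    unfolding k_def[symmetric]
  proof safe
    fix w assume w: "0 \<le> w" "w < r"
    define y where "y = 1 - w / r"
    have y: "0 \<le> y" "y \<le> 1" "w = r * (1 - y)" using w r by (auto simp: y_def)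
    have "(w - r)\<^sup>2 / (2 * r\<^sup>2) = (r\<^sup>2 * y\<^sup>2) / (r\<^sup>2 * 2)"
      by (simp add: y(3) power2_eq_square algebra_simps)
    then have "y\<^sup>2 / 2 = (w - r)\<^sup>2 / (2 * r\<^sup>2)"
      using r by simp
    moreover have "(w - r)\<^sup>2 / (2 * s\<^sup>2) \<le> (w - r)\<^sup>2 / (2 * r\<^sup>2)"
      using r by (intro divide_left_mono) (auto intro: power_mono)
    ultimately have "1 - y \<le> exp (- y - (w - r)\<^sup>2 / (2 * s\<^sup>2))"
      using one_minus_le_exp_gaussian[OF y(1,2)] by (smt (verit) exp_le_cancel_iff)
    then have "(1 - y) ^ k \<le> exp (- y - (w - r)\<^sup>2 / (2 * s\<^sup>2)) ^ k"
      using y by (intro power_mono) auto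
    also have "\<dots> = exp (real k * (- y - (w - r)\<^sup>2 / (2 * s\<^sup>2)))" by (simp add: exp_of_nat_mult)
    finally have 1: "(1 - y) ^ k \<le> exp (real k * (- y - (w - r)\<^sup>2 / (2 * s\<^sup>2)))" .
    have "\<rho> w \<le> \<rho> r * exp (real k / r * (r - w))" using A w by (auto simp: k_def)
    also have "real k / r * (r - w) = real k * y" using r by (simp add: y_def field_simps)
    finally have 2: "\<rho> w \<le> \<rho> r * exp (real k * y)" .
    have "w ^ k * \<rho> w = r ^ k * ((1 - y) ^ k * \<rho> w)" by (simp add: y(3) power_mult_distrib)
    also have "\<dots> \<le> r ^ k * (exp (real k * (- y - (w - r)\<^sup>2 / (2 * s\<^sup>2))) * (\<rho> r * exp (real k * y)))"
      using 1 2 r y nonneg[of w] w by (intro mult_left_mono mult_mono) auto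
    also have "\<dots> = r ^ k * \<rho> r * (exp (real k * (- y - (w - r)\<^sup>2 / (2 * s\<^sup>2))) * exp (real k * y))"
      by (simp only: mult_ac)
    also have "exp (real k * (- y - (w - r)\<^sup>2 / (2 * s\<^sup>2))) * exp (real k * y) = exp (- real k * (w - r)\<^sup>2 / (2 * s\<^sup>2))"
      unfolding exp_add[symmetric] by (rule arg_cong[of _ _ exp]) (simp add: algebra_simps)
    finally show "w ^ k * \<rho> w \<le> r ^ k * \<rho> r * exp (- real k * (w - r)\<^sup>2 / (2 * s\<^sup>2))" .
  qed
qed

end

section \<open>Lebesgue measure and topology in dimension n\<close>

interpretation lborel_prod: product_sigma_finite "\<lambda>_::nat. lborel :: real measure"
  by standard

abbreviation E_n :: "nat \<Rightarrow> (nat \<Rightarrow> real) set" where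
  "E_n n \<equiv> {..<n} \<rightarrow>\<^sub>E UNIV"

text \<open>
  The coordinates from \<open>n\<close> on are reset to \<open>undefined\<close>, so that the map sends everything into the carrier.
\<close>

definition affine_n :: "nat \<Rightarrow> (nat \<Rightarrow> real) \<Rightarrow> real \<Rightarrow> (nat \<Rightarrow> real) \<Rightarrow> (nat \<Rightarrow> real)" where
  "affine_n n a t x = (\<lambda>i\<in>{..<n}. a i + t * x i)"

abbreviation scale_n :: "nat \<Rightarrow> real \<Rightarrow> (nat \<Rightarrow> real) \<Rightarrow> (nat \<Rightarrow> real)" where
  "scale_n n t x \<equiv> affine_n n (\<lambda>_. 0) t x"

lemma affine_n_in [simp]: "affine_n n a t x \<in> E_n n"
  by (simp add: affine_n_def)

lemma affine_n_nth [simp]: "i < n \<Longrightarrow> affine_n n a t x i = a i + t * x i"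
  by (simp add: affine_n_def)

lemma scale_scale [simp]: "scale_n n s (scale_n n t x) = scale_n n (s * t) x"
  by (auto simp: affine_n_def restrict_def)

lemma scale_one: "x \<in> E_n n \<Longrightarrow> scale_n n 1 x = x"
  by (auto simp: affine_n_def restrict_def PiE_def extensional_def)

lemma E_n_eqI: "x \<in> E_n n \<Longrightarrow> y \<in> E_n n \<Longrightarrow> (\<And>i. i < n \<Longrightarrow> x i = y i) \<Longrightarrow> x = y"
  by (rule PiE_ext) auto

lemma space_lborel_n [simp]: "space (lborel_n n) = E_n n"
  by (simp add: lborel_n_def space_PiM)

lemma topspace_euclid_top [simp]: "topspace (euclid_top n) = E_n n"
  by (simp add: euclid_top_def)

lemma sigma_finite_lborel_n: "sigma_finite_measure (lborel_n n)"
  unfolding lborel_n_def by (rule lborel_prod.sigma_finite) simp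

interpretation lborel_n: sigma_finite_measure "lborel_n n" for n
  by (rule sigma_finite_lborel_n)

lemma measurable_nth_lborel_n [measurable (raw)]: "i < n \<Longrightarrow> (\<lambda>x. x i) \<in> borel_measurable (lborel_n n)"
  unfolding lborel_n_def by simp

lemma measurable_lborel_nI:
  assumes "\<And>i. i < n \<Longrightarrow> (\<lambda>x. f x i) \<in> borel_measurable M" "\<And>x. x \<in> space M \<Longrightarrow> f x \<in> E_n n"
  shows "f \<in> M \<rightarrow>\<^sub>M lborel_n n"
  unfolding lborel_n_def using assms
  by (intro measurable_PiM_single') (auto simp: space_PiM)

lemma measurable_affine_n [measurable]:
  assumes f: "f \<in> borel_measurable M" and g: "g \<in> M \<rightarrow>\<^sub>M lborel_n n"
  shows "(\<lambda>x. affine_n n a (f x) (g x)) \<in> M \<rightarrow>\<^sub>M lborel_n n"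
proof (rule measurable_lborel_nI)
  fix i assume i: "i < n"
  have "(\<lambda>x. g x i) \<in> borel_measurable M"
    using measurable_compose[OF g measurable_nth_lborel_n[OF i]] by simp
  then show "(\<lambda>x. affine_n n a (f x) (g x) i) \<in> borel_measurable M"
    using i f by simp
qed simp

text \<open>
  Both sides agree on boxes, where the claim is the one-dimensional change of variables in each factor.
\<close>

lemma lborel_n_affine:
  assumes t: "t \<noteq> 0"
  shows "lborel_n n = density (distr (lborel_n n) (lborel_n n) (affine_n n a t)) (\<lambda>_. ennreal (\<bar>t\<bar> ^ n))"
    (is "_ = ?P")
proof -
  have [measurable]: "affine_n n a t \<in> lborel_n n \<rightarrow>\<^sub>M lborel_n n"
    using measurable_affine_n[of "\<lambda>_. t" "lborel_n n" "\<lambda>x. x"] by simp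
  have "?P = Pi\<^sub>M {..<n} (\<lambda>_. lborel)"
  proof (rule lborel_prod.PiM_eqI)
    fix A :: "nat \<Rightarrow> real set" assume "\<And>i. i \<in> {..<n} \<Longrightarrow> A i \<in> sets lborel"
    then have A: "A i \<in> sets borel" if "i < n" for i using that by simp
    have AE: "Pi\<^sub>E {..<n} A \<in> sets (lborel_n n)"
      unfolding lborel_n_def using A by (intro sets_PiM_I_finite) auto
    have v: "affine_n n a t -` Pi\<^sub>E {..<n} A \<inter> space (lborel_n n) = Pi\<^sub>E {..<n} (\<lambda>i. (\<lambda>x. a i + t * x) -` A i)"
      by (auto simp: affine_n_def PiE_iff)
    have one: "emeasure lborel (A i) = ennreal \<bar>t\<bar> * emeasure lborel ((\<lambda>x. a i + t * x) -` A i)" if "i < n" for i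
    proof -
      have "emeasure lborel (A i) = (\<integral>\<^sup>+x. indicator (A i) x \<partial>lborel)" using A[OF that] by simp
      also have "\<dots> = ennreal \<bar>t\<bar> * (\<integral>\<^sup>+x. indicator (A i) (a i + t * x) \<partial>lborel)"
        using A[OF that] t by (intro nn_integral_real_affine) auto
      also have "(\<integral>\<^sup>+x. indicator (A i) (a i + t * x) \<partial>lborel) = (\<integral>\<^sup>+x. indicator ((\<lambda>x. a i + t * x) -` A i) x \<partial>lborel)"
        by (intro nn_integral_cong) (auto simp: indicator_def)
      also have "\<dots> = emeasure lborel ((\<lambda>x. a i + t * x) -` A i)"
        using A[OF that] by (intro nn_integral_indicator) (auto intro!: measurable_sets_borel[where M=borel])
      finally show ?thesis .
    qed
    have "emeasure ?P (Pi\<^sub>E {..<n} A) = ennreal (\<bar>t\<bar> ^ n) * emeasure (lborel_n n) (Pi\<^sub>E {..<n} (\<lambda>i. (\<lambda>x. a i + t * x) -` A i))"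
      using AE by (simp add: emeasure_density nn_integral_cmult_indicator emeasure_distr v[simplified])
    also have "emeasure (lborel_n n) (Pi\<^sub>E {..<n} (\<lambda>i. (\<lambda>x. a i + t * x) -` A i)) = (\<Prod>i<n. emeasure lborel ((\<lambda>x. a i + t * x) -` A i))"
      unfolding lborel_n_def using A
      by (intro lborel_prod.emeasure_PiM) (auto intro!: measurable_sets_borel[where M=borel])
    also have "ennreal (\<bar>t\<bar> ^ n) * (\<Prod>i<n. emeasure lborel ((\<lambda>x. a i + t * x) -` A i)) = (\<Prod>i<n. emeasure lborel (A i))"
      by (simp add: one prod.distrib ennreal_power)
    finally show "emeasure ?P (Pi\<^sub>E {..<n} A) = (\<Prod>i<n. emeasure lborel (A i))" .
  qed (auto simp: lborel_n_def)
  then show ?thesis by (simp add: lborel_n_def)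
qed

lemma nn_integral_affine_n:
  assumes t: "t \<noteq> 0" and F[measurable]: "F \<in> borel_measurable (lborel_n n)"
  shows "(\<integral>\<^sup>+x. F x \<partial>lborel_n n) = ennreal (\<bar>t\<bar> ^ n) * (\<integral>\<^sup>+x. F (affine_n n a t x) \<partial>lborel_n n)"
proof -
  have [measurable]: "affine_n n a t \<in> lborel_n n \<rightarrow>\<^sub>M lborel_n n"
    using measurable_affine_n[of "\<lambda>_. t" "lborel_n n" "\<lambda>x. x"] by simp
  show ?thesis
    by (subst lborel_n_affine[OF t, of n a]) (simp add: nn_integral_density nn_integral_distr nn_integral_cmult)
qed

lemma continuous_map_restrict_euclid:
  "continuous_map euclidean (euclid_top n) (\<lambda>x. restrict x {..<n})"
  unfolding euclid_top_def euclidean_product_topology[symmetric]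
  by (auto simp: continuous_map_componentwise
      intro!: continuous_map_product_projection[where X="\<lambda>_. euclideanreal", simplified])

text \<open>
  Padding by zeros embeds the carrier into the type of all sequences, whose topology and Borel sets are those
  of the countable product. Borel measurability of continuous functions and of closed sets is pulled back
  along this embedding.
\<close>

lemma measurable_extend_n:
  "(\<lambda>x i. if i < n then x i else 0) \<in> lborel_n n \<rightarrow>\<^sub>M (borel :: (nat \<Rightarrow> real) measure)"
proof -
  have "(\<lambda>x i. if i < n then x i else 0) \<in> lborel_n n \<rightarrow>\<^sub>M Pi\<^sub>M UNIV (\<lambda>_::nat. borel :: real measure)"
  proof (rule measurable_PiM_single')
    show "(\<lambda>x. if i < n then x i else 0) \<in> lborel_n n \<rightarrow>\<^sub>M borel" for i
      by (cases "i < n") (auto intro: measurable_nth_lborel_n)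
  qed auto
  then show ?thesis by (simp add: measurable_cong_sets[OF refl sets_PiM_equal_borel])
qed

lemma restrict_extend_n: "x \<in> E_n n \<Longrightarrow> restrict (\<lambda>i. if i < n then x i else 0) {..<n} = x"
  by (auto simp: PiE_def extensional_def restrict_def)

lemma measurable_continuous_map:
  assumes "continuous_map (euclid_top n) euclideanreal f"
  shows "f \<in> borel_measurable (lborel_n n)"
proof -
  have "continuous_map euclidean euclideanreal (f \<circ> (\<lambda>x. restrict x {..<n}))"
    by (rule continuous_map_compose[OF continuous_map_restrict_euclid assms])
  then have "f \<circ> (\<lambda>x. restrict x {..<n}) \<in> borel_measurable borel"
    by (intro borel_measurable_continuous_onI) simp
  from measurable_compose[OF measurable_extend_n this]
  show ?thesis
    by (rule measurable_cong[THEN iffD1, rotated]) (simp add: restrict_extend_n)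
qed

lemma sets_closedin:
  assumes "closedin (euclid_top n) S"
  shows "S \<in> sets (lborel_n n)"
proof -
  have "closed {x. restrict x {..<n} \<in> S}"
    using closedin_continuous_map_preimage[OF continuous_map_restrict_euclid assms] by simp
  then have "{x. restrict x {..<n} \<in> S} \<in> sets borel" by (rule borel_closed)
  from measurable_sets[OF measurable_extend_n this]
  have "(\<lambda>x i. if i < n then x i else 0) -` {x. restrict x {..<n} \<in> S} \<inter> E_n n \<in> sets (lborel_n n)" by simp
  also have "(\<lambda>x i. if i < n then x i else 0) -` {x. restrict x {..<n} \<in> S} \<inter> E_n n = S"
    using closedin_subset[OF assms] by (auto simp: restrict_extend_n)
  finally show ?thesis .
qed

lemma openin_euclid_box:
  assumes "openin (euclid_top n) U" "z \<in> U"
  obtains e where "0 < e" "{x \<in> E_n n. \<forall>i<n. \<bar>x i - z i\<bar> \<le> e} \<subseteq> U"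
proof -
  obtain V where V: "\<And>i. i < n \<Longrightarrow> open (V i)" "z \<in> Pi\<^sub>E {..<n} V" "Pi\<^sub>E {..<n} V \<subseteq> U"
    using assms unfolding euclid_top_def openin_product_topology_alt by (auto, meson lessThan_iff)
  have "\<exists>e>0. \<forall>y. \<bar>y - z i\<bar> < e \<longrightarrow> y \<in> V i" if "i < n" for i
    using V(1)[OF that] V(2) that unfolding open_dist dist_real_def by auto
  then obtain e where e: "\<And>i. i < n \<Longrightarrow> 0 < e i" "\<And>i y. i < n \<Longrightarrow> \<bar>y - z i\<bar> < e i \<Longrightarrow> y \<in> V i"
    by metis
  define d where "d = Min (insert 1 (e ` {..<n}))"
  have d: "d \<le> e i" if "i < n" for i using that by (auto simp: d_def)
  have "0 < d" using e(1) by (auto simp: d_def)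
  moreover have "{x \<in> E_n n. \<forall>i<n. \<bar>x i - z i\<bar> \<le> d / 2} \<subseteq> U"
  proof safe
    fix x assume x: "x \<in> E_n n" "\<forall>i<n. \<bar>x i - z i\<bar> \<le> d / 2"
    have "x i \<in> V i" if "i < n" for i
    proof (rule e(2)[OF that])
      have "\<bar>x i - z i\<bar> \<le> d / 2" using x(2) that by blast
      also have "\<dots> < e i" using d[OF that] \<open>0 < d\<close> by simp
      finally show "\<bar>x i - z i\<bar> < e i" .
    qed
    then show "x \<in> U" using V(3) x(1) by (auto simp: PiE_def)
  qed
  ultimately show thesis using that[of "d / 2"] by simp
qed

lemma emeasure_box_n:
  assumes "0 \<le> e"
  shows "{x \<in> E_n n. \<forall>i<n. \<bar>x i - z i\<bar> \<le> e} \<in> sets (lborel_n n)"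
    and "emeasure (lborel_n n) {x \<in> E_n n. \<forall>i<n. \<bar>x i - z i\<bar> \<le> e} = ennreal ((2 * e) ^ n)"
proof -
  have eq: "{x \<in> E_n n. \<forall>i<n. \<bar>x i - z i\<bar> \<le> e} = Pi\<^sub>E {..<n} (\<lambda>i. {z i - e..z i + e})"
    by (auto simp: PiE_def abs_le_iff Pi_def)
  show "{x \<in> E_n n. \<forall>i<n. \<bar>x i - z i\<bar> \<le> e} \<in> sets (lborel_n n)"
    unfolding eq lborel_n_def by (intro sets_PiM_I_finite) auto
  show "emeasure (lborel_n n) {x \<in> E_n n. \<forall>i<n. \<bar>x i - z i\<bar> \<le> e} = ennreal ((2 * e) ^ n)"
    unfolding eq lborel_n_def using assms
    by (subst lborel_prod.emeasure_PiM) (auto simp: ennreal_power emeasure_lborel_Icc)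
qed

section \<open>Convex bodies with barycentre at the origin\<close>

lemma closedin_convex_body: "convex_body n B \<Longrightarrow> closedin (euclid_top n) B"
  unfolding convex_body_def euclid_top_def
  by (intro compactin_imp_closedin) (auto simp: Hausdorff_space_product_topology)

lemma convex_body_subset: "convex_body n B \<Longrightarrow> B \<subseteq> E_n n"
  using closedin_subset[OF closedin_convex_body] by simp

lemma sets_convex_body: "convex_body n B \<Longrightarrow> B \<in> sets (lborel_n n)"
  by (intro sets_closedin closedin_convex_body)

lemma continuous_map_nth: "i < n \<Longrightarrow> continuous_map (euclid_top n) euclideanreal (\<lambda>x. x i)"
  unfolding euclid_top_def by (rule continuous_map_product_projection[where X="\<lambda>_. euclideanreal", simplified]) simp

lemma convex_body_bounded:
  assumes "convex_body n B"
  obtains K where "0 < K" "\<forall>x\<in>B. \<forall>i<n. \<bar>x i\<bar> \<le> K"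
proof -
  have "\<exists>K. \<forall>x\<in>B. \<bar>x i\<bar> \<le> K" if "i < n" for i
  proof -
    have "compactin (euclid_top n) B" using assms by (simp add: convex_body_def)
    then have "compactin euclideanreal ((\<lambda>x. x i) ` B)"
      by (rule image_compactin[OF _ continuous_map_nth[OF that]])
    then have "bounded ((\<lambda>x. x i) ` B)" by (simp add: compact_imp_bounded)
    then show ?thesis by (auto simp: bounded_real)
  qed
  then obtain K where K: "\<And>i x. i < n \<Longrightarrow> x \<in> B \<Longrightarrow> \<bar>x i\<bar> \<le> K i" by metis
  define L where "L = Max (insert 1 (K ` {..<n}))"
  have L: "K i \<le> L" if "i < n" for i using that by (auto simp: L_def)
  show thesis
  proof (rule that[of L])
    show "0 < L" by (auto simp: L_def Max_gr_iff)
    show "\<forall>x\<in>B. \<forall>i<n. \<bar>x i\<bar> \<le> L"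
      using K L by (meson order_trans)
  qed
qed

lemma convex_body_interior_box:
  assumes "convex_body n B"
  obtains z e where "z \<in> E_n n" "0 < e" "{x \<in> E_n n. \<forall>i<n. \<bar>x i - z i\<bar> \<le> e} \<subseteq> B"
proof -
  obtain z where z: "z \<in> euclid_top n interior_of B" using assms by (auto simp: convex_body_def)
  obtain e where e: "0 < e" "{x \<in> E_n n. \<forall>i<n. \<bar>x i - z i\<bar> \<le> e} \<subseteq> euclid_top n interior_of B"
    by (rule openin_euclid_box[OF openin_interior_of z])
  have "z \<in> E_n n" using z interior_of_subset_topspace[of "euclid_top n" B] by auto
  then show thesis using e that[of z e] interior_of_subset[of "euclid_top n" B] by (meson subset_trans)
qed

lemma emeasure_convex_body:
  assumes "convex_body n B"
  shows "emeasure (lborel_n n) B = ennreal (measure (lborel_n n) B)" "0 < measure (lborel_n n) B"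
proof -
  obtain K where K: "0 < K" "\<forall>x\<in>B. \<forall>i<n. \<bar>x i\<bar> \<le> K"
    by (rule convex_body_bounded[OF assms])
  have "emeasure (lborel_n n) B \<le> emeasure (lborel_n n) {x \<in> E_n n. \<forall>i<n. \<bar>x i - (\<lambda>_. 0) i\<bar> \<le> K}"
    using K convex_body_subset[OF assms] by (intro emeasure_mono emeasure_box_n) auto
  also have "\<dots> = ennreal ((2 * K) ^ n)" using K by (intro emeasure_box_n) simp
  also have "\<dots> < \<infinity>" by simp
  finally have fin: "emeasure (lborel_n n) B < \<infinity>" .
  then show 1: "emeasure (lborel_n n) B = ennreal (measure (lborel_n n) B)"
    by (simp add: emeasure_eq_ennreal_measure)
  obtain z e where "z \<in> E_n n" and e: "0 < e" "{x \<in> E_n n. \<forall>i<n. \<bar>x i - z i\<bar> \<le> e} \<subseteq> B"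
    by (rule convex_body_interior_box[OF assms])
  have "ennreal ((2 * e) ^ n) = emeasure (lborel_n n) {x \<in> E_n n. \<forall>i<n. \<bar>x i - z i\<bar> \<le> e}"
    using e by (intro emeasure_box_n(2)[symmetric]) simp
  also have "\<dots> \<le> emeasure (lborel_n n) B"
    by (intro emeasure_mono sets_convex_body assms e(2))
  finally have "ennreal ((2 * e) ^ n) \<le> ennreal (measure (lborel_n n) B)" by (simp only: 1)
  then have "(2 * e) ^ n \<le> measure (lborel_n n) B" by (simp add: ennreal_le_iff)
  moreover have "0 < (2 * e) ^ n" using e by simp
  ultimately show "0 < measure (lborel_n n) B" by linarith
qed

lemma integrable_on_bounded_set:
  assumes "W \<in> sets M" "emeasure M W < \<infinity>" "f \<in> borel_measurable M" "\<And>x. x \<in> W \<Longrightarrow> \<bar>f x\<bar> \<le> (K::real)"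
  shows "integrable M (\<lambda>x. indicator W x * f x)"
  using integrableI_bounded_set_indicator[of W M f K] assms by simp

lemma convex_n_mem:
  assumes "convex_n n S" "x \<in> S" "y \<in> S" "0 \<le> u" "u \<le> 1"
  shows "(\<lambda>i\<in>{..<n}. u * x i + (1 - u) * y i) \<in> S"
  using assms unfolding convex_n_def by auto

text \<open>
  Let \<open>p\<close> be the point of \<open>B\<close> nearest to the mean \<open>q\<close>. Every \<open>y\<close> in \<open>B\<close> satisfies \<open>\<langle>p - q, y - p\<rangle> \<ge> 0\<close>, and
  integrating over \<open>W\<close> gives \<open>- |p - q|\<^sup>2 \<ge> 0\<close>.
\<close>

lemma mean_in_compact_convex:
  assumes comp: "compactin (euclid_top n) B" and conv: "convex_n n B" and q: "q \<in> E_n n"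
    and W: "W \<in> sets (lborel_n n)" "W \<subseteq> B" "emeasure (lborel_n n) W < \<infinity>" "0 < measure (lborel_n n) W"
    and int: "\<And>i. i < n \<Longrightarrow> integrable (lborel_n n) (\<lambda>x. indicator W x * x i)"
    and mean: "\<And>i. i < n \<Longrightarrow> (\<integral>x. indicator W x * x i \<partial>lborel_n n) = measure (lborel_n n) W * q i"
  shows "q \<in> B"
proof -
  define d where "d x = (\<Sum>i<n. (x i - q i)\<^sup>2)" for x :: "nat \<Rightarrow> real"
  define m where "m = measure (lborel_n n) W"
  have "continuous_map (euclid_top n) euclideanreal d"
    unfolding d_def by (intro continuous_map_sum continuous_map_real_pow continuous_map_diff continuous_map_nth) auto
  then have "compact (d ` B)" using image_compactin[OF comp] by fastforce
  moreover have "B \<noteq> {}" using W by (metis measure_empty order_less_irrefl subset_empty)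
  ultimately obtain p where p: "p \<in> B" "\<And>x. x \<in> B \<Longrightarrow> d p \<le> d x"
    using compact_attains_inf[of "d ` B"] by auto
  have pE: "p \<in> E_n n" using p compactin_subset_topspace[OF comp] by auto
  have pos: "0 \<le> (\<Sum>i<n. (p i - q i) * (y i - p i))" if y: "y \<in> B" for y
  proof (rule ccontr)
    define a where "a = (\<Sum>i<n. (p i - q i) * (y i - p i))"
    define b where "b = (\<Sum>i<n. (y i - p i)\<^sup>2)"
    assume "\<not> ?thesis"
    then have a: "a < 0" by (simp add: a_def)
    have b: "0 \<le> b" unfolding b_def by (intro sum_nonneg) simp
    have ineq: "0 \<le> 2 * s * a + s\<^sup>2 * b" if s: "0 \<le> s" "s \<le> 1" for s
    proof -
      have "d p \<le> d (\<lambda>i\<in>{..<n}. s * y i + (1 - s) * p i)"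
        by (intro p(2) convex_n_mem conv y p s)
      also have "\<dots> = (\<Sum>i<n. (p i - q i)\<^sup>2 + 2 * s * ((p i - q i) * (y i - p i)) + s\<^sup>2 * (y i - p i)\<^sup>2)"
        unfolding d_def by (intro sum.cong refl) (simp add: power2_eq_square algebra_simps)
      also have "\<dots> = d p + 2 * s * a + s\<^sup>2 * b"
        by (simp add: sum.distrib sum_distrib_left a_def b_def d_def)
      finally show ?thesis by simp
    qed
    define s where "s = min 1 (- a / (b + 1))"
    have s: "0 < s" "s \<le> 1" using a b divide_neg_pos[of a "b + 1"] by (auto simp: s_def)
    have "s \<le> - a / (b + 1)" by (simp add: s_def)
    then have "s * (b + 1) \<le> - a" using b by (intro pos_le_divide_eq[THEN iffD1]) auto
    then have "s * b \<le> - a" using s by (simp add: algebra_simps)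
    then have "s * (2 * a + s * b) < 0" using s a by (intro mult_pos_neg) auto
    then show False using ineq[of s] s by (simp add: algebra_simps power2_eq_square)
  qed
  have i1: "integrable (lborel_n n) (\<lambda>x. indicator W x * (c::real))" for c
    using W by (auto intro!: integrable_mult_left integrable_real_indicator)
  have WE: "W \<inter> E_n n = W" using sets.sets_into_space[OF W(1)] by auto
  have e1: "indicator W x * (\<Sum>i<n. (p i - q i) * (x i - p i))
      = (\<Sum>i<n. (p i - q i) * (indicator W x * x i) - indicator W x * ((p i - q i) * p i))" for x
    by (simp add: sum_distrib_left algebra_simps)
  have "0 \<le> (\<integral>x. indicator W x * (\<Sum>i<n. (p i - q i) * (x i - p i)) \<partial>lborel_n n)"
    using pos W(2) by (intro integral_nonneg_AE AE_I2) (auto simp: indicator_def)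
  also have "\<dots> = (\<Sum>i<n. (p i - q i) * (m * q i) - m * ((p i - q i) * p i))"
    unfolding e1 using int i1 W
    by (subst Bochner_Integration.integral_sum) (auto simp: mean m_def WE)
  also have "\<dots> = - m * (\<Sum>i<n. (p i - q i)\<^sup>2)"
    by (simp add: sum_distrib_left sum_negf[symmetric] power2_eq_square algebra_simps)
  finally have "(\<Sum>i<n. (p i - q i)\<^sup>2) \<le> 0" using W(4) by (simp add: m_def mult_le_0_iff)
  then have "(\<Sum>i<n. (p i - q i)\<^sup>2) = 0" by (intro antisym sum_nonneg) auto
  then have "p i = q i" if "i < n" for i using that by (subst (asm) sum_nonneg_eq_0_iff) auto
  then have "p = q" by (rule E_n_eqI[OF pE q])
  then show ?thesis using p by simp
qed

text \<open>
  Take a small cube \<open>U\<close> inside \<open>B\<close> and let \<open>u\<close> and \<open>q\<close> be the means over \<open>U\<close> and over \<open>B - U\<close>. Both lie in \<open>B\<close>, the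
  point \<open>u\<close> even with a neighbourhood, and since the barycentre of \<open>B\<close> is \<open>0\<close>, the origin is a proper convex
  combination of \<open>u\<close> and \<open>q\<close>. Hence it is an interior point.
\<close>

lemma convex_body_centred_box:
  assumes body: "convex_body n B" and n: "1 \<le> n"
    and mean0: "\<And>i. i < n \<Longrightarrow> (\<integral>x. indicator B x * x i \<partial>lborel_n n) = 0"
  obtains e where "0 < e" "{x \<in> E_n n. \<forall>i<n. \<bar>x i\<bar> \<le> e} \<subseteq> B"
proof -
  let ?M = "lborel_n n"
  obtain K where K: "0 < K" "\<forall>x\<in>B. \<forall>i<n. \<bar>x i\<bar> \<le> K"
    by (rule convex_body_bounded[OF body])
  obtain z e where z: "z \<in> E_n n" and e: "0 < e" "{x \<in> E_n n. \<forall>i<n. \<bar>x i - z i\<bar> \<le> e} \<subseteq> B"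
    by (rule convex_body_interior_box[OF body])
  \<comment> \<open>half the size of a cube in \<open>B\<close>: then \<open>B - U\<close> has positive measure and the mean over \<open>U\<close> has room around it\<close>
  define U where "U = {x \<in> E_n n. \<forall>i<n. \<bar>x i - z i\<bar> \<le> e / 2}"
  define U' where "U' = {x \<in> E_n n. \<forall>i<n. \<bar>x i - z i\<bar> \<le> e}"
  have U: "U \<in> sets ?M" "emeasure ?M U = ennreal ((2 * (e / 2)) ^ n)"
    unfolding U_def using e by (intro emeasure_box_n, simp)+
  have U': "U' \<in> sets ?M" "emeasure ?M U' = ennreal ((2 * e) ^ n)"
    unfolding U'_def using e by (intro emeasure_box_n, simp)+
  have "U \<subseteq> U'"
  proof
    fix x assume x: "x \<in> U"
    have "\<bar>x i - z i\<bar> \<le> e" if "i < n" for i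
    proof -
      have "\<bar>x i - z i\<bar> \<le> e / 2" using x that unfolding U_def by blast
      then show ?thesis using e(1) by simp
    qed
    then show "x \<in> U'" using x unfolding U_def U'_def by blast
  qed
  moreover have "U' \<subseteq> B" using e(2) by (simp add: U'_def)
  ultimately have UB: "U \<subseteq> U'" "U' \<subseteq> B" .
  have BM: "B \<in> sets ?M" by (rule sets_convex_body[OF body])
  have UE: "U \<inter> E_n n = U" by (auto simp: U_def)
  define W where "W = B - U"
  have W: "W \<in> sets ?M" using BM U by (simp add: W_def)
  have finB: "emeasure ?M B < \<infinity>" using emeasure_convex_body(1)[OF body] by simp
  have fin: "emeasure ?M S < \<infinity>" if "S \<subseteq> B" for S
    using emeasure_mono[OF that BM] finB by (rule le_less_trans)
  define mU where "mU = measure ?M U"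
  define mW where "mW = measure ?M W"
  define mB where "mB = measure ?M B"
  have mU: "mU = e ^ n" unfolding mU_def measure_def U(2) using e by simp
  then have mU0: "0 < mU" using e by simp
  have mB: "mB = mU + mW"
    unfolding mB_def mU_def mW_def W_def
    using measure_Diff[of ?M B U] fin[of B] UB BM U by (simp add: measure_Diff less_top)
  have "(2 * e) ^ n \<le> mB"
  proof -
    have "ennreal ((2 * e) ^ n) \<le> ennreal mB"
      using emeasure_mono[OF UB(2) BM] unfolding U'(2) emeasure_convex_body(1)[OF body] mB_def .
    then show ?thesis by (simp add: mB_def)
  qed
  moreover have "e ^ n < (2 * e) ^ n" using e n by (intro power_strict_mono) auto
  ultimately have mW0: "0 < mW" using mB mU by linarith
  have int: "integrable ?M (\<lambda>x. indicator S x * x i)" if "S \<in> sets ?M" "S \<subseteq> B" "i < n" for S i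
    using that K fin[OF that(2)] by (intro integrable_on_bounded_set[where K=K]) (auto intro: measurable_nth_lborel_n)
  define u where "u = (\<lambda>i\<in>{..<n}. (\<integral>x. indicator U x * x i \<partial>?M) / mU)"
  define q where "q = (\<lambda>i\<in>{..<n}. (\<integral>x. indicator W x * x i \<partial>?M) / mW)"
  have q: "q \<in> B"
  proof (rule mean_in_compact_convex)
    show "compactin (euclid_top n) B" "convex_n n B" using body by (auto simp: convex_body_def)
    show "q \<in> E_n n" by (simp add: q_def)
    show "W \<in> sets ?M" "W \<subseteq> B" "emeasure ?M W < \<infinity>" "0 < measure ?M W"
      using W fin[of W] mW0 by (auto simp: W_def mW_def)
    show "integrable ?M (\<lambda>x. indicator W x * x i)" if "i < n" for i
      using that W by (intro int) (auto simp: W_def)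
    show "(\<integral>x. indicator W x * x i \<partial>?M) = measure ?M W * q i" if "i < n" for i
      using that mW0 by (simp add: q_def mW_def)
  qed
  have balance: "mU * u i + mW * q i = 0" if i: "i < n" for i
  proof -
    have "(\<integral>x. indicator B x * x i \<partial>?M) = (\<integral>x. indicator U x * x i + indicator W x * x i \<partial>?M)"
      using UB by (intro Bochner_Integration.integral_cong) (auto simp: W_def indicator_def)
    also have "\<dots> = (\<integral>x. indicator U x * x i \<partial>?M) + (\<integral>x. indicator W x * x i \<partial>?M)"
      using int[of U i] int[of W i] U W UB i by (intro Bochner_Integration.integral_add) (auto simp: W_def)
    finally show ?thesis using mean0[OF i] mU0 mW0 i by (simp add: u_def q_def)
  qed
  have uz: "\<bar>u i - z i\<bar> \<le> e / 2" if i: "i < n" for i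
  proof -
    have "(\<integral>x. indicator U x * x i \<partial>?M) - z i * mU = (\<integral>x. indicator U x * x i - z i * indicator U x \<partial>?M)"
      using int[of U i] U UB i fin[of U] by (subst Bochner_Integration.integral_diff) (auto simp: mU_def UE)
    also have "\<bar>\<dots>\<bar> \<le> (\<integral>x. e / 2 * indicator U x \<partial>?M)"
    proof (rule order_trans[OF integral_abs_bound] , rule integral_mono)
      show "integrable ?M (\<lambda>x. \<bar>indicator U x * x i - z i * indicator U x\<bar>)"
        using int[of U i] U UB i fin[of U] by (intro integrable_abs Bochner_Integration.integrable_diff) auto
      show "integrable ?M (\<lambda>x. e / 2 * indicator U x)" using U fin[of U] UB by auto
      show "\<bar>indicator U x * x i - z i * indicator U x\<bar> \<le> e / 2 * indicator U x" for x
        using i by (auto simp: U_def indicator_def)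
    qed
    also have "\<dots> = e / 2 * mU" using U by (simp add: mU_def UE)
    finally have "\<bar>(\<integral>x. indicator U x * x i \<partial>?M) - z i * mU\<bar> \<le> e / 2 * mU" .
    then have "\<bar>(\<integral>x. indicator U x * x i \<partial>?M) - z i * mU\<bar> / mU \<le> e / 2"
      using mU0 by (simp add: divide_le_eq)
    moreover have "u i - z i = ((\<integral>x. indicator U x * x i \<partial>?M) - z i * mU) / mU"
      using i mU0 by (simp add: u_def field_simps)
    ultimately show ?thesis using mU0 by (simp add: abs_divide)
  qed
  \<comment> \<open>the weight of \<open>u\<close> in the convex combination that represents the origin\<close>
  define b where "b = mU / mB"
  have b: "0 < b" "b \<le> 1" "1 - b = mW / mB" using mU0 mW0 mB by (auto simp: b_def field_simps)
  have mB0: "0 < mB" using mB mU0 mW0 by simp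
  show thesis
  proof (rule that[of "b * e / 2"])
    show "0 < b * e / 2" using b e(1) by simp
    show "{x \<in> E_n n. \<forall>i<n. \<bar>x i\<bar> \<le> b * e / 2} \<subseteq> B"
    proof safe
      fix x assume xE: "x \<in> E_n n" and x: "\<forall>i<n. \<bar>x i\<bar> \<le> b * e / 2"
      let ?y = "\<lambda>i\<in>{..<n}. u i + x i / b"
      have "\<bar>?y i - z i\<bar> \<le> e" if i: "i < n" for i
      proof -
        have "\<bar>x i\<bar> \<le> b * e / 2" using x i by blast
        then have "\<bar>x i / b\<bar> \<le> e / 2" using b(1) by (simp add: abs_divide divide_le_eq mult.commute)
        moreover have "?y i - z i = (u i - z i) + x i / b" using i by simp
        ultimately show ?thesis using uz[OF i] by linarith
      qed
      then have "?y \<in> {x \<in> E_n n. \<forall>i<n. \<bar>x i - z i\<bar> \<le> e}" by simp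
      then have y: "?y \<in> B" using e(2) by (rule rev_subsetD)
      have "convex_n n B" using body by (simp add: convex_body_def)
      from convex_n_mem[OF this y q] b(1,2)
      have "(\<lambda>i\<in>{..<n}. b * ?y i + (1 - b) * q i) \<in> B" by simp
      also have "(\<lambda>i\<in>{..<n}. b * ?y i + (1 - b) * q i) = x"
      proof (rule E_n_eqI)
        fix i assume i: "i < n"
        have "b * u i + (1 - b) * q i = (mU * u i + mW * q i) / mB"
          unfolding b(3) by (simp add: b_def add_divide_distrib)
        then have "b * u i + (1 - b) * q i = 0" using balance[OF i] by simp
        then show "(\<lambda>i\<in>{..<n}. b * ?y i + (1 - b) * q i) i = x i"
          using i b(1) by (simp add: distrib_left)
      qed (use xE in auto)
      finally show "x \<in> B" .
    qed
  qed
qed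

lemma uniform_on_body_density:
  assumes "convex_body n B"
  shows "uniform_on_body n B = density (lborel_n n) (\<lambda>x. ennreal (indicator B x / measure (lborel_n n) B))"
  unfolding uniform_on_body_def uniform_measure_def emeasure_convex_body(1)[OF assms]
  using emeasure_convex_body(2)[OF assms]
  by (intro arg_cong[of _ _ "density (lborel_n n)"] ext)
     (simp add: divide_ennreal[symmetric] ennreal_indicator)

lemma integral_uniform_on_body:
  assumes "convex_body n B" "f \<in> borel_measurable (lborel_n n)"
  shows "(\<integral>x. f x \<partial>uniform_on_body n B) = (\<integral>x. indicator B x * (f x :: real) \<partial>lborel_n n) / measure (lborel_n n) B"
  unfolding uniform_on_body_density[OF assms(1)] using assms sets_convex_body[OF assms(1)]
  by (subst integral_density) (auto simp: mult.commute)

lemma nn_integral_uniform_on_body: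
  assumes "convex_body n B" "f \<in> borel_measurable (lborel_n n)"
  shows "(\<integral>\<^sup>+x. f x \<partial>uniform_on_body n B) = (\<integral>\<^sup>+x\<in>B. f x \<partial>lborel_n n) / measure (lborel_n n) B"
  unfolding uniform_on_body_def using assms sets_convex_body[OF assms(1)]
  by (simp add: nn_integral_uniform_measure emeasure_convex_body(1))

lemma inner_n_measurable [measurable]: "(\<lambda>x. inner_n m x v) \<in> borel_measurable (lborel_n m)"
  unfolding inner_n_def by (intro borel_measurable_sum borel_measurable_times measurable_nth_lborel_n) auto

lemma norm_n_sq_sum: "(norm_n m x)\<^sup>2 = (\<Sum>i<m. (x i)\<^sup>2)"
  unfolding norm_n_def inner_n_def by (subst real_sqrt_pow2) (auto intro: sum_nonneg simp: power2_eq_square)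

lemma norm_sq_measurable [measurable]: "(\<lambda>x. (norm_n m x)\<^sup>2) \<in> borel_measurable (lborel_n m)"
  unfolding norm_n_sq_sum by (intro borel_measurable_sum borel_measurable_power measurable_nth_lborel_n) auto

section \<open>Gauge and radial projection\<close>

locale isotropic_convex_body =
  fixes n :: nat and B :: "(nat \<Rightarrow> real) set"
  assumes n: "1 \<le> n" and body: "convex_body n B" and isotropic: "isotropic_body n B"
begin

definition vol :: real where "vol = measure (lborel_n n) B"

definition second_moment :: real where
  "second_moment = (\<integral>x. (norm_n n x)\<^sup>2 \<partial>uniform_on_body n B)"

abbreviation gauge :: "(nat \<Rightarrow> real) \<Rightarrow> real" where "gauge \<equiv> gauge_n n B"

lemma B_subset: "B \<subseteq> E_n n" by (rule convex_body_subset[OF body])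

lemma B_sets [measurable]: "B \<in> sets (lborel_n n)" by (rule sets_convex_body[OF body])

lemma emeasure_B: "emeasure (lborel_n n) B = ennreal vol" and vol_pos: "0 < vol"
  unfolding vol_def by (rule emeasure_convex_body[OF body])+

lemma barycentre:
  assumes "i < n" shows "(\<integral>x. indicator B x * x i \<partial>lborel_n n) = 0"
proof -
  have "(\<integral>x. x i \<partial>uniform_on_body n B) = 0"
    using isotropic assms by (auto simp: isotropic_body_def isotropic_def)
  then show ?thesis
    using integral_uniform_on_body[OF body measurable_nth_lborel_n[OF assms]] vol_pos by (simp add: vol_def)
qed

lemma centred_box:
  obtains e where "0 < e" "{x \<in> E_n n. \<forall>i<n. \<bar>x i\<bar> \<le> e} \<subseteq> B"
  by (rule convex_body_centred_box[OF body n barycentre])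

lemma B_scale:
  assumes "x \<in> B" "0 \<le> t" "t \<le> 1" shows "scale_n n t x \<in> B"
proof -
  obtain e where e: "0 < e" "{x \<in> E_n n. \<forall>i<n. \<bar>x i\<bar> \<le> e} \<subseteq> B" by (rule centred_box)
  have "(\<lambda>i\<in>{..<n}. 0) \<in> {x \<in> E_n n. \<forall>i<n. \<bar>x i\<bar> \<le> e}" using e(1) by simp
  then have "(\<lambda>i\<in>{..<n}. 0) \<in> B" using e(2) by blast
  then have "(\<lambda>i\<in>{..<n}. t * x i + (1 - t) * (\<lambda>i\<in>{..<n}. 0) i) \<in> B"
    using body unfolding convex_body_def by (intro convex_n_mem assms) blast+
  also have "(\<lambda>i\<in>{..<n}. t * x i + (1 - t) * (\<lambda>i\<in>{..<n}. 0) i) = scale_n n t x"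
    by (auto simp: affine_n_def)
  finally show ?thesis .
qed

lemma gauge_eq_Inf: "gauge x = Inf {l. 0 < l \<and> scale_n n (1 / l) x \<in> B}"
  unfolding gauge_n_def affine_n_def by simp

lemma gauge_set_nonempty:
  obtains l where "0 < l" "scale_n n (1 / l) x \<in> B"
proof -
  obtain e where e: "0 < e" "{x \<in> E_n n. \<forall>i<n. \<bar>x i\<bar> \<le> e} \<subseteq> B" by (rule centred_box)
  define L where "L = Max (insert 1 ((\<lambda>i. \<bar>x i\<bar>) ` {..<n}))"
  have L: "\<bar>x i\<bar> \<le> L" if "i < n" for i using that by (auto simp: L_def)
  have L0: "0 < L" by (auto simp: L_def Max_gr_iff)
  have "\<forall>i<n. \<bar>scale_n n (1 / (L / e)) x i\<bar> \<le> e"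
  proof (intro allI impI)
    fix i assume i: "i < n"
    show "\<bar>scale_n n (1 / (L / e)) x i\<bar> \<le> e"
      using L[OF i] L0 e(1) unfolding affine_n_nth[OF i] by (simp add: abs_mult divide_simps mult.commute)
  qed
  then have "scale_n n (1 / (L / e)) x \<in> {x \<in> E_n n. \<forall>i<n. \<bar>x i\<bar> \<le> e}"
    by (simp only: mem_Collect_eq affine_n_in simp_thms)
  then have mem: "scale_n n (1 / (L / e)) x \<in> B" by (rule subsetD[OF e(2)])
  show thesis by (rule that[OF _ mem]) (use L0 e(1) in simp)
qed

lemma gauge_nonneg: "0 \<le> gauge x"
  unfolding gauge_eq_Inf
proof (rule cInf_greatest)
  obtain l where "0 < l" "scale_n n (1 / l) x \<in> B" by (rule gauge_set_nonempty)
  then show "{l. 0 < l \<and> scale_n n (1 / l) x \<in> B} \<noteq> {}" by blast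
qed simp

text \<open>
  The infimum in the gauge is attained because \<open>B\<close> is closed, so dilates of \<open>B\<close> are exactly the
  sublevel sets of the gauge.
\<close>

lemma gauge_le_iff:
  assumes s: "0 < s"
  shows "gauge x \<le> s \<longleftrightarrow> scale_n n (1 / s) x \<in> B"
proof
  assume "scale_n n (1 / s) x \<in> B"
  then show "gauge x \<le> s"
    unfolding gauge_eq_Inf using s by (intro cInf_lower bdd_belowI[of _ 0]) auto
next
  assume le: "gauge x \<le> s"
  have mem: "scale_n n (1 / t) x \<in> B" if t: "s < t" for t
  proof -
    obtain l0 where "0 < l0" "scale_n n (1 / l0) x \<in> B" by (rule gauge_set_nonempty)
    then have ne: "{l. 0 < l \<and> scale_n n (1 / l) x \<in> B} \<noteq> {}" by blast
    have "Inf {l. 0 < l \<and> scale_n n (1 / l) x \<in> B} < t" using le t unfolding gauge_eq_Inf by simp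
    then obtain l where l: "0 < l" "scale_n n (1 / l) x \<in> B" "l < t"
      using cInf_lessD[OF ne] by blast
    have "scale_n n (l / t) (scale_n n (1 / l) x) \<in> B" using l s t by (intro B_scale[OF l(2)]) auto
    then show ?thesis using l by simp
  qed
  have "limitin (euclid_top n) (\<lambda>j. scale_n n (1 / (s + 1 / Suc j)) x) (scale_n n (1 / s) x) sequentially"
    unfolding euclid_top_def limitin_componentwise
  proof (intro conjI ballI)
    show "scale_n n (1 / s) x \<in> extensional {..<n}"
      using affine_n_in[of n "\<lambda>_. 0" "1/s" x] by (simp add: PiE_def del: affine_n_in)
    show "\<forall>\<^sub>F j in sequentially. scale_n n (1 / (s + 1 / Suc j)) x \<in> topspace (powertop_real {..<n})"
      by simp
    fix i assume "i \<in> {..<n}"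
    moreover have "(\<lambda>j. 1 / (s + 1 / Suc j) * x i) \<longlonglongrightarrow> 1 / (s + 0) * x i"
      using s by (intro tendsto_intros LIMSEQ_Suc[OF lim_1_over_n]) auto
    ultimately show "limitin euclideanreal (\<lambda>j. scale_n n (1 / (s + 1 / Suc j)) x i) (scale_n n (1 / s) x i) sequentially"
      by simp
  qed
  moreover have "closedin (euclid_top n) B" by (rule closedin_convex_body[OF body])
  moreover have "\<forall>\<^sub>F j in sequentially. scale_n n (1 / (s + 1 / real (Suc j))) x \<in> B"
    by (intro always_eventually allI mem) simp
  ultimately show "scale_n n (1 / s) x \<in> B"
    by (rule limitin_closedin) simp
qed

lemma gauge_le_one: "x \<in> E_n n \<Longrightarrow> gauge x \<le> 1 \<longleftrightarrow> x \<in> B"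
  using gauge_le_iff[of 1 x] by (simp add: scale_one)

lemma gauge_scale:
  assumes t: "0 < t" shows "gauge (scale_n n t x) = t * gauge x"
proof -
  have iff: "gauge (scale_n n t x) \<le> s \<longleftrightarrow> t * gauge x \<le> s" if s: "0 < s" for s
  proof -
    have "t * gauge x \<le> s \<longleftrightarrow> gauge x \<le> s / t" using t by (simp add: pos_le_divide_eq mult.commute)
    also have "\<dots> \<longleftrightarrow> scale_n n (1 / (s / t)) x \<in> B" using s t by (intro gauge_le_iff) auto
    finally show ?thesis using gauge_le_iff[OF s, of "scale_n n t x"] by simp
  qed
  show ?thesis
  proof (rule antisym; rule dense_ge)
    fix s assume "t * gauge x < s"
    moreover have "0 \<le> t * gauge x" using gauge_nonneg[of x] t by simp
    ultimately show "gauge (scale_n n t x) \<le> s" using iff[of s] by linarith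
  next
    fix s assume "gauge (scale_n n t x) < s"
    moreover have "0 \<le> gauge (scale_n n t x)" by (rule gauge_nonneg)
    ultimately show "t * gauge x \<le> s" using iff[of s] by linarith
  qed
qed

lemma gauge_zero_imp:
  assumes "gauge x = 0" "i < n" shows "x i = 0"
proof (rule ccontr)
  assume ne: "x i \<noteq> 0"
  obtain K where K: "0 < K" "\<forall>x\<in>B. \<forall>i<n. \<bar>x i\<bar> \<le> K" by (rule convex_body_bounded[OF body])
  define s where "s = \<bar>x i\<bar> / (2 * K)"
  have s: "0 < s" using ne K by (simp add: s_def)
  then have "scale_n n (1 / s) x \<in> B" using assms gauge_le_iff[of s x] by simp
  then have "\<bar>scale_n n (1 / s) x i\<bar> \<le> K" using K(2) assms(2) by blast
  then have "\<bar>x i\<bar> / s \<le> K" using s assms(2) by (simp add: abs_mult)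
  then show False using ne K(1) by (simp add: s_def)
qed

lemma gauge_measurable [measurable]: "gauge \<in> borel_measurable (lborel_n n)"
proof (rule borel_measurable_iff_le[THEN iffD2], rule allI)
  fix a :: real
  have pos: "{x \<in> space (lborel_n n). gauge x \<le> a} \<in> sets (lborel_n n)" if "0 < a" for a
  proof -
    have "{x \<in> space (lborel_n n). gauge x \<le> a} = (\<lambda>x. scale_n n (1 / a) x) -` B \<inter> space (lborel_n n)"
      using gauge_le_iff[OF that] by auto
    also have "\<dots> \<in> sets (lborel_n n)" by measurable
    finally show ?thesis .
  qed
  show "{x \<in> space (lborel_n n). gauge x \<le> a} \<in> sets (lborel_n n)"
  proof (cases "0 < a")
    case False
    have "{x \<in> space (lborel_n n). gauge x \<le> a}
      = (if a < 0 then {} else {x \<in> space (lborel_n n). \<forall>j. gauge x \<le> 1 / Suc j})"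
    proof (cases "a < 0")
      case True
      then show ?thesis using gauge_nonneg by (auto simp: not_le intro: less_le_trans)
    next
      case F: False
      then have a: "a = 0" using False by simp
      have "gauge x \<le> 0" if "\<And>j. gauge x \<le> 1 / Suc j" for x
        using that by (intro LIMSEQ_le_const[OF LIMSEQ_Suc[OF lim_1_over_n]]) auto
      moreover have "gauge x \<le> 1 / Suc j" if "gauge x \<le> 0" for x j
        using that by (meson order_trans divide_nonneg_nonneg of_nat_0_le_iff zero_le_one)
      ultimately show ?thesis using a by auto
    qed
    also have "\<dots> \<in> sets (lborel_n n)"
      by (auto simp del: of_nat_Suc space_lborel_n intro!: sets.sets_Collect_countable_All pos)
    finally show ?thesis .
  qed (rule pos)
qed

lemma gauge_pos_AE: "AE x in lborel_n n. 0 < gauge x"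
proof -
  define Z where "Z = {x \<in> E_n n. \<forall>i<n. \<bar>x i - 0\<bar> \<le> 0}"
  have "Z \<in> sets (lborel_n n)" "emeasure (lborel_n n) Z = ennreal ((2 * 0) ^ n)"
    unfolding Z_def by (rule emeasure_box_n, simp)+
  moreover have "ennreal ((2 * 0) ^ n) = 0" using n by (simp add: power_0_left)
  ultimately have z: "Z \<in> null_sets (lborel_n n)" by (intro null_setsI) metis+
  have sub: "{x \<in> space (lborel_n n). \<not> 0 < gauge x} \<subseteq> Z"
  proof
    fix x assume "x \<in> {x \<in> space (lborel_n n). \<not> 0 < gauge x}"
    then have x: "x \<in> E_n n" "gauge x = 0" using gauge_nonneg[of x] by auto
    then show "x \<in> Z" unfolding Z_def using gauge_zero_imp[OF x(2)] by simp
  qed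
  show ?thesis by (rule AE_I'[OF z sub])
qed

text \<open>
  The point where the ray through \<open>y\<close> leaves \<open>B\<close>.
\<close>

definition proj :: "(nat \<Rightarrow> real) \<Rightarrow> (nat \<Rightarrow> real)" where
  "proj y = scale_n n (1 / gauge y) y"

lemma proj_in_B: "0 < gauge y \<Longrightarrow> proj y \<in> B"
  unfolding proj_def using gauge_le_iff[of "gauge y" y] by simp

lemma gauge_proj: "0 < gauge y \<Longrightarrow> gauge (proj y) = 1"
  unfolding proj_def by (subst gauge_scale) auto

lemma gauge_scale_proj: "0 < gauge y \<Longrightarrow> 0 < t \<Longrightarrow> gauge (scale_n n t (proj y)) = t"
  by (simp add: gauge_scale gauge_proj)

lemma proj_measurable [measurable]: "proj \<in> lborel_n n \<rightarrow>\<^sub>M lborel_n n"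
  unfolding proj_def by measurable

section \<open>Polar coordinates adapted to the body\<close>

text \<open>
  Polar coordinates without a surface measure: the direction is the projection of a point \<open>y\<close> of \<open>B\<close>, which
  follows the cone measure when \<open>y\<close> is uniform. Substituting \<open>t = |y|\<^sub>B s\<close> and then \<open>x = s y\<close> turns the right-hand
  side into the integral of \<open>F(x) |x|\<^sub>B\<^sup>n \<integral> n s\<^sup>-\<^sup>n\<^sup>-\<^sup>1 ds\<close> over \<open>s \<ge> |x|\<^sub>B\<close>, and the inner integral is \<open>|x|\<^sub>B\<^sup>-\<^sup>n\<close>.
\<close>

lemma polar_coordinates:
  assumes F[measurable]: "F \<in> borel_measurable (lborel_n n)"
  shows "(\<integral>\<^sup>+x. F x \<partial>lborel_n n)
    = (\<integral>\<^sup>+y\<in>B. (\<integral>\<^sup>+t\<in>{0<..}. ennreal (real n * t ^ (n - 1)) * F (scale_n n t (proj y)) \<partial>lborel) \<partial>lborel_n n)"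
proof -
  interpret P: pair_sigma_finite "lborel :: real measure" "lborel_n n" ..
  have inner: "(\<integral>\<^sup>+t\<in>{0<..}. ennreal (real n * t ^ (n - 1)) * F (scale_n n t (proj y)) \<partial>lborel)
      = (\<integral>\<^sup>+s\<in>{0<..}. ennreal (real n * s ^ (n - 1)) * ennreal (gauge y ^ n) * F (scale_n n s y) \<partial>lborel)"
    if g: "0 < gauge y" and y: "y \<in> E_n n" for y
  proof -
    have meas: "(\<lambda>t. F (scale_n n t y)) \<in> borel_measurable borel" if "y \<in> space (lborel_n n)" for y
      using that by measurable
    have [measurable]: "(\<lambda>t. F (scale_n n t y)) \<in> borel_measurable borel" for y
    proof (cases "y \<in> E_n n")
      case True
      then show ?thesis by (intro meas) simp
    next
      case False
      have "scale_n n t y = scale_n n t (restrict y {..<n})" for t by (auto simp: affine_n_def)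
      moreover have "restrict y {..<n} \<in> space (lborel_n n)" by simp
      ultimately show ?thesis using meas[of "restrict y {..<n}"] by simp
    qed
    have "(\<integral>\<^sup>+t\<in>{0<..}. ennreal (real n * t ^ (n - 1)) * F (scale_n n t (proj y)) \<partial>lborel)
      = ennreal \<bar>gauge y\<bar> * (\<integral>\<^sup>+s. ennreal (real n * (0 + gauge y * s) ^ (n - 1)) * F (scale_n n (0 + gauge y * s) (proj y)) * indicator {0<..} (0 + gauge y * s) \<partial>lborel)"
      using g by (intro nn_integral_real_affine) auto
    also have "\<dots> = (\<integral>\<^sup>+s. ennreal \<bar>gauge y\<bar> * (ennreal (real n * (0 + gauge y * s) ^ (n - 1)) * F (scale_n n (0 + gauge y * s) (proj y)) * indicator {0<..} (0 + gauge y * s)) \<partial>lborel)"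
      by (rule nn_integral_cmult[symmetric]) measurable
    also have "\<dots> = (\<integral>\<^sup>+s\<in>{0<..}. ennreal (real n * s ^ (n - 1)) * ennreal (gauge y ^ n) * F (scale_n n s y) \<partial>lborel)"
    proof (intro nn_integral_cong)
      fix s
      show "ennreal \<bar>gauge y\<bar> * (ennreal (real n * (0 + gauge y * s) ^ (n - 1)) * F (scale_n n (0 + gauge y * s) (proj y)) * indicator {0<..} (0 + gauge y * s))
        = ennreal (real n * s ^ (n - 1)) * ennreal (gauge y ^ n) * F (scale_n n s y) * indicator {0<..} s"
      proof (cases "0 < s")
        case True
        have "gauge y * (real n * (gauge y * s) ^ (n - 1)) = real n * s ^ (n - 1) * gauge y ^ n"
          using n by (cases n) (auto simp: power_mult_distrib)
        then have "ennreal \<bar>gauge y\<bar> * ennreal (real n * (gauge y * s) ^ (n - 1)) = ennreal (real n * s ^ (n - 1)) * ennreal (gauge y ^ n)"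
          using g True by (simp add: ennreal_mult[symmetric])
        moreover have "scale_n n (gauge y * s) (proj y) = scale_n n s y" using g by (simp add: proj_def)
        ultimately show ?thesis using g True by (simp add: mult.assoc[symmetric])
      next
        case False
        then show ?thesis using g by (simp add: zero_less_mult_iff)
      qed
    qed
    finally show ?thesis .
  qed
  have radial: "(\<integral>\<^sup>+s. ennreal (real n / s ^ (n + 1)) * indicator {g..} s \<partial>lborel) = ennreal (1 / g ^ n)" if g: "0 < g" for g
  proof -
    have d: "((\<lambda>s. - 1 / s ^ n) has_real_derivative real n / s ^ (n + 1)) (at s)" if "g \<le> s" for s :: real
    proof -
      have s: "s \<noteq> 0" using that g by simp
      have "((\<lambda>s. - 1 / s ^ n) has_real_derivative (0 * s ^ n - (- 1) * (real n * s ^ (n - 1))) / (s ^ n * s ^ n)) (at s)"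
        using s by (intro DERIV_divide derivative_eq_intros) auto
      moreover have "(0 * s ^ n - (- 1) * (real n * s ^ (n - 1))) / (s ^ n * s ^ n) = real n / s ^ (n + 1)"
        using s n by (cases n) (auto simp: field_simps)
      ultimately show ?thesis by simp
    qed
    have "((\<lambda>s::real. inverse (s ^ n)) \<longlongrightarrow> 0) at_top"
      by (rule tendsto_inverse_0_at_top[OF filterlim_pow_at_top[OF _ filterlim_ident]]) (use n in simp)
    from tendsto_minus[OF this] have l: "((\<lambda>s::real. - 1 / s ^ n) \<longlongrightarrow> 0) at_top"
      by (simp only: inverse_eq_divide minus_divide_left minus_zero)
    have "(\<integral>\<^sup>+s. ennreal (real n / s ^ (n + 1)) * indicator {g..} s \<partial>lborel) = ennreal (0 - (- 1 / g ^ n))"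
      by (rule nn_integral_FTC_atLeast[OF _ d _ l]) (use g in auto)
    then show ?thesis by simp
  qed
  have "(\<integral>\<^sup>+y\<in>B. (\<integral>\<^sup>+t\<in>{0<..}. ennreal (real n * t ^ (n - 1)) * F (scale_n n t (proj y)) \<partial>lborel) \<partial>lborel_n n)
    = (\<integral>\<^sup>+y. (\<integral>\<^sup>+s. ennreal (real n * s ^ (n - 1)) * ennreal (gauge y ^ n) * F (scale_n n s y) * indicator {0<..} s * indicator B y \<partial>lborel) \<partial>lborel_n n)"
    using gauge_pos_AE AE_space[of "lborel_n n"]
  proof (intro nn_integral_cong_AE, eventually_elim)
    case (elim y)
    then show ?case using inner[of y] by (cases "y \<in> B") auto
  qed
  also have "\<dots> = (\<integral>\<^sup>+s. (\<integral>\<^sup>+y. ennreal (real n * s ^ (n - 1)) * ennreal (gauge y ^ n) * F (scale_n n s y) * indicator {0<..} s * indicator B y \<partial>lborel_n n) \<partial>lborel)"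
    by (rule P.Fubini'[where f="\<lambda>s y. ennreal (real n * s ^ (n - 1)) * ennreal (gauge y ^ n) * F (scale_n n s y) * indicator {0<..} s * indicator B y"]) measurable
  also have "\<dots> = (\<integral>\<^sup>+s. (\<integral>\<^sup>+x. ennreal (real n / s ^ (n + 1)) * ennreal (gauge x ^ n) * F x * indicator {(s, g). 0 < s \<and> g \<le> s} (s, gauge x) \<partial>lborel_n n) \<partial>lborel)"
  proof (rule nn_integral_cong)
    fix s :: real
    show "(\<integral>\<^sup>+y. ennreal (real n * s ^ (n - 1)) * ennreal (gauge y ^ n) * F (scale_n n s y) * indicator {0<..} s * indicator B y \<partial>lborel_n n)
      = (\<integral>\<^sup>+x. ennreal (real n / s ^ (n + 1)) * ennreal (gauge x ^ n) * F x * indicator {(s, g). 0 < s \<and> g \<le> s} (s, gauge x) \<partial>lborel_n n)"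
    proof (cases "0 < s")
      case s: True
      have "(\<integral>\<^sup>+x. ennreal (real n / s ^ (n + 1)) * ennreal (gauge x ^ n) * F x * indicator {(s, g). 0 < s \<and> g \<le> s} (s, gauge x) \<partial>lborel_n n)
        = ennreal (\<bar>s\<bar> ^ n) * (\<integral>\<^sup>+x. ennreal (real n / s ^ (n + 1)) * ennreal (gauge (scale_n n s x) ^ n) * F (scale_n n s x) * indicator {(s, g). 0 < s \<and> g \<le> s} (s, gauge (scale_n n s x)) \<partial>lborel_n n)"
        by (rule nn_integral_affine_n[where a="\<lambda>_. 0"]) (use s in auto)
      also have "\<dots> = (\<integral>\<^sup>+x. ennreal (\<bar>s\<bar> ^ n) * (ennreal (real n / s ^ (n + 1)) * ennreal (gauge (scale_n n s x) ^ n) * F (scale_n n s x) * indicator {(s, g). 0 < s \<and> g \<le> s} (s, gauge (scale_n n s x))) \<partial>lborel_n n)"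
        by (rule nn_integral_cmult[symmetric]) measurable
      also have "\<dots> = (\<integral>\<^sup>+y. ennreal (real n * s ^ (n - 1)) * ennreal (gauge y ^ n) * F (scale_n n s y) * indicator {0<..} s * indicator B y \<partial>lborel_n n)"
      proof (intro nn_integral_cong)
        fix x assume x: "x \<in> space (lborel_n n)"
        have "s ^ n * (real n / s ^ (n + 1) * (s * gauge x) ^ n) = real n * s ^ (n - 1) * gauge x ^ n"
          using s n by (cases n) (auto simp: field_simps power_mult_distrib)
        then have "ennreal (\<bar>s\<bar> ^ n) * (ennreal (real n / s ^ (n + 1)) * ennreal ((s * gauge x) ^ n)) = ennreal (real n * s ^ (n - 1)) * ennreal (gauge x ^ n)"
          using s gauge_nonneg[of x] by (simp add: ennreal_mult[symmetric])
        moreover have "indicator {(s, g). 0 < s \<and> g \<le> s} (s, s * gauge x) = (indicator B x :: ennreal)"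
          using s gauge_le_one[of x] x by (auto simp: indicator_def mult_le_cancel_left1 mult_le_cancel_left2)
        ultimately show "ennreal (\<bar>s\<bar> ^ n) * (ennreal (real n / s ^ (n + 1)) * ennreal (gauge (scale_n n s x) ^ n) * F (scale_n n s x) * indicator {(s, g). 0 < s \<and> g \<le> s} (s, gauge (scale_n n s x)))
          = ennreal (real n * s ^ (n - 1)) * ennreal (gauge x ^ n) * F (scale_n n s x) * indicator {0<..} s * indicator B x"
          using s by (simp add: gauge_scale mult.assoc[symmetric])
      qed
      finally show ?thesis by simp
    qed simp
  qed
  also have "\<dots> = (\<integral>\<^sup>+x. (\<integral>\<^sup>+s. ennreal (real n / s ^ (n + 1)) * ennreal (gauge x ^ n) * F x * indicator {(s, g). 0 < s \<and> g \<le> s} (s, gauge x) \<partial>lborel) \<partial>lborel_n n)"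
    by (rule P.Fubini'[symmetric, where f="\<lambda>s x. ennreal (real n / s ^ (n + 1)) * ennreal (gauge x ^ n) * F x * indicator {(s, g). 0 < s \<and> g \<le> s} (s, gauge x)"]) measurable
  also have "\<dots> = (\<integral>\<^sup>+x. F x \<partial>lborel_n n)"
    using gauge_pos_AE
  proof (intro nn_integral_cong_AE, eventually_elim)
    case (elim x)
    have "(\<integral>\<^sup>+s. ennreal (real n / s ^ (n + 1)) * ennreal (gauge x ^ n) * F x * indicator {(s, g). 0 < s \<and> g \<le> s} (s, gauge x) \<partial>lborel)
      = (\<integral>\<^sup>+s. ennreal (real n / s ^ (n + 1)) * indicator {gauge x..} s * (ennreal (gauge x ^ n) * F x) \<partial>lborel)"
      using elim by (intro nn_integral_cong) (auto simp: indicator_def mult.assoc)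
    also have "\<dots> = ennreal (1 / gauge x ^ n) * (ennreal (gauge x ^ n) * F x)"
      unfolding radial[OF elim(2), symmetric] by (rule nn_integral_multc) measurable
    also have "\<dots> = F x"
      using elim by (simp add: mult.assoc[symmetric] ennreal_mult[symmetric])
    finally show ?case .
  qed
  finally show ?thesis by simp
qed

lemma polar_radial:
  assumes F[measurable]: "F \<in> borel_measurable (lborel_n n)" and \<phi>[measurable]: "\<phi> \<in> borel_measurable borel"
  shows "(\<integral>\<^sup>+x. \<phi> (gauge x) * F x \<partial>lborel_n n)
    = (\<integral>\<^sup>+t\<in>{0<..}. ennreal (real n * t ^ (n - 1)) * \<phi> t * (\<integral>\<^sup>+y\<in>B. F (scale_n n t (proj y)) \<partial>lborel_n n) \<partial>lborel)"
proof -
  interpret P: pair_sigma_finite "lborel :: real measure" "lborel_n n" ..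
  have "(\<integral>\<^sup>+x. \<phi> (gauge x) * F x \<partial>lborel_n n)
    = (\<integral>\<^sup>+y\<in>B. (\<integral>\<^sup>+t\<in>{0<..}. ennreal (real n * t ^ (n - 1)) * (\<phi> (gauge (scale_n n t (proj y))) * F (scale_n n t (proj y))) \<partial>lborel) \<partial>lborel_n n)"
    by (rule polar_coordinates) measurable
  also have "\<dots> = (\<integral>\<^sup>+y. (\<integral>\<^sup>+t. ennreal (real n * t ^ (n - 1)) * \<phi> t * F (scale_n n t (proj y)) * indicator {0<..} t * indicator B y \<partial>lborel) \<partial>lborel_n n)"
    using gauge_pos_AE
  proof (intro nn_integral_cong_AE, eventually_elim)
    case (elim y)
    then show ?case
      by (cases "y \<in> B") (auto intro!: nn_integral_cong simp: gauge_scale_proj indicator_def mult.assoc)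
  qed
  also have "\<dots> = (\<integral>\<^sup>+t. (\<integral>\<^sup>+y. ennreal (real n * t ^ (n - 1)) * \<phi> t * F (scale_n n t (proj y)) * indicator {0<..} t * indicator B y \<partial>lborel_n n) \<partial>lborel)"
    by (rule P.Fubini'[where f="\<lambda>t y. ennreal (real n * t ^ (n - 1)) * \<phi> t * F (scale_n n t (proj y)) * indicator {0<..} t * indicator B y"]) measurable
  also have "\<dots> = (\<integral>\<^sup>+t\<in>{0<..}. ennreal (real n * t ^ (n - 1)) * \<phi> t * (\<integral>\<^sup>+y\<in>B. F (scale_n n t (proj y)) \<partial>lborel_n n) \<partial>lborel)"
  proof (intro nn_integral_cong)
    fix t :: real
    have "(\<integral>\<^sup>+y. ennreal (real n * t ^ (n - 1)) * \<phi> t * F (scale_n n t (proj y)) * indicator {0<..} t * indicator B y \<partial>lborel_n n)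
      = (\<integral>\<^sup>+y. (ennreal (real n * t ^ (n - 1)) * \<phi> t * indicator {0<..} t) * (F (scale_n n t (proj y)) * indicator B y) \<partial>lborel_n n)"
      by (intro nn_integral_cong) (simp add: mult_ac)
    also have "\<dots> = (ennreal (real n * t ^ (n - 1)) * \<phi> t * indicator {0<..} t) * (\<integral>\<^sup>+y\<in>B. F (scale_n n t (proj y)) \<partial>lborel_n n)"
      by (rule nn_integral_cmult) measurable
    finally show "(\<integral>\<^sup>+y. ennreal (real n * t ^ (n - 1)) * \<phi> t * F (scale_n n t (proj y)) * indicator {0<..} t * indicator B y \<partial>lborel_n n)
      = ennreal (real n * t ^ (n - 1)) * \<phi> t * (\<integral>\<^sup>+y\<in>B. F (scale_n n t (proj y)) \<partial>lborel_n n) * indicator {0<..} t"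
      by (simp add: mult_ac)
  qed
  finally show ?thesis .
qed


text \<open>
  Against a radial weight, \<open>F\<close> may be replaced by its average \<open>\<psi>\<close> over directions.
\<close>

lemma polar_radial_mean:
  assumes F[measurable]: "F \<in> borel_measurable (lborel_n n)" and \<phi>[measurable]: "\<phi> \<in> borel_measurable borel"
    and \<psi>[measurable]: "\<psi> \<in> borel_measurable borel"
    and mean: "\<And>t. 0 < t \<Longrightarrow> \<phi> t \<noteq> 0 \<Longrightarrow> (\<integral>\<^sup>+y\<in>B. F (scale_n n t (proj y)) \<partial>lborel_n n) = ennreal vol * \<psi> t"
  shows "(\<integral>\<^sup>+x. \<phi> (gauge x) * F x \<partial>lborel_n n) = (\<integral>\<^sup>+x. \<phi> (gauge x) * \<psi> (gauge x) \<partial>lborel_n n)"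
proof -
  have "(\<integral>\<^sup>+x. \<phi> (gauge x) * F x \<partial>lborel_n n)
    = (\<integral>\<^sup>+t\<in>{0<..}. ennreal (real n * t ^ (n - 1)) * \<phi> t * (\<integral>\<^sup>+y\<in>B. F (scale_n n t (proj y)) \<partial>lborel_n n) \<partial>lborel)"
    by (rule polar_radial) measurable
  also have "\<dots> = (\<integral>\<^sup>+t\<in>{0<..}. ennreal (real n * t ^ (n - 1)) * \<phi> t * (\<integral>\<^sup>+y\<in>B. \<psi> (gauge (scale_n n t (proj y))) \<partial>lborel_n n) \<partial>lborel)"
  proof (intro nn_integral_cong)
    fix t :: real
    show "ennreal (real n * t ^ (n - 1)) * \<phi> t * (\<integral>\<^sup>+y\<in>B. F (scale_n n t (proj y)) \<partial>lborel_n n) * indicator {0<..} t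
      = ennreal (real n * t ^ (n - 1)) * \<phi> t * (\<integral>\<^sup>+y\<in>B. \<psi> (gauge (scale_n n t (proj y))) \<partial>lborel_n n) * indicator {0<..} t"
    proof (cases "0 < t \<and> \<phi> t \<noteq> 0")
      case True
      have "(\<integral>\<^sup>+y\<in>B. \<psi> (gauge (scale_n n t (proj y))) \<partial>lborel_n n) = (\<integral>\<^sup>+y. \<psi> t * indicator B y \<partial>lborel_n n)"
        using gauge_pos_AE
        by (intro nn_integral_cong_AE, eventually_elim) (use True in \<open>simp add: gauge_scale_proj\<close>)
      also have "\<dots> = ennreal vol * \<psi> t"
        by (subst nn_integral_cmult_indicator) (auto simp: emeasure_B mult.commute)
      finally show ?thesis using mean[of t] True by simp
    qed auto
  qed
  also have "\<dots> = (\<integral>\<^sup>+x. \<phi> (gauge x) * \<psi> (gauge x) \<partial>lborel_n n)"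
    by (rule polar_radial[symmetric]) measurable
  finally show ?thesis .
qed

section \<open>Second moments and diameter\<close>

lemma integrable_on_body:
  fixes f :: "(nat \<Rightarrow> real) \<Rightarrow> real"
  assumes "f \<in> borel_measurable (lborel_n n)" "\<And>x. x \<in> B \<Longrightarrow> \<bar>f x\<bar> \<le> K"
  shows "integrable (lborel_n n) (\<lambda>x. indicator B x * f x)"
  using assms by (intro integrable_on_bounded_set) (auto simp: emeasure_B)

lemma inner_n_bound:
  obtains K where "0 < K" "\<forall>x\<in>B. \<bar>inner_n n x v\<bar> \<le> K"
proof -
  obtain K where K: "0 < K" "\<forall>x\<in>B. \<forall>i<n. \<bar>x i\<bar> \<le> K" by (rule convex_body_bounded[OF body])
  have "\<bar>inner_n n x v\<bar> \<le> (\<Sum>i<n. K * \<bar>v i\<bar>)" if "x \<in> B" for x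
    unfolding inner_n_def using K that
    by (intro order_trans[OF sum_abs] sum_mono) (auto simp: abs_mult intro!: mult_right_mono)
  then show thesis
    by (intro that[of "(\<Sum>i<n. K * \<bar>v i\<bar>) + 1"]) (use K(1) in \<open>force intro!: add_nonneg_pos sum_nonneg\<close>)+
qed

text \<open>
  Isotropy fixes the second moment in every direction, and the trace identifies the common value.
\<close>

lemma second_moment_inner:
  "(\<integral>x. indicator B x * (inner_n n x v)\<^sup>2 \<partial>lborel_n n) = vol * ((norm_n n v)\<^sup>2 * second_moment / n)"
proof -
  let ?I = "\<lambda>v. (\<integral>x. (inner_n n x v)\<^sup>2 \<partial>uniform_on_body n B)"
  have conv: "?I v = (\<integral>x. indicator B x * (inner_n n x v)\<^sup>2 \<partial>lborel_n n) / vol" for v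
    unfolding vol_def by (rule integral_uniform_on_body[OF body]) measurable
  obtain c where c: "\<And>\<theta>. \<theta> \<in> sphere_n n \<Longrightarrow> ?I \<theta> = c"
    using isotropic unfolding isotropic_body_def isotropic_def by blast
  have S: "second_moment = n * c"
  proof -
    have int: "integrable (lborel_n n) (\<lambda>x. indicator B x * (x i)\<^sup>2)" if i: "i < n" for i
    proof -
      obtain K where K: "0 < K" "\<forall>x\<in>B. \<forall>i<n. \<bar>x i\<bar> \<le> K" by (rule convex_body_bounded[OF body])
      have "\<bar>(x i)\<^sup>2\<bar> \<le> K\<^sup>2" if "x \<in> B" for x
      proof -
        have "\<bar>x i\<bar> \<le> \<bar>K\<bar>" using K that i by force
        then show ?thesis by (simp add: abs_le_square_iff)
      qed
      then show ?thesis
        by (intro integrable_on_body borel_measurable_power measurable_nth_lborel_n i)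
    qed
    have one: "(\<integral>x. indicator B x * (x i)\<^sup>2 \<partial>lborel_n n) / vol = c" if i: "i < n" for i
    proof -
      let ?e = "\<lambda>j\<in>{..<n}. if j = i then 1 else (0::real)"
      have "(norm_n n ?e)\<^sup>2 = 1" unfolding norm_n_sq_sum using i by (simp add: if_distrib[of "\<lambda>z. z\<^sup>2"] cong: if_cong)
      then have "norm_n n ?e = 1" by (simp add: norm_n_def inner_n_def sum_nonneg power2_eq_1_iff)
      then have "?e \<in> sphere_n n" by (simp add: sphere_n_def)
      then have "?I ?e = c" by (rule c)
      moreover have "inner_n n x ?e = x i" for x using i by (simp add: inner_n_def if_distrib[of "\<lambda>z. _ * z"] cong: if_cong)
      ultimately show ?thesis using conv[of ?e] by simp
    qed
    have "second_moment = (\<integral>x. indicator B x * (norm_n n x)\<^sup>2 \<partial>lborel_n n) / vol"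
      unfolding second_moment_def vol_def by (rule integral_uniform_on_body[OF body]) measurable
    also have "\<dots> = (\<Sum>i<n. (\<integral>x. indicator B x * (x i)\<^sup>2 \<partial>lborel_n n)) / vol"
      unfolding norm_n_sq_sum sum_distrib_left using int by (subst Bochner_Integration.integral_sum) auto
    also have "\<dots> = (\<Sum>i<n. c)" unfolding sum_divide_distrib using one by (intro sum.cong) auto
    finally show ?thesis by simp
  qed
  show ?thesis
  proof (cases "norm_n n v = 0")
    case True
    then have "(norm_n n v)\<^sup>2 = 0" by simp
    then have "v i = 0" if "i < n" for i
      using that unfolding norm_n_sq_sum by (subst (asm) sum_nonneg_eq_0_iff) auto
    then have "inner_n n x v = 0" for x by (simp add: inner_n_def)
    then show ?thesis using True by simp
  next
    case False
    define r where "r = norm_n n v"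
    have r: "0 < r" using False unfolding r_def norm_n_def by (simp add: inner_n_def sum_nonneg less_le)
    let ?w = "scale_n n (1 / r) v"
    have "(norm_n n ?w)\<^sup>2 = (norm_n n v)\<^sup>2 / r\<^sup>2"
      unfolding norm_n_sq_sum by (simp add: power_divide sum_divide_distrib)
    then have "(norm_n n ?w)\<^sup>2 = 1" using r by (simp add: r_def)
    then have "norm_n n ?w = 1" by (simp add: norm_n_def inner_n_def sum_nonneg power2_eq_1_iff)
    then have "?w \<in> sphere_n n" by (simp add: sphere_n_def)
    then have Ic: "?I ?w = c" by (rule c)
    have "inner_n n x v = r * inner_n n x ?w" for x
      using r by (simp add: inner_n_def sum_distrib_left)
    then have "(\<integral>x. indicator B x * (inner_n n x v)\<^sup>2 \<partial>lborel_n n) = (\<integral>x. r\<^sup>2 * (indicator B x * (inner_n n x ?w)\<^sup>2) \<partial>lborel_n n)"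
      by (simp add: power_mult_distrib mult_ac)
    also have "\<dots> = r\<^sup>2 * (\<integral>x. indicator B x * (inner_n n x ?w)\<^sup>2 \<partial>lborel_n n)" by simp
    also have "(\<integral>x. indicator B x * (inner_n n x ?w)\<^sup>2 \<partial>lborel_n n) = vol * c"
      using conv[of ?w] Ic vol_pos by (simp add: field_simps)
    finally show ?thesis using S n by (simp add: r_def)
  qed
qed

lemma second_moment_nonneg: "0 \<le> second_moment"
  unfolding second_moment_def by (intro integral_nonneg_AE) simp

text \<open>
  The copy \<open>(1 - t) z + t B\<close> of \<open>B\<close> is contained in \<open>B\<close>, has a fraction \<open>t\<^sup>n\<close> of its volume and barycentre
  \<open>(1 - t) z\<close>, so the second moment of \<open>B\<close> in the direction of \<open>z\<close> is at least \<open>t\<^sup>n (1 - t)\<^sup>2 |z|\<^sup>2\<close>. With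
  \<open>1 - t\<close> of order \<open>1 / n\<close> the first factor stays bounded below.
\<close>

lemma diameter_bound:
  assumes z: "z \<in> B"
  shows "(norm_n n z)\<^sup>2 \<le> 8 * n * second_moment"
proof (cases "norm_n n z = 0")
  case True
  then show ?thesis using second_moment_nonneg by simp
next
  case False
  \<comment> \<open>by Bernoulli this choice keeps the volume fraction above one half\<close>
  define t :: real where "t = 1 - 1 / (2 * n)"
  define A where "A = (1 - t) * (norm_n n z)\<^sup>2"
  have t: "0 < t" "t \<le> 1" using n by (auto simp: t_def field_simps)
  have tn: "1 / 2 \<le> t ^ n"
  proof -
    have "1 + real n * (- 1 / (2 * real n)) \<le> (1 + (- 1 / (2 * real n))) ^ n"
      by (rule Bernoulli_inequality) (use n in \<open>simp add: field_simps\<close>)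
    then show ?thesis using n by (simp add: t_def)
  qed
  define a where "a = (\<lambda>i. (1 - t) * z i)"
  have mem: "affine_n n a t x \<in> B" if "x \<in> B" for x
  proof -
    have "(\<lambda>i\<in>{..<n}. (1 - t) * z i + (1 - (1 - t)) * x i) \<in> B"
      using body t that z unfolding convex_body_def by (intro convex_n_mem) auto
    then show ?thesis by (simp add: affine_n_def a_def)
  qed
  have inner: "inner_n n (affine_n n a t x) z = A + t * inner_n n x z" for x
    unfolding inner_n_def A_def norm_n_sq_sum
    by (simp add: a_def sum_distrib_left sum.distrib[symmetric] power2_eq_square algebra_simps)
  have int1: "integrable (lborel_n n) (\<lambda>x. indicator B x * inner_n n x z)"
  proof -
    obtain K where "0 < K" "\<forall>x\<in>B. \<bar>inner_n n x z\<bar> \<le> K" by (rule inner_n_bound)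
    then show ?thesis by (intro integrable_on_body[where K=K]) auto
  qed
  have int2: "integrable (lborel_n n) (\<lambda>x. indicator B x * (inner_n n x z)\<^sup>2)"
  proof -
    obtain K where K: "0 < K" "\<forall>x\<in>B. \<bar>inner_n n x z\<bar> \<le> K" by (rule inner_n_bound)
    then have "\<bar>(inner_n n x z)\<^sup>2\<bar> \<le> K\<^sup>2" if "x \<in> B" for x
      using bspec[OF K(2) that] K(1) by (simp add: abs_le_square_iff[symmetric])
    then show ?thesis by (intro integrable_on_body[where K="K\<^sup>2"]) auto
  qed
  have int0: "integrable (lborel_n n) (\<lambda>x. indicator B x * (c::real))" for c
    by (auto simp: emeasure_B)
  have lin0: "(\<integral>x. indicator B x * inner_n n x z \<partial>lborel_n n) = 0"
  proof -
    obtain K where K: "0 < K" "\<forall>x\<in>B. \<forall>i<n. \<bar>x i\<bar> \<le> K" by (rule convex_body_bounded[OF body])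
    have i: "integrable (lborel_n n) (\<lambda>x. indicator B x * x i)" if "i < n" for i
      using K that by (intro integrable_on_body[where K=K] measurable_nth_lborel_n) auto
    have "(\<integral>x. indicator B x * inner_n n x z \<partial>lborel_n n) = (\<integral>x. (\<Sum>i<n. z i * (indicator B x * x i)) \<partial>lborel_n n)"
      by (intro Bochner_Integration.integral_cong) (auto simp: inner_n_def sum_distrib_left mult_ac)
    also have "\<dots> = 0" using i by (subst Bochner_Integration.integral_sum) (auto simp: barycentre)
    finally show ?thesis .
  qed
  let ?F = "\<lambda>x. ennreal (indicator B x * (inner_n n x z)\<^sup>2)"
  have "ennreal (t ^ n * (vol * A\<^sup>2)) \<le> ennreal (t ^ n) * (\<integral>\<^sup>+x. ennreal (indicator B x * (A + t * inner_n n x z)\<^sup>2) \<partial>lborel_n n)"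
  proof -
    have i: "integrable (lborel_n n) (\<lambda>x. indicator B x * (A + t * inner_n n x z)\<^sup>2)"
    proof -
      have "(\<lambda>x. indicator B x * (A + t * inner_n n x z)\<^sup>2)
        = (\<lambda>x. indicator B x * A\<^sup>2 + (2 * A * t) * (indicator B x * inner_n n x z) + t\<^sup>2 * (indicator B x * (inner_n n x z)\<^sup>2))"
        by (simp add: fun_eq_iff power2_eq_square algebra_simps)
      then show ?thesis using int0 int1 int2 by simp
    qed
    have BE: "B \<inter> E_n n = B" using B_subset by auto
    have "vol * A\<^sup>2 = (\<integral>x. indicator B x * A\<^sup>2 + (2 * A * t) * (indicator B x * inner_n n x z) \<partial>lborel_n n)"
      using int0 int1 by (subst Bochner_Integration.integral_add) (auto simp: lin0 BE vol_def)
    also have "\<dots> \<le> (\<integral>x. indicator B x * (A + t * inner_n n x z)\<^sup>2 \<partial>lborel_n n)"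
    proof (rule integral_mono)
      show "indicator B x * A\<^sup>2 + (2 * A * t) * (indicator B x * inner_n n x z) \<le> indicator B x * (A + t * inner_n n x z)\<^sup>2" for x
        using zero_le_power2[of "t * inner_n n x z"] by (simp add: indicator_def power2_eq_square algebra_simps)
    qed (use int0 int1 i in auto)
    finally have "ennreal (vol * A\<^sup>2) \<le> ennreal (\<integral>x. indicator B x * (A + t * inner_n n x z)\<^sup>2 \<partial>lborel_n n)"
      by (rule ennreal_leI)
    also have "\<dots> = (\<integral>\<^sup>+x. ennreal (indicator B x * (A + t * inner_n n x z)\<^sup>2) \<partial>lborel_n n)"
      by (rule nn_integral_eq_integral[symmetric, OF i]) auto
    finally show ?thesis using t vol_pos by (simp add: ennreal_mult mult_left_mono)
  qed
  also have "\<dots> \<le> ennreal (\<bar>t\<bar> ^ n) * (\<integral>\<^sup>+x. ?F (affine_n n a t x) \<partial>lborel_n n)"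
    using t mem by (intro mult_mono nn_integral_mono ennreal_leI) (auto simp: inner indicator_def)
  also have "\<dots> = (\<integral>\<^sup>+x. ?F x \<partial>lborel_n n)"
    by (rule nn_integral_affine_n[symmetric]) (use t in auto)
  also have "\<dots> = ennreal (vol * ((norm_n n z)\<^sup>2 * second_moment / n))"
    by (subst nn_integral_eq_integral[OF int2]) (auto simp: second_moment_inner)
  finally have "t ^ n * (vol * A\<^sup>2) \<le> vol * ((norm_n n z)\<^sup>2 * second_moment / n)"
    using second_moment_nonneg vol_pos t by (subst (asm) ennreal_le_iff) auto
  moreover have "1 / 2 * (vol * A\<^sup>2) \<le> t ^ n * (vol * A\<^sup>2)"
    using tn vol_pos by (intro mult_right_mono) auto
  ultimately have "1 / 2 * (vol * A\<^sup>2) \<le> vol * ((norm_n n z)\<^sup>2 * second_moment / n)" by (rule order_trans[rotated])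
  then have "vol * (1 / 2 * A\<^sup>2) \<le> vol * ((norm_n n z)\<^sup>2 * second_moment / n)" by (simp only: mult.left_commute)
  then have "1 / 2 * A\<^sup>2 \<le> (norm_n n z)\<^sup>2 * second_moment / n"
    by (rule mult_left_le_imp_le[OF _ vol_pos])
  moreover have "A = (norm_n n z)\<^sup>2 / (2 * n)" by (simp add: A_def t_def)
  ultimately have "(norm_n n z)\<^sup>2 * ((norm_n n z)\<^sup>2 / (8 * (real n)\<^sup>2)) \<le> (norm_n n z)\<^sup>2 * (second_moment / n)"
    by (simp add: power_divide power_mult_distrib power2_eq_square)
  then have "(norm_n n z)\<^sup>2 / (8 * (real n)\<^sup>2) \<le> second_moment / n"
    by (rule mult_left_le_imp_le) (use False in simp)
  then show ?thesis using n by (simp add: field_simps power2_eq_square)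
qed


lemma second_moment_pos: "0 < second_moment"
proof -
  obtain e where e: "0 < e" "{x \<in> E_n n. \<forall>i<n. \<bar>x i\<bar> \<le> e} \<subseteq> B" by (rule centred_box)
  define z where "z = (\<lambda>i\<in>{..<n}. e)"
  have "z \<in> {x \<in> E_n n. \<forall>i<n. \<bar>x i\<bar> \<le> e}" using e(1) by (simp add: z_def)
  then have "z \<in> B" using e(2) by blast
  then have le: "(norm_n n z)\<^sup>2 \<le> 8 * n * second_moment" by (rule diameter_bound)
  have "(norm_n n z)\<^sup>2 = n * e\<^sup>2" unfolding norm_n_sq_sum by (simp add: z_def)
  then have "0 < (norm_n n z)\<^sup>2" using e(1) n by simp
  then have "0 < real (8 * n) * second_moment" using le by (rule less_le_trans)
  then show ?thesis using n by (simp add: zero_less_mult_iff)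
qed

lemma norm_sq_scale: "(norm_n n (scale_n n t x))\<^sup>2 = t\<^sup>2 * (norm_n n x)\<^sup>2"
  unfolding norm_n_sq_sum by (simp add: power_mult_distrib sum_distrib_left)

lemma second_moment_nn:
  "(\<integral>\<^sup>+y\<in>B. ennreal ((norm_n n y)\<^sup>2) \<partial>lborel_n n) = ennreal (vol * second_moment)"
proof -
  have bd: "\<bar>(norm_n n x)\<^sup>2\<bar> \<le> 8 * n * second_moment" if "x \<in> B" for x
    using diameter_bound[OF that] by simp
  have i: "integrable (lborel_n n) (\<lambda>x. indicator B x * (norm_n n x)\<^sup>2)"
    by (rule integrable_on_body[OF _ bd]) auto
  have "(\<integral>\<^sup>+y\<in>B. ennreal ((norm_n n y)\<^sup>2) \<partial>lborel_n n) = (\<integral>\<^sup>+y. ennreal (indicator B y * (norm_n n y)\<^sup>2) \<partial>lborel_n n)"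
    by (intro nn_integral_cong) (simp add: indicator_def)
  also have "\<dots> = ennreal (\<integral>x. indicator B x * (norm_n n x)\<^sup>2 \<partial>lborel_n n)"
    by (rule nn_integral_eq_integral[OF i]) auto
  also have "(\<integral>x. indicator B x * (norm_n n x)\<^sup>2 \<partial>lborel_n n) = vol * second_moment"
    using integral_uniform_on_body[OF body norm_sq_measurable] vol_pos
    unfolding second_moment_def vol_def[symmetric] by simp
  finally show ?thesis .
qed

text \<open>
  Polar coordinates for \<open>|x|\<^sup>2\<close> on \<open>B\<close>: the radial integral \<open>\<integral> n t\<^sup>n\<^sup>+\<^sup>1 dt\<close> over \<open>[0, 1]\<close> is \<open>n / (n + 2)\<close>.
\<close>

lemma second_moment_direction: "(\<integral>\<^sup>+y\<in>B. ennreal ((norm_n n (proj y))\<^sup>2) \<partial>lborel_n n) = ennreal (vol * second_moment * (n + 2) / n)"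
proof -
  define I where "I = (\<integral>\<^sup>+y\<in>B. ennreal ((norm_n n (proj y))\<^sup>2) \<partial>lborel_n n)"
  have "ennreal (vol * second_moment) = (\<integral>\<^sup>+x. indicator {..1} (gauge x) * ennreal ((norm_n n x)\<^sup>2) \<partial>lborel_n n)"
    unfolding second_moment_nn[symmetric]
    by (intro nn_integral_cong) (auto simp: indicator_def gauge_le_one)
  also have "\<dots> = (\<integral>\<^sup>+t\<in>{0<..}. ennreal (real n * t ^ (n - 1)) * indicator {..1} t * (\<integral>\<^sup>+y\<in>B. ennreal ((norm_n n (scale_n n t (proj y)))\<^sup>2) \<partial>lborel_n n) \<partial>lborel)"
    by (rule polar_radial) measurable
  also have "\<dots> = (\<integral>\<^sup>+t. (ennreal n * I) * (ennreal (t ^ (n + 1)) * indicator {0<..1} t) \<partial>lborel)"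
  proof (intro nn_integral_cong)
    fix t :: real
    show "ennreal (real n * t ^ (n - 1)) * indicator {..1} t * (\<integral>\<^sup>+y\<in>B. ennreal ((norm_n n (scale_n n t (proj y)))\<^sup>2) \<partial>lborel_n n) * indicator {0<..} t
      = (ennreal n * I) * (ennreal (t ^ (n + 1)) * indicator {0<..1} t)"
    proof (cases "0 < t \<and> t \<le> 1")
      case True
      have "(\<integral>\<^sup>+y\<in>B. ennreal ((norm_n n (scale_n n t (proj y)))\<^sup>2) \<partial>lborel_n n) = (\<integral>\<^sup>+y. ennreal (t\<^sup>2) * (ennreal ((norm_n n (proj y))\<^sup>2) * indicator B y) \<partial>lborel_n n)"
        by (intro nn_integral_cong) (simp add: norm_sq_scale ennreal_mult mult.assoc)
      also have "\<dots> = ennreal (t\<^sup>2) * I" unfolding I_def by (rule nn_integral_cmult) measurable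
      finally have 1: "(\<integral>\<^sup>+y\<in>B. ennreal ((norm_n n (scale_n n t (proj y)))\<^sup>2) \<partial>lborel_n n) = ennreal (t\<^sup>2) * I" .
      have "real n * t ^ (n - 1) * t\<^sup>2 = n * t ^ (n + 1)"
        using n by (cases n) (auto simp: power2_eq_square)
      then have "ennreal (real n * t ^ (n - 1)) * ennreal (t\<^sup>2) = ennreal n * ennreal (t ^ (n + 1))"
        using True by (simp add: ennreal_mult[symmetric])
      then have "ennreal (real n * t ^ (n - 1)) * (ennreal (t\<^sup>2) * I) = ennreal n * I * ennreal (t ^ (n + 1))"
        by (metis mult.assoc mult.commute)
      then show ?thesis unfolding 1 using True by simp
    qed auto
  qed
  also have "\<dots> = ennreal n * I * ennreal (1 / (n + 2))"
    by (subst nn_integral_cmult, measurable, subst nn_integral_power_Ioc) (auto simp: add_ac)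
  also have "\<dots> = (ennreal n * ennreal (1 / (n + 2))) * I" by (simp only: mult_ac)
  also have "ennreal n * ennreal (1 / (n + 2)) = ennreal (n / (n + 2))" by (simp add: ennreal_mult[symmetric])
  finally have eq: "ennreal (vol * second_moment) = ennreal (n / (n + 2)) * I" .
  have "ennreal (vol * second_moment * (n + 2) / n) = ennreal ((n + 2) / n) * ennreal (vol * second_moment)"
    using vol_pos second_moment_pos by (simp add: ennreal_mult[symmetric] mult_ac)
  also have "\<dots> = ennreal ((n + 2) / n) * ennreal (n / (n + 2)) * I" unfolding eq by (simp only: mult.assoc)
  also have "ennreal ((n + 2) / n) * ennreal (n / (n + 2)) = 1" using n by (simp add: ennreal_mult[symmetric])
  finally show ?thesis by (simp add: I_def)
qed

end

section \<open>Smooth functions along rays\<close>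

lemma partial_deriv_scale:
  assumes f: "\<forall>x\<in>E_n n. (\<lambda>t. f (x(i := t))) differentiable at (x i)" and i: "i < n"
  shows "partial_deriv i (\<lambda>x. c * f (scale_n n s x)) x = c * s * partial_deriv i f (scale_n n s x)"
    and "(\<lambda>t. c * f (scale_n n s (x(i := t)))) differentiable at (x i)"
proof -
  let ?y = "scale_n n s x"
  have upd: "scale_n n s (x(i := t)) = ?y(i := s * t)" for t
    using i by (auto simp: affine_n_def fun_eq_iff)
  have "((\<lambda>t. f (?y(i := t))) has_real_derivative partial_deriv i f ?y) (at (?y i))"
    unfolding partial_deriv_def using bspec[OF f affine_n_in] by (simp add: DERIV_deriv_iff_real_differentiable)
  then have "((\<lambda>t. f (?y(i := t))) has_real_derivative partial_deriv i f ?y) (at (s * x i))" using i by simp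
  moreover have "((\<lambda>t. s * t) has_real_derivative s) (at (x i))"
    using DERIV_cmult[OF DERIV_ident, of s] by simp
  ultimately have "((\<lambda>t. f (?y(i := s * t))) has_real_derivative partial_deriv i f ?y * s) (at (x i))"
    by (rule DERIV_chain2)
  then have "((\<lambda>t. c * f (?y(i := s * t))) has_real_derivative c * (partial_deriv i f ?y * s)) (at (x i))"
    by (rule DERIV_cmult)
  then have d: "((\<lambda>t. c * f (scale_n n s (x(i := t)))) has_real_derivative c * s * partial_deriv i f ?y) (at (x i))"
    by (simp only: upd mult_ac)
  show "partial_deriv i (\<lambda>x. c * f (scale_n n s x)) x = c * s * partial_deriv i f ?y"
    unfolding partial_deriv_def[of i "\<lambda>x. c * f (scale_n n s x)"] by (rule DERIV_imp_deriv[OF d])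
  show "(\<lambda>t. c * f (scale_n n s (x(i := t)))) differentiable at (x i)"
    using d real_differentiable_def by blast
qed

lemma continuous_map_scale_n: "continuous_map (euclid_top n) (euclid_top n) (scale_n n s)"
proof -
  have "continuous_map (euclid_top n) euclideanreal (\<lambda>x. scale_n n s x k)" if "k < n" for k
    using that by (simp, intro continuous_map_real_mult continuous_map_nth) auto
  then show ?thesis
    using affine_n_in[of n "\<lambda>_. 0" s]
    by (subst (2) euclid_top_def) (auto simp: continuous_map_componentwise PiE_iff)
qed

text \<open>
  The factor \<open>c\<close> is there for the induction: differentiation produces the factor \<open>s\<close>.
\<close>

lemma Ck_scale: "Ck n k f \<Longrightarrow> Ck n k (\<lambda>x. c * f (scale_n n s x))"
proof (induction k arbitrary: f c)
  case 0
  then have "continuous_map (euclid_top n) euclideanreal (\<lambda>x. f (scale_n n s x))"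
    using continuous_map_compose[OF continuous_map_scale_n, of n euclideanreal f s] by (simp add: o_def)
  then show ?case by (auto intro!: continuous_map_real_mult)
next
  case (Suc k)
  have diff: "\<forall>x\<in>E_n n. (\<lambda>t. f (x(i := t))) differentiable at (x i)" if "i < n" for i using Suc.prems that by simp
  have "continuous_map (euclid_top n) euclideanreal (\<lambda>x. f (scale_n n s x))"
    using continuous_map_compose[OF continuous_map_scale_n, of n euclideanreal f s] Suc.prems by (simp add: o_def)
  then have cont: "continuous_map (euclid_top n) euclideanreal (\<lambda>x. c * f (scale_n n s x))"
    by (auto intro!: continuous_map_real_mult)
  have "Ck n k (partial_deriv i (\<lambda>x. c * f (scale_n n s x)))" if i: "i < n" for i
  proof -
    have "partial_deriv i (\<lambda>x. c * f (scale_n n s x)) = (\<lambda>x. c * s * partial_deriv i f (scale_n n s x))"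
      using partial_deriv_scale(1)[OF diff[OF i] i] by (intro ext)
    moreover have "Ck n k (partial_deriv i f)" using Suc.prems i by simp
    ultimately show ?thesis using Suc.IH by simp
  qed
  moreover have "(\<lambda>t. c * f (scale_n n s (x(i := t)))) differentiable at (x i)" if "i < n" for i x
    by (rule partial_deriv_scale(2)[OF diff[OF that] that])
  ultimately show ?case using cont by (simp only: Ck.simps) blast
qed

lemma smooth_scale: "smooth n f \<Longrightarrow> smooth n (\<lambda>x. f (scale_n n s x))"
  unfolding smooth_def using Ck_scale[of n _ f 1 s] by simp

lemma smooth_continuous: "smooth n f \<Longrightarrow> continuous_map (euclid_top n) euclideanreal f"
  unfolding smooth_def by (auto dest: spec[of _ 0])

lemma smooth_C1:
  assumes "smooth n f" "i < n"
  shows "\<forall>x\<in>E_n n. (\<lambda>t. f (x(i := t))) differentiable at (x i)"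
    "continuous_map (euclid_top n) euclideanreal (partial_deriv i f)"
proof -
  have "Ck n (Suc 0) f" using assms by (simp only: smooth_def)
  then show "\<forall>x\<in>E_n n. (\<lambda>t. f (x(i := t))) differentiable at (x i)"
    "continuous_map (euclid_top n) euclideanreal (partial_deriv i f)"
    using assms(2) by auto
qed

lemma tendsto_continuous_map:
  assumes g: "continuous_map (euclid_top n) euclideanreal g" and p: "\<And>h. p h \<in> E_n n" and y: "y \<in> E_n n"
    and lim: "\<And>i. i < n \<Longrightarrow> ((\<lambda>h. p h i) \<longlongrightarrow> y i) F"
  shows "((\<lambda>h. g (p h)) \<longlongrightarrow> g y) F"
proof -
  have "limitin (euclid_top n) p y F"
    unfolding euclid_top_def limitin_componentwise
    using p y lim by (auto simp: PiE_def)
  then have "limitin euclideanreal (g \<circ> p) (g y) F"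
    by (rule continuous_map_limit[OF g])
  then show ?thesis by (simp add: o_def)
qed

lemma mvt_unordered:
  fixes \<phi> :: "real \<Rightarrow> real"
  assumes "\<And>u. (\<phi> has_real_derivative \<phi>' u) (at u)"
  obtains \<xi> where "\<bar>\<xi> - a\<bar> \<le> \<bar>b - a\<bar>" "\<phi> b - \<phi> a = (b - a) * \<phi>' \<xi>"
proof -
  consider "a < b" | "b < a" | "a = b" by linarith
  then show thesis
  proof cases
    case 1
    then obtain z where "a < z" "z < b" "\<phi> b - \<phi> a = (b - a) * \<phi>' z"
      using MVT2[of a b \<phi> \<phi>'] assms by blast
    then show thesis using that[of z] by simp
  next
    case 2
    then obtain z where z: "b < z" "z < a" "\<phi> a - \<phi> b = (a - b) * \<phi>' z"
      using MVT2[of b a \<phi> \<phi>'] assms by blast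
    show thesis by (rule that[of z]) (use z in \<open>simp_all add: algebra_simps\<close>)
  next
    case 3
    then show thesis using that[of a] by simp
  qed
qed

text \<open>
  The chain rule from continuous partial derivatives. The increment of \<open>f\<close> is split into steps that change
  one coordinate each, and the mean value theorem applies to every step.
\<close>

lemma smooth_ray_derivative:
  assumes f: "smooth n f" and x: "x \<in> E_n n"
  shows "((\<lambda>t. f (scale_n n t x)) has_real_derivative (\<Sum>i<n. x i * partial_deriv i f (scale_n n t x))) (at t)"
proof -
  let ?y = "scale_n n t x"
  define z where "z j h = (\<lambda>i\<in>{..<n}. if i < j then (t + h) * x i else t * x i)" for j h
  have zE: "z j h \<in> E_n n" for j h by (simp add: z_def)
  have "\<exists>p\<in>E_n n. (\<forall>i<n. \<bar>p i - t * x i\<bar> \<le> \<bar>h * x i\<bar>) \<and> f (z (Suc j) h) - f (z j h) = h * (x j * partial_deriv j f p)"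
    if j: "j < n" for j h
  proof -
    have upd: "(z j h)(j := u) \<in> E_n n" for u using j by (auto simp: z_def PiE_iff extensional_def)
    have "((\<lambda>u. f ((z j h)(j := u))) has_real_derivative partial_deriv j f ((z j h)(j := u))) (at u)" for u
      unfolding partial_deriv_def using bspec[OF smooth_C1(1)[OF f j] upd[of u]]
      by (simp add: DERIV_deriv_iff_real_differentiable)
    then obtain \<xi> where \<xi>: "\<bar>\<xi> - t * x j\<bar> \<le> \<bar>(t + h) * x j - t * x j\<bar>"
      "f ((z j h)(j := (t + h) * x j)) - f ((z j h)(j := t * x j)) = ((t + h) * x j - t * x j) * partial_deriv j f ((z j h)(j := \<xi>))"
      by (rule mvt_unordered)
    have "(z j h)(j := (t + h) * x j) = z (Suc j) h" "(z j h)(j := t * x j) = z j h"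
      using j by (auto simp: z_def fun_eq_iff less_Suc_eq)
    then have "f (z (Suc j) h) - f (z j h) = h * (x j * partial_deriv j f ((z j h)(j := \<xi>)))"
      using \<xi>(2) by (simp add: algebra_simps)
    moreover have "\<forall>i<n. \<bar>((z j h)(j := \<xi>)) i - t * x i\<bar> \<le> \<bar>h * x i\<bar>"
      using \<xi>(1) by (auto simp: z_def algebra_simps)
    ultimately show ?thesis using upd by blast
  qed
  then obtain p where p: "\<And>j h. j < n \<Longrightarrow> p j h \<in> E_n n"
      "\<And>j h i. j < n \<Longrightarrow> i < n \<Longrightarrow> \<bar>p j h i - t * x i\<bar> \<le> \<bar>h * x i\<bar>"
      "\<And>j h. j < n \<Longrightarrow> f (z (Suc j) h) - f (z j h) = h * (x j * partial_deriv j f (p j h))"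
    by metis
  have diff: "f (scale_n n (t + h) x) - f ?y = h * (\<Sum>j<n. x j * partial_deriv j f (p j h))" for h
  proof -
    have "z n h = scale_n n (t + h) x" "z 0 h = ?y" by (auto simp: z_def affine_n_def)
    then have "f (scale_n n (t + h) x) - f ?y = (\<Sum>j<n. f (z (Suc j) h) - f (z j h))"
      by (subst sum_lessThan_telescope) simp
    also have "\<dots> = (\<Sum>j<n. h * (x j * partial_deriv j f (p j h)))"
      using p(3) by (intro sum.cong) auto
    finally show ?thesis by (simp add: sum_distrib_left)
  qed
  have lim: "((\<lambda>h. \<Sum>j<n. x j * partial_deriv j f (p j h)) \<longlongrightarrow> (\<Sum>j<n. x j * partial_deriv j f ?y)) (at 0)"
  proof (intro tendsto_sum tendsto_mult tendsto_const)
    fix j assume "j \<in> {..<n}"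
    then have j: "j < n" by simp
    show "((\<lambda>h. partial_deriv j f (p j h)) \<longlongrightarrow> partial_deriv j f ?y) (at 0)"
    proof (rule tendsto_continuous_map[OF smooth_C1(2)[OF f j]])
      fix i assume i: "i < n"
      have "((\<lambda>h. p j h i - t * x i) \<longlongrightarrow> 0) (at 0)"
      proof (rule Lim_null_comparison)
        show "\<forall>\<^sub>F h in at 0. norm (p j h i - t * x i) \<le> \<bar>h * x i\<bar>"
          using p(2)[OF j i] by (intro always_eventually allI) simp
        show "((\<lambda>h. \<bar>h * x i\<bar>) \<longlongrightarrow> 0) (at 0)"
          by (rule tendsto_eq_intros refl | simp)+
      qed
      then show "((\<lambda>h. p j h i) \<longlongrightarrow> ?y i) (at 0)" using i by (simp add: LIM_zero_iff)
    qed (use p(1)[OF j] in auto)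
  qed
  have "((\<lambda>h. (f (scale_n n (t + h) x) - f ?y) / h) \<longlongrightarrow> (\<Sum>j<n. x j * partial_deriv j f ?y)) (at 0)"
  proof (rule Lim_transform_eventually[OF lim])
    show "\<forall>\<^sub>F h in at 0. (\<Sum>j<n. x j * partial_deriv j f (p j h)) = (f (scale_n n (t + h) x) - f ?y) / h"
      unfolding diff by (auto simp: eventually_at_filter)
  qed
  then show ?thesis by (simp add: DERIV_def)
qed

lemma continuous_on_scale_ray:
  assumes "continuous_map (euclid_top n) euclideanreal g"
  shows "continuous_on UNIV (\<lambda>t. g (scale_n n t x))"
proof -
  have "((\<lambda>t. g (scale_n n t x)) \<longlongrightarrow> g (scale_n n a x)) (at a)" for a
    by (rule tendsto_continuous_map[OF assms]) (auto intro!: tendsto_eq_intros)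
  then show ?thesis by (simp add: continuous_on_def)
qed

lemma continuous_map_bounded_on_box:
  assumes "continuous_map (euclid_top n) euclideanreal g"
  obtains M where "0 \<le> M" "\<forall>x\<in>E_n n. (\<forall>i<n. \<bar>x i\<bar> \<le> K) \<longrightarrow> \<bar>g x\<bar> \<le> M"
proof -
  have "compactin (euclid_top n) (Pi\<^sub>E {..<n} (\<lambda>_. {-K..K}))"
    unfolding euclid_top_def by (simp add: compactin_PiE)
  then have "compactin euclideanreal (g ` (Pi\<^sub>E {..<n} (\<lambda>_. {-K..K})))"
    by (rule image_compactin[OF _ assms])
  then have "bounded (g ` (Pi\<^sub>E {..<n} (\<lambda>_. {-K..K})))" by (simp add: compact_imp_bounded)
  then obtain M where M: "\<forall>x\<in>Pi\<^sub>E {..<n} (\<lambda>_. {-K..K}). \<bar>g x\<bar> \<le> M" by (auto simp: bounded_real)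
  have mem: "x \<in> Pi\<^sub>E {..<n} (\<lambda>_. {-K..K})" if "x \<in> E_n n" "\<forall>i<n. \<bar>x i\<bar> \<le> K" for x
    using that by (auto simp: PiE_iff abs_le_iff minus_le_iff)
  have "\<bar>g x\<bar> \<le> max M 0" if "x \<in> E_n n" "\<forall>i<n. \<bar>x i\<bar> \<le> K" for x
    using bspec[OF M mem[OF that]] by simp
  then show thesis by (intro that[of "max M 0"]) auto
qed

abbreviation grad_sq :: "nat \<Rightarrow> ((nat \<Rightarrow> real) \<Rightarrow> real) \<Rightarrow> (nat \<Rightarrow> real) \<Rightarrow> real" where
  "grad_sq n f x \<equiv> (norm_n n (gradient n f x))\<^sup>2"

lemma grad_sq_sum: "grad_sq n f x = (\<Sum>i<n. (partial_deriv i f x)\<^sup>2)"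
  unfolding norm_n_sq_sum gradient_def by simp

lemma continuous_map_grad_sq: "smooth n f \<Longrightarrow> continuous_map (euclid_top n) euclideanreal (grad_sq n f)"
  unfolding grad_sq_sum by (intro continuous_map_sum continuous_map_real_pow smooth_C1(2)) auto

lemma grad_sq_scale:
  assumes "smooth n f"
  shows "grad_sq n (\<lambda>x. f (scale_n n s x)) x = s\<^sup>2 * grad_sq n f (scale_n n s x)"
proof -
  have "partial_deriv i (\<lambda>x. f (scale_n n s x)) x = s * partial_deriv i f (scale_n n s x)" if "i < n" for i
    using partial_deriv_scale(1)[OF smooth_C1(1)[OF assms that] that, of 1 s x] by simp
  then show ?thesis unfolding grad_sq_sum by (simp add: power_mult_distrib sum_distrib_left)
qed

context isotropic_convex_body begin

section \<open>Averages over directions\<close>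

lemma proj_mem: "y \<in> B \<Longrightarrow> proj y \<in> B"
proof (cases "0 < gauge y")
  case False
  assume "y \<in> B"
  moreover have "gauge y = 0" using False gauge_nonneg[of y] by simp
  ultimately show ?thesis unfolding proj_def using B_scale[of y 0] by simp
qed (rule proj_in_B)

lemma proj_in_E [simp]: "proj y \<in> E_n n"
  by (simp add: proj_def)

lemma bounded_along_rays:
  assumes "continuous_map (euclid_top n) euclideanreal g"
  obtains M where "0 \<le> M" "\<forall>t y. \<bar>t\<bar> \<le> T \<longrightarrow> y \<in> B \<longrightarrow> \<bar>g (scale_n n t (proj y))\<bar> \<le> M"
proof -
  obtain K where K: "0 < K" "\<forall>x\<in>B. \<forall>i<n. \<bar>x i\<bar> \<le> K" by (rule convex_body_bounded[OF body])
  obtain M where M: "0 \<le> M" "\<forall>x\<in>E_n n. (\<forall>i<n. \<bar>x i\<bar> \<le> T * K) \<longrightarrow> \<bar>g x\<bar> \<le> M"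
    by (rule continuous_map_bounded_on_box[OF assms])
  have "\<bar>g (scale_n n t (proj y))\<bar> \<le> M" if t: "\<bar>t\<bar> \<le> T" and y: "y \<in> B" for t y
  proof -
    have "\<bar>scale_n n t (proj y) i\<bar> \<le> T * K" if i: "i < n" for i
    proof -
      have "\<bar>proj y i\<bar> \<le> K" using K(2) proj_mem[OF y] i by blast
      then show ?thesis using t i K(1) by (simp add: abs_mult mult_mono)
    qed
    then show ?thesis using M(2) affine_n_in by blast
  qed
  then show thesis using M(1) that by blast
qed

lemma measurable_along_rays:
  assumes "continuous_map (euclid_top n) euclideanreal g"
  shows "(\<lambda>y. g (scale_n n t (proj y))) \<in> borel_measurable (lborel_n n)"
  by (rule measurable_compose[OF _ measurable_continuous_map[OF assms]]) measurable

text \<open>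
  The mean of \<open>f\<close> over the boundary of the dilate \<open>tB\<close> with respect to the cone measure.
\<close>

definition radial_mean :: "((nat \<Rightarrow> real) \<Rightarrow> real) \<Rightarrow> real \<Rightarrow> real" where
  "radial_mean f t = (\<integral>y. indicator B y * f (scale_n n t (proj y)) \<partial>lborel_n n) / vol"

definition radial_slope :: "((nat \<Rightarrow> real) \<Rightarrow> real) \<Rightarrow> real \<Rightarrow> (nat \<Rightarrow> real) \<Rightarrow> real" where
  "radial_slope f t y = (\<Sum>i<n. proj y i * partial_deriv i f (scale_n n t (proj y)))"

definition radial_mean_slope :: "((nat \<Rightarrow> real) \<Rightarrow> real) \<Rightarrow> real \<Rightarrow> real" where
  "radial_mean_slope f t = (\<integral>y. indicator B y * radial_slope f t y \<partial>lborel_n n) / vol"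

lemma radial_slope_measurable:
  assumes "smooth n f"
  shows "radial_slope f t \<in> borel_measurable (lborel_n n)"
  unfolding radial_slope_def
  using measurable_compose[OF proj_measurable measurable_nth_lborel_n] measurable_along_rays[OF smooth_C1(2)[OF assms]]
  by (intro borel_measurable_sum borel_measurable_times) auto

lemma radial_slope_bounded:
  assumes f: "smooth n f"
  obtains M where "0 \<le> M" "\<forall>t y. \<bar>t\<bar> \<le> T \<longrightarrow> y \<in> B \<longrightarrow> \<bar>radial_slope f t y\<bar> \<le> M"
proof -
  obtain K where K: "0 < K" "\<forall>x\<in>B. \<forall>i<n. \<bar>x i\<bar> \<le> K" by (rule convex_body_bounded[OF body])
  have "\<exists>M. 0 \<le> M \<and> (\<forall>t y. \<bar>t\<bar> \<le> T \<longrightarrow> y \<in> B \<longrightarrow> \<bar>partial_deriv i f (scale_n n t (proj y))\<bar> \<le> M)" if "i < n" for i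
    using bounded_along_rays[OF smooth_C1(2)[OF f that], of T] by metis
  then obtain M where M: "\<And>i. i < n \<Longrightarrow> 0 \<le> M i"
      "\<And>i t y. i < n \<Longrightarrow> \<bar>t\<bar> \<le> T \<Longrightarrow> y \<in> B \<Longrightarrow> \<bar>partial_deriv i f (scale_n n t (proj y))\<bar> \<le> M i"
    by metis
  have "\<bar>radial_slope f t y\<bar> \<le> (\<Sum>i<n. K * M i)" if "\<bar>t\<bar> \<le> T" "y \<in> B" for t y
    unfolding radial_slope_def
  proof (intro order_trans[OF sum_abs] sum_mono)
    fix i assume "i \<in> {..<n}"
    then have i: "i < n" by simp
    have "\<bar>proj y i\<bar> \<le> K" using K(2) proj_mem[OF that(2)] i by blast
    then show "\<bar>proj y i * partial_deriv i f (scale_n n t (proj y))\<bar> \<le> K * M i"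
      unfolding abs_mult using M(2)[OF i that] K(1) by (intro mult_mono) auto
  qed
  moreover have "0 \<le> (\<Sum>i<n. K * M i)" using M(1) K(1) by (intro sum_nonneg) auto
  ultimately show thesis using that by blast
qed

lemma radial_slope_deriv:
  assumes "smooth n f"
  shows "((\<lambda>t. f (scale_n n t (proj y))) has_real_derivative radial_slope f t y) (at t)"
  unfolding radial_slope_def by (rule smooth_ray_derivative[OF assms proj_in_E])

lemma radial_slope_continuous:
  assumes "smooth n f"
  shows "continuous_on UNIV (\<lambda>t. radial_slope f t y)"
  unfolding radial_slope_def
  by (intro continuous_intros continuous_on_scale_ray smooth_C1(2)[OF assms]) auto

lemma radial_slope_sq: "(radial_slope f t y)\<^sup>2 \<le> (norm_n n (proj y))\<^sup>2 * grad_sq n f (scale_n n t (proj y))"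
  unfolding radial_slope_def norm_n_sq_sum[of n "proj y"] grad_sq_sum by (rule Cauchy_Schwarz_ineq_sum)

lemma integrable_ray:
  assumes "continuous_map (euclid_top n) euclideanreal g"
  shows "integrable (lborel_n n) (\<lambda>y. indicator B y * g (scale_n n t (proj y)))"
proof -
  obtain M where "0 \<le> M" "\<forall>t' y. \<bar>t'\<bar> \<le> \<bar>t\<bar> \<longrightarrow> y \<in> B \<longrightarrow> \<bar>g (scale_n n t' (proj y))\<bar> \<le> M"
    by (rule bounded_along_rays[OF assms])
  then show ?thesis
    by (intro integrable_on_body[where K=M] measurable_along_rays assms) auto
qed

text \<open>
  Differentiation under the integral; on compact intervals the slopes along all rays have a common bound,
  which dominates the difference quotients.
\<close>

lemma radial_mean_deriv:
  assumes f: "smooth n f"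
  shows "(radial_mean f has_real_derivative radial_mean_slope f t) (at t)"
proof -
  note cf = smooth_continuous[OF f]
  let ?H = "\<lambda>h y. indicator B y * ((f (scale_n n (t + h) (proj y)) - f (scale_n n t (proj y))) / h)"
  have quot: "(radial_mean f (t + h) - radial_mean f t) / h = (\<integral>y. ?H h y \<partial>lborel_n n) / vol" for h
  proof -
    have "(\<integral>y. ?H h y \<partial>lborel_n n)
      = (\<integral>y. (indicator B y * f (scale_n n (t + h) (proj y)) - indicator B y * f (scale_n n t (proj y))) / h \<partial>lborel_n n)"
      by (intro Bochner_Integration.integral_cong) (auto simp: algebra_simps)
    also have "\<dots> = ((\<integral>y. indicator B y * f (scale_n n (t + h) (proj y)) \<partial>lborel_n n) - (\<integral>y. indicator B y * f (scale_n n t (proj y)) \<partial>lborel_n n)) / h"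
      by (simp add: Bochner_Integration.integral_diff integrable_ray[OF cf])
    finally show ?thesis unfolding radial_mean_def by (simp add: diff_divide_distrib mult.commute)
  qed
  have "(\<lambda>k. \<integral>y. ?H (S k) y \<partial>lborel_n n) \<longlonglongrightarrow> (\<integral>y. indicator B y * radial_slope f t y \<partial>lborel_n n)"
    if S: "\<forall>k. S k \<noteq> 0" "S \<longlonglongrightarrow> 0" for S :: "nat \<Rightarrow> real"
  proof -
    obtain R where R: "\<And>k. \<bar>S k\<bar> \<le> R"
      using convergent_imp_Bseq[OF convergentI[OF S(2)]] unfolding Bseq_def by auto
    obtain M where M: "0 \<le> M" "\<forall>u y. \<bar>u\<bar> \<le> \<bar>t\<bar> + R \<longrightarrow> y \<in> B \<longrightarrow> \<bar>radial_slope f u y\<bar> \<le> M"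
      by (rule radial_slope_bounded[OF f])
    show ?thesis
    proof (rule integral_dominated_convergence[where w="\<lambda>y. indicator B y * M"])
      show "(\<lambda>y. indicator B y * radial_slope f t y) \<in> borel_measurable (lborel_n n)"
        using radial_slope_measurable[OF f] by measurable
      show "?H (S k) \<in> borel_measurable (lborel_n n)" for k
        by (intro borel_measurable_times borel_measurable_divide borel_measurable_diff
            measurable_along_rays[OF cf] borel_measurable_indicator B_sets borel_measurable_const)
      show "integrable (lborel_n n) (\<lambda>y. indicator B y * M)" by (auto simp: emeasure_B)
      show "AE y in lborel_n n. (\<lambda>k. ?H (S k) y) \<longlonglongrightarrow> indicator B y * radial_slope f t y"
      proof (rule AE_I2)
        fix y
        have "(\<lambda>h. (f (scale_n n (t + h) (proj y)) - f (scale_n n t (proj y))) / h) \<midarrow>0\<rightarrow> radial_slope f t y"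
          using radial_slope_deriv[OF f, of y t] by (simp add: DERIV_def)
        then have "(\<lambda>k. (f (scale_n n (t + S k) (proj y)) - f (scale_n n t (proj y))) / S k) \<longlonglongrightarrow> radial_slope f t y"
          using S unfolding LIMSEQ_SEQ_conv[symmetric] by blast
        then show "(\<lambda>k. ?H (S k) y) \<longlonglongrightarrow> indicator B y * radial_slope f t y"
          by (intro tendsto_mult tendsto_const)
      qed
      show "AE y in lborel_n n. norm (?H (S k) y) \<le> indicator B y * M" for k
      proof (rule AE_I2)
        fix y
        show "norm (?H (S k) y) \<le> indicator B y * M"
        proof (cases "y \<in> B")
          case True
          obtain \<xi> where \<xi>: "\<bar>\<xi> - t\<bar> \<le> \<bar>(t + S k) - t\<bar>"
            "f (scale_n n (t + S k) (proj y)) - f (scale_n n t (proj y)) = ((t + S k) - t) * radial_slope f \<xi> y"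
            by (rule mvt_unordered[OF radial_slope_deriv[OF f, of y]])
          have "\<bar>\<xi>\<bar> \<le> \<bar>t\<bar> + R" using \<xi>(1) R[of k] by linarith
          then have "\<bar>radial_slope f \<xi> y\<bar> \<le> M" using M(2) True by blast
          then show ?thesis using True \<xi>(2) S(1) by (simp add: abs_mult)
        qed simp
      qed
    qed
  qed
  then have "(\<lambda>h. \<integral>y. ?H h y \<partial>lborel_n n) \<midarrow>0\<rightarrow> (\<integral>y. indicator B y * radial_slope f t y \<partial>lborel_n n)"
    unfolding LIMSEQ_SEQ_conv[symmetric] by blast
  from tendsto_divide[OF this tendsto_const[of vol]] show ?thesis
    unfolding DERIV_def quot radial_mean_slope_def using vol_pos by simp
qed

lemma radial_mean_slope_continuous:
  assumes f: "smooth n f"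
  shows "continuous_on UNIV (radial_mean_slope f)"
proof (rule continuous_at_imp_continuous_on, intro ballI)
  fix t :: real
  have "(\<lambda>k. radial_mean_slope f (S k)) \<longlonglongrightarrow> radial_mean_slope f t"
    if S: "S \<longlonglongrightarrow> t" for S
  proof -
    obtain R where R: "\<And>k. \<bar>S k\<bar> \<le> R"
      using convergent_imp_Bseq[OF convergentI[OF S]] unfolding Bseq_def by auto
    obtain M where M: "0 \<le> M" "\<forall>u y. \<bar>u\<bar> \<le> R \<longrightarrow> y \<in> B \<longrightarrow> \<bar>radial_slope f u y\<bar> \<le> M"
      by (rule radial_slope_bounded[OF f])
    have "(\<lambda>k. \<integral>y. indicator B y * radial_slope f (S k) y \<partial>lborel_n n) \<longlonglongrightarrow> (\<integral>y. indicator B y * radial_slope f t y \<partial>lborel_n n)"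
    proof (rule integral_dominated_convergence[where w="\<lambda>y. indicator B y * M"])
      show "(\<lambda>y. indicator B y * radial_slope f t y) \<in> borel_measurable (lborel_n n)"
        "(\<lambda>y. indicator B y * radial_slope f (S k) y) \<in> borel_measurable (lborel_n n)" for k
        using radial_slope_measurable[OF f] by (auto intro!: borel_measurable_times)
      show "integrable (lborel_n n) (\<lambda>y. indicator B y * M)" by (auto simp: emeasure_B)
      show "AE y in lborel_n n. (\<lambda>k. indicator B y * radial_slope f (S k) y) \<longlonglongrightarrow> indicator B y * radial_slope f t y"
      proof (rule AE_I2)
        fix y
        have "isCont (\<lambda>t. radial_slope f t y) t"
          using radial_slope_continuous[OF f] by (simp add: continuous_on_eq_continuous_at)
        then have "(\<lambda>k. radial_slope f (S k) y) \<longlonglongrightarrow> radial_slope f t y"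
          using S by (rule isCont_tendsto_compose)
        then show "(\<lambda>k. indicator B y * radial_slope f (S k) y) \<longlonglongrightarrow> indicator B y * radial_slope f t y"
          by (intro tendsto_mult tendsto_const)
      qed
      show "AE y in lborel_n n. norm (indicator B y * radial_slope f (S k) y) \<le> indicator B y * M" for k
        using M(2) R[of k] by (intro AE_I2) (auto simp: indicator_def)
    qed
    from tendsto_divide[OF this tendsto_const[of vol]] show ?thesis
      unfolding radial_mean_slope_def using vol_pos by simp
  qed
  then show "isCont (radial_mean_slope f) t"
    unfolding continuous_at_sequentially o_def by blast
qed

lemma radial_mean_continuous: "smooth n f \<Longrightarrow> continuous_on UNIV (radial_mean f)"
  using radial_mean_deriv by (meson DERIV_isCont continuous_at_imp_continuous_on)

lemma radial_mean_measurable: "smooth n f \<Longrightarrow> radial_mean f \<in> borel_measurable borel"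
  by (intro borel_measurable_continuous_onI radial_mean_continuous)

lemma grad_sq_measurable: "smooth n f \<Longrightarrow> grad_sq n f \<in> borel_measurable (lborel_n n)"
  by (intro measurable_continuous_map continuous_map_grad_sq)

text \<open>
  By Cauchy-Schwarz over the directions only the average of \<open>|\<theta>|\<^sup>2\<close> enters, which is smaller than its
  maximum by a factor that can be of order \<open>n\<close>.
\<close>

lemma radial_mean_slope_sq:
  assumes f: "smooth n f"
  shows "ennreal vol * ennreal ((radial_mean_slope f t)\<^sup>2)
    \<le> ennreal (3 * second_moment) * (\<integral>\<^sup>+y\<in>B. ennreal (grad_sq n f (scale_n n t (proj y))) \<partial>lborel_n n)"
proof -
  define G where "G = (\<integral>\<^sup>+y\<in>B. ennreal (grad_sq n f (scale_n n t (proj y))) \<partial>lborel_n n)"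
  define D where "D = (\<integral>y. indicator B y * radial_slope f t y \<partial>lborel_n n)"
  have [measurable]: "(\<lambda>y. grad_sq n f (scale_n n t (proj y))) \<in> borel_measurable (lborel_n n)"
    by (rule measurable_along_rays[OF continuous_map_grad_sq[OF f]])
  have int: "integrable (lborel_n n) (\<lambda>y. indicator B y * radial_slope f t y)"
  proof -
    obtain M where "0 \<le> M" "\<forall>u y. \<bar>u\<bar> \<le> \<bar>t\<bar> \<longrightarrow> y \<in> B \<longrightarrow> \<bar>radial_slope f u y\<bar> \<le> M"
      by (rule radial_slope_bounded[OF f])
    then show ?thesis by (intro integrable_on_body[where K=M] radial_slope_measurable f) auto
  qed
  let ?a = "\<lambda>y. ennreal (indicator B y * sqrt ((norm_n n (proj y))\<^sup>2))"
  let ?b = "\<lambda>y. ennreal (indicator B y * sqrt (grad_sq n f (scale_n n t (proj y))))"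
  have "ennreal (norm D) \<le> (\<integral>\<^sup>+y. ennreal (norm (indicator B y * radial_slope f t y)) \<partial>lborel_n n)"
    unfolding D_def by (rule integral_norm_bound_ennreal[OF int])
  also have "\<dots> \<le> (\<integral>\<^sup>+y. ?a y * ?b y \<partial>lborel_n n)"
  proof (intro nn_integral_mono)
    fix y
    have "\<bar>radial_slope f t y\<bar> \<le> sqrt ((norm_n n (proj y))\<^sup>2 * grad_sq n f (scale_n n t (proj y)))"
      using radial_slope_sq[of f t y] real_le_rsqrt by auto
    then show "ennreal (norm (indicator B y * radial_slope f t y)) \<le> ?a y * ?b y"
      by (auto simp: indicator_def ennreal_mult[symmetric] real_sqrt_mult intro!: ennreal_leI)
  qed
  finally have "ennreal (norm D) ^ 2 \<le> (\<integral>\<^sup>+y. ?a y * ?b y \<partial>lborel_n n) ^ 2"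
    by (intro power_mono) auto
  also have "\<dots> \<le> (\<integral>\<^sup>+y. ?a y ^ 2 \<partial>lborel_n n) * (\<integral>\<^sup>+y. ?b y ^ 2 \<partial>lborel_n n)"
    by (rule Cauchy_Schwarz_nn_integral) measurable
  also have "(\<integral>\<^sup>+y. ?a y ^ 2 \<partial>lborel_n n) = (\<integral>\<^sup>+y\<in>B. ennreal ((norm_n n (proj y))\<^sup>2) \<partial>lborel_n n)"
    by (intro nn_integral_cong) (auto simp: indicator_def ennreal_power simp del: real_sqrt_abs)
  also have "\<dots> = ennreal (vol * second_moment * (n + 2) / n)" by (rule second_moment_direction)
  also have "(\<integral>\<^sup>+y. ?b y ^ 2 \<partial>lborel_n n) = G"
    unfolding G_def by (intro nn_integral_cong) (auto simp: indicator_def ennreal_power simp del: real_sqrt_abs)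
  also have "ennreal (vol * second_moment * (n + 2) / n) \<le> ennreal (vol * (3 * second_moment))"
  proof (intro ennreal_leI)
    have "(real n + 2) / n \<le> 3" using n by (simp add: divide_le_eq)
    then have "(vol * second_moment) * ((real n + 2) / n) \<le> (vol * second_moment) * 3"
      using vol_pos second_moment_pos by (intro mult_left_mono) auto
    then show "vol * second_moment * (n + 2) / n \<le> vol * (3 * second_moment)" by (simp add: algebra_simps)
  qed
  finally have "ennreal (norm D) ^ 2 \<le> ennreal (vol * (3 * second_moment)) * G"
    by (simp add: mult_right_mono)
  moreover have "ennreal (norm D) ^ 2 = ennreal vol * (ennreal vol * ennreal ((radial_mean_slope f t)\<^sup>2))"
    using vol_pos by (simp add: radial_mean_slope_def D_def[symmetric] ennreal_power ennreal_mult[symmetric] power_divide power2_eq_square)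
  moreover have "ennreal (vol * (3 * second_moment)) * G = ennreal vol * (ennreal (3 * second_moment) * G)"
    using vol_pos second_moment_pos by (simp add: ennreal_mult mult.assoc)
  ultimately have "ennreal vol * (ennreal vol * ennreal ((radial_mean_slope f t)\<^sup>2)) \<le> ennreal vol * (ennreal (3 * second_moment) * G)"
    by simp
  then show ?thesis
    using vol_pos unfolding G_def by (subst (asm) ennreal_mult_le_mult_iff) auto
qed

section \<open>The Poincare inequality on dilates of the body\<close>

definition poincare_bound :: "real \<Rightarrow> bool" where
  "poincare_bound A \<longleftrightarrow> (\<forall>f. smooth n f \<and> integrable (uniform_on_body n B) f \<longrightarrow>
     variance_of (uniform_on_body n B) f \<le> ennreal A * energy n (uniform_on_body n B) f)"

lemma nn_integral_gauge_le:
  assumes s: "0 < s" and G[measurable]: "G \<in> borel_measurable (lborel_n n)"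
  shows "(\<integral>\<^sup>+x. indicator {..s} (gauge x) * G x \<partial>lborel_n n) = ennreal (s ^ n) * (\<integral>\<^sup>+x\<in>B. G (scale_n n s x) \<partial>lborel_n n)"
proof -
  have "(\<integral>\<^sup>+x. indicator {..s} (gauge x) * G x \<partial>lborel_n n)
    = ennreal (\<bar>s\<bar> ^ n) * (\<integral>\<^sup>+x. indicator {..s} (gauge (scale_n n s x)) * G (scale_n n s x) \<partial>lborel_n n)"
    by (rule nn_integral_affine_n[where a="\<lambda>_. 0"]) (use s in auto)
  also have "(\<integral>\<^sup>+x. indicator {..s} (gauge (scale_n n s x)) * G (scale_n n s x) \<partial>lborel_n n)
    = (\<integral>\<^sup>+x\<in>B. G (scale_n n s x) \<partial>lborel_n n)"
  proof (rule nn_integral_cong)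
    fix x assume "x \<in> space (lborel_n n)"
    then have "x \<in> B \<longleftrightarrow> s * gauge x \<le> s" using s gauge_le_one[of x] by (simp add: mult_le_cancel_left1)
    then show "indicator {..s} (gauge (scale_n n s x)) * G (scale_n n s x) = G (scale_n n s x) * indicator B x"
      using s by (simp add: gauge_scale indicator_def)
  qed
  finally show ?thesis using s by simp
qed

lemma square_deviation_split:
  fixes g :: "(nat \<Rightarrow> real) \<Rightarrow> real"
  assumes g[measurable]: "g \<in> borel_measurable (lborel_n n)" and bd: "\<And>x. x \<in> B \<Longrightarrow> \<bar>g x\<bar> \<le> K"
    and mean: "(\<integral>x. indicator B x * g x \<partial>lborel_n n) = vol * M"
  shows "(\<integral>\<^sup>+x\<in>B. ennreal ((g x - c)\<^sup>2) \<partial>lborel_n n)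
    = (\<integral>\<^sup>+x\<in>B. ennreal ((g x - M)\<^sup>2) \<partial>lborel_n n) + ennreal (vol * (M - c)\<^sup>2)"
proof -
  have i1: "integrable (lborel_n n) (\<lambda>x. indicator B x * g x)"
    by (rule integrable_on_body[OF g bd])
  have bd2: "\<bar>(g x)\<^sup>2\<bar> \<le> K\<^sup>2" if "x \<in> B" for x
    using bd[OF that] by (simp add: abs_le_square_iff[symmetric])
  have i2: "integrable (lborel_n n) (\<lambda>x. indicator B x * (g x)\<^sup>2)"
    by (rule integrable_on_body[OF _ bd2]) auto
  have i0: "integrable (lborel_n n) (\<lambda>x. indicator B x * (a::real))" for a by (auto simp: emeasure_B)
  have BE: "B \<inter> E_n n = B" using B_subset by auto
  have expand: "(\<integral>\<^sup>+x\<in>B. ennreal ((g x - a)\<^sup>2) \<partial>lborel_n n)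
    = ennreal ((\<integral>x. indicator B x * (g x)\<^sup>2 \<partial>lborel_n n) - 2 * a * (vol * M) + vol * a\<^sup>2)"
    and pos: "0 \<le> (\<integral>x. indicator B x * (g x)\<^sup>2 \<partial>lborel_n n) - 2 * a * (vol * M) + vol * a\<^sup>2" for a
  proof -
    have e: "indicator B x * (g x - a)\<^sup>2 = indicator B x * (g x)\<^sup>2 - 2 * a * (indicator B x * g x) + indicator B x * a\<^sup>2" for x
      by (simp add: power2_eq_square algebra_simps)
    have i: "integrable (lborel_n n) (\<lambda>x. indicator B x * (g x - a)\<^sup>2)"
      unfolding e using i0 i1 i2 by (intro Bochner_Integration.integrable_add Bochner_Integration.integrable_diff integrable_mult_right)
    have v: "(\<integral>x. indicator B x * (g x - a)\<^sup>2 \<partial>lborel_n n) = (\<integral>x. indicator B x * (g x)\<^sup>2 \<partial>lborel_n n) - 2 * a * (vol * M) + vol * a\<^sup>2"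
    proof -
      have "(\<integral>x. indicator B x * (g x - a)\<^sup>2 \<partial>lborel_n n)
        = (\<integral>x. indicator B x * (g x)\<^sup>2 - 2 * a * (indicator B x * g x) \<partial>lborel_n n) + (\<integral>x. indicator B x * a\<^sup>2 \<partial>lborel_n n)"
        unfolding e using i0 i1 i2 by (intro Bochner_Integration.integral_add Bochner_Integration.integrable_diff integrable_mult_right)
      also have "(\<integral>x. indicator B x * (g x)\<^sup>2 - 2 * a * (indicator B x * g x) \<partial>lborel_n n)
        = (\<integral>x. indicator B x * (g x)\<^sup>2 \<partial>lborel_n n) - (\<integral>x. 2 * a * (indicator B x * g x) \<partial>lborel_n n)"
        using i1 i2 by (intro Bochner_Integration.integral_diff integrable_mult_right)
      finally show ?thesis by (simp add: mean BE vol_def)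
    qed
    have "(\<integral>\<^sup>+x\<in>B. ennreal ((g x - a)\<^sup>2) \<partial>lborel_n n) = (\<integral>\<^sup>+x. ennreal (indicator B x * (g x - a)\<^sup>2) \<partial>lborel_n n)"
      by (intro nn_integral_cong) (simp add: indicator_def)
    also have "\<dots> = ennreal (\<integral>x. indicator B x * (g x - a)\<^sup>2 \<partial>lborel_n n)"
      by (rule nn_integral_eq_integral[OF i]) auto
    finally show "(\<integral>\<^sup>+x\<in>B. ennreal ((g x - a)\<^sup>2) \<partial>lborel_n n)
      = ennreal ((\<integral>x. indicator B x * (g x)\<^sup>2 \<partial>lborel_n n) - 2 * a * (vol * M) + vol * a\<^sup>2)" by (simp only: v)
    have "0 \<le> (\<integral>x. indicator B x * (g x - a)\<^sup>2 \<partial>lborel_n n)" by (intro integral_nonneg_AE) auto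
    then show "0 \<le> (\<integral>x. indicator B x * (g x)\<^sup>2 \<partial>lborel_n n) - 2 * a * (vol * M) + vol * a\<^sup>2" by (simp only: v)
  qed
  have eq: "(\<integral>x. indicator B x * (g x)\<^sup>2 \<partial>lborel_n n) - 2 * c * (vol * M) + vol * c\<^sup>2
    = ((\<integral>x. indicator B x * (g x)\<^sup>2 \<partial>lborel_n n) - 2 * M * (vol * M) + vol * M\<^sup>2) + vol * (M - c)\<^sup>2"
    by (simp add: power2_eq_square algebra_simps)
  show ?thesis
    unfolding expand eq using pos[of M] vol_pos by (intro ennreal_plus) auto
qed

text \<open>
  The mean over \<open>sB\<close> does not change when \<open>f\<close> is averaged over directions. Polar integration is available for
  nonnegative functions, so a constant is added first.
\<close>

lemma radial_mean_same_average:
  assumes f: "smooth n f" and s: "0 < s"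
  shows "(\<integral>x. indicator B x * f (scale_n n s x) \<partial>lborel_n n) = (\<integral>x. indicator B x * radial_mean f (s * gauge x) \<partial>lborel_n n)"
    and "integrable (lborel_n n) (\<lambda>x. indicator B x * f (scale_n n s x))"
    and "\<exists>K. \<forall>x\<in>B. \<bar>f (scale_n n s x)\<bar> \<le> K \<and> \<bar>radial_mean f (s * gauge x)\<bar> \<le> K"
proof -
  note cf = smooth_continuous[OF f]
  have [measurable]: "f \<in> borel_measurable (lborel_n n)" by (rule measurable_continuous_map[OF cf])
  note [measurable] = radial_mean_measurable[OF f]
  obtain b where b: "0 < b" "\<forall>x\<in>B. \<forall>i<n. \<bar>x i\<bar> \<le> b" by (rule convex_body_bounded[OF body])
  obtain K1 where K1: "0 \<le> K1" "\<forall>x\<in>E_n n. (\<forall>i<n. \<bar>x i\<bar> \<le> s * b) \<longrightarrow> \<bar>f x\<bar> \<le> K1"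
    by (rule continuous_map_bounded_on_box[OF cf])
  have f1: "\<bar>f (scale_n n s x)\<bar> \<le> K1" if x: "x \<in> B" for x
  proof -
    have "\<forall>i<n. \<bar>scale_n n s x i\<bar> \<le> s * b" using b x s by (auto simp: abs_mult)
    then show ?thesis using K1(2) affine_n_in by blast
  qed
  obtain K2 where K2: "0 \<le> K2" "\<forall>t y. \<bar>t\<bar> \<le> s \<longrightarrow> y \<in> B \<longrightarrow> \<bar>f (scale_n n t (proj y))\<bar> \<le> K2"
    by (rule bounded_along_rays[OF cf])
  have BE: "B \<inter> E_n n = B" using B_subset by auto
  have i0: "integrable (lborel_n n) (\<lambda>x. indicator B x * (a::real))" for a by (auto simp: emeasure_B)
  have m2: "\<bar>radial_mean f t\<bar> \<le> K2" if "\<bar>t\<bar> \<le> s" for t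
  proof -
    have "\<bar>\<integral>y. indicator B y * f (scale_n n t (proj y)) \<partial>lborel_n n\<bar> \<le> (\<integral>y. indicator B y * K2 \<partial>lborel_n n)"
    proof (rule order_trans[OF integral_abs_bound], rule integral_mono)
      show "integrable (lborel_n n) (\<lambda>y. \<bar>indicator B y * f (scale_n n t (proj y))\<bar>)"
        by (intro integrable_abs integrable_ray cf)
      show "\<bar>indicator B y * f (scale_n n t (proj y))\<bar> \<le> indicator B y * K2" for y
        using K2(2) that by (auto simp: indicator_def)
    qed (rule i0)
    also have "\<dots> = vol * K2" by (simp add: BE vol_def)
    finally show ?thesis unfolding radial_mean_def using vol_pos by (simp add: abs_divide divide_le_eq mult.commute)
  qed
  define K where "K = max K1 K2"
  have fK: "\<bar>f (scale_n n s x)\<bar> \<le> K" if "x \<in> B" for x using f1[OF that] by (simp add: K_def)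
  have mK: "\<bar>radial_mean f t\<bar> \<le> K" if "\<bar>t\<bar> \<le> s" for t using m2[OF that] by (simp add: K_def)
  have rK: "\<bar>f (scale_n n t (proj y))\<bar> \<le> K" if "\<bar>t\<bar> \<le> s" "y \<in> B" for t y
  proof -
    have "\<bar>f (scale_n n t (proj y))\<bar> \<le> K2" using K2(2) that by blast
    then show ?thesis by (simp add: K_def)
  qed
  have sg: "\<bar>s * gauge x\<bar> \<le> s" if "x \<in> B" for x
    using gauge_le_one[of x] that B_subset s gauge_nonneg[of x] by (auto simp: mult_le_cancel_left1)
  show "\<exists>K. \<forall>x\<in>B. \<bar>f (scale_n n s x)\<bar> \<le> K \<and> \<bar>radial_mean f (s * gauge x)\<bar> \<le> K"
    using fK mK[OF sg] by blast
  show if1: "integrable (lborel_n n) (\<lambda>x. indicator B x * f (scale_n n s x))"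
    by (rule integrable_on_body[OF _ fK]) measurable
  have im: "integrable (lborel_n n) (\<lambda>x. indicator B x * radial_mean f (s * gauge x))"
    by (rule integrable_on_body[OF _ mK[OF sg]]) measurable
  have shift: "(\<integral>\<^sup>+x\<in>B. ennreal (g x + K) \<partial>lborel_n n) = ennreal ((\<integral>x. indicator B x * g x \<partial>lborel_n n) + vol * K)"
      "0 \<le> (\<integral>x. indicator B x * g x \<partial>lborel_n n) + vol * K"
    if i: "integrable (lborel_n n) (\<lambda>x. indicator B x * g x)" and bd: "\<And>x. x \<in> B \<Longrightarrow> \<bar>g x\<bar> \<le> K" for g :: "(nat \<Rightarrow> real) \<Rightarrow> real"
  proof -
    have p: "0 \<le> indicator B x * g x + indicator B x * K" for x using bd[of x] by (auto simp: indicator_def)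
    have v: "(\<integral>x. indicator B x * g x + indicator B x * K \<partial>lborel_n n) = (\<integral>x. indicator B x * g x \<partial>lborel_n n) + vol * K"
      by (subst Bochner_Integration.integral_add[OF i i0]) (simp add: BE vol_def)
    have "(\<integral>\<^sup>+x\<in>B. ennreal (g x + K) \<partial>lborel_n n) = (\<integral>\<^sup>+x. ennreal (indicator B x * g x + indicator B x * K) \<partial>lborel_n n)"
      by (intro nn_integral_cong) (simp add: indicator_def)
    also have "\<dots> = ennreal (\<integral>x. indicator B x * g x + indicator B x * K \<partial>lborel_n n)"
      using p i i0 by (intro nn_integral_eq_integral) auto
    finally show "(\<integral>\<^sup>+x\<in>B. ennreal (g x + K) \<partial>lborel_n n) = ennreal ((\<integral>x. indicator B x * g x \<partial>lborel_n n) + vol * K)"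
      by (simp only: v)
    have "0 \<le> (\<integral>x. indicator B x * g x + indicator B x * K \<partial>lborel_n n)" using p by (intro integral_nonneg_AE) auto
    then show "0 \<le> (\<integral>x. indicator B x * g x \<partial>lborel_n n) + vol * K" by (simp only: v)
  qed
  let ?F = "\<lambda>x. ennreal (f (scale_n n s x) + K)" and ?\<psi> = "\<lambda>t. ennreal (radial_mean f (s * t) + K)"
  have "(\<integral>\<^sup>+x. indicator {..1} (gauge x) * ?F x \<partial>lborel_n n) = (\<integral>\<^sup>+x. indicator {..1} (gauge x) * ?\<psi> (gauge x) \<partial>lborel_n n)"
  proof (rule polar_radial_mean)
    fix t :: real assume t: "0 < t" "indicator {..1} t \<noteq> (0::ennreal)"
    then have st: "\<bar>s * t\<bar> \<le> s" using s by (auto simp: indicator_def mult_le_cancel_left1 split: if_splits)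
    have "(\<integral>\<^sup>+y\<in>B. ?F (scale_n n t (proj y)) \<partial>lborel_n n) = (\<integral>\<^sup>+y\<in>B. ennreal (f (scale_n n (s * t) (proj y)) + K) \<partial>lborel_n n)"
      by simp
    also have "\<dots> = ennreal ((\<integral>x. indicator B x * f (scale_n n (s * t) (proj x)) \<partial>lborel_n n) + vol * K)"
      using rK[OF st] by (intro shift integrable_ray cf)
    also have "(\<integral>x. indicator B x * f (scale_n n (s * t) (proj x)) \<partial>lborel_n n) + vol * K = vol * (radial_mean f (s * t) + K)"
      using vol_pos by (simp add: radial_mean_def algebra_simps)
    also have "ennreal \<dots> = ennreal vol * ?\<psi> t"
      using vol_pos mK[OF st] by (intro ennreal_mult) auto
    finally show "(\<integral>\<^sup>+y\<in>B. ?F (scale_n n t (proj y)) \<partial>lborel_n n) = ennreal vol * ?\<psi> t" .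
  qed measurable
  moreover have "(\<integral>\<^sup>+x. indicator {..1} (gauge x) * G x \<partial>lborel_n n) = (\<integral>\<^sup>+x\<in>B. G x \<partial>lborel_n n)" for G :: "(nat \<Rightarrow> real) \<Rightarrow> ennreal"
    by (intro nn_integral_cong) (auto simp: indicator_def gauge_le_one)
  ultimately have "(\<integral>\<^sup>+x\<in>B. ?F x \<partial>lborel_n n) = (\<integral>\<^sup>+x\<in>B. ?\<psi> (gauge x) \<partial>lborel_n n)" by simp
  then have "ennreal ((\<integral>x. indicator B x * f (scale_n n s x) \<partial>lborel_n n) + vol * K)
    = ennreal ((\<integral>x. indicator B x * radial_mean f (s * gauge x) \<partial>lborel_n n) + vol * K)"
    by (simp only: shift(1)[OF if1 fK] shift(1)[OF im mK[OF sg]])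
  then show "(\<integral>x. indicator B x * f (scale_n n s x) \<partial>lborel_n n) = (\<integral>x. indicator B x * radial_mean f (s * gauge x) \<partial>lborel_n n)"
    using shift(2)[OF if1 fK] shift(2)[OF im mK[OF sg]] by (subst (asm) ennreal_inj) auto
qed

text \<open>
  Split the deviation from \<open>c\<close> into the variance over \<open>sB\<close> and the deviation of the mean. The former is
  controlled by the inequality of \<open>B\<close>, rescaled; the latter is also the mean of the radial average
  and hence at most its mean square deviation from \<open>c\<close>.
\<close>

lemma poincare_on_dilate:
  assumes A: "poincare_bound A" "0 \<le> A" and f: "smooth n f" and s: "0 < s"
  shows "(\<integral>\<^sup>+x. indicator {..s} (gauge x) * ennreal ((f x - c)\<^sup>2) \<partial>lborel_n n)
    \<le> ennreal (s\<^sup>2 * A) * (\<integral>\<^sup>+x. indicator {..s} (gauge x) * ennreal (grad_sq n f x) \<partial>lborel_n n)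
      + (\<integral>\<^sup>+x. indicator {..s} (gauge x) * ennreal ((radial_mean f (gauge x) - c)\<^sup>2) \<partial>lborel_n n)"
proof -
  note cf = smooth_continuous[OF f]
  have [measurable]: "f \<in> borel_measurable (lborel_n n)" by (rule measurable_continuous_map[OF cf])
  note [measurable] = radial_mean_measurable[OF f] grad_sq_measurable[OF f]
  let ?g = "\<lambda>x. f (scale_n n s x)" and ?u = "\<lambda>x. radial_mean f (s * gauge x)"
  define M where "M = (\<integral>x. indicator B x * ?g x \<partial>lborel_n n) / vol"
  have Mg: "(\<integral>x. indicator B x * ?g x \<partial>lborel_n n) = vol * M" using vol_pos by (simp add: M_def)
  have Mu: "(\<integral>x. indicator B x * ?u x \<partial>lborel_n n) = vol * M"
    using radial_mean_same_average(1)[OF f s] Mg by simp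
  obtain K where K: "\<forall>x\<in>B. \<bar>?g x\<bar> \<le> K \<and> \<bar>?u x\<bar> \<le> K" using radial_mean_same_average(3)[OF f s] by blast
  have v: "ennreal vol \<noteq> 0" "ennreal vol < top" using vol_pos by auto
  have cancel: "X \<le> a * Y" if "X / ennreal vol \<le> a * (Y / ennreal vol)" for X Y a
  proof -
    have "X / ennreal vol * ennreal vol \<le> a * (Y / ennreal vol) * ennreal vol" using that by (rule mult_right_mono) simp
    then show ?thesis using v by (simp add: ennreal_divide_times mult.assoc)
  qed
  have var: "(\<integral>\<^sup>+x\<in>B. ennreal ((?g x - M)\<^sup>2) \<partial>lborel_n n) \<le> ennreal A * (\<integral>\<^sup>+x\<in>B. ennreal (s\<^sup>2 * grad_sq n f (scale_n n s x)) \<partial>lborel_n n)"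
  proof (rule cancel)
    have int: "integrable (uniform_on_body n B) ?g"
      unfolding uniform_on_body_density[OF body] vol_def[symmetric]
      using vol_pos radial_mean_same_average(2)[OF f s]
      by (subst integrable_density) (auto simp: mult.commute)
    have mean: "(\<integral>x. ?g x \<partial>uniform_on_body n B) = M"
      unfolding M_def vol_def by (rule integral_uniform_on_body[OF body]) measurable
    have "variance_of (uniform_on_body n B) ?g = (\<integral>\<^sup>+x\<in>B. ennreal ((?g x - M)\<^sup>2) \<partial>lborel_n n) / ennreal vol"
      unfolding variance_of_def mean vol_def by (rule nn_integral_uniform_on_body[OF body]) measurable
    moreover have "energy n (uniform_on_body n B) ?g = (\<integral>\<^sup>+x\<in>B. ennreal (s\<^sup>2 * grad_sq n f (scale_n n s x)) \<partial>lborel_n n) / ennreal vol"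
      unfolding energy_def grad_sq_scale[OF f] vol_def by (rule nn_integral_uniform_on_body[OF body]) measurable
    ultimately show "(\<integral>\<^sup>+x\<in>B. ennreal ((?g x - M)\<^sup>2) \<partial>lborel_n n) / ennreal vol
      \<le> ennreal A * ((\<integral>\<^sup>+x\<in>B. ennreal (s\<^sup>2 * grad_sq n f (scale_n n s x)) \<partial>lborel_n n) / ennreal vol)"
      using A(1) smooth_scale[OF f, of s] int unfolding poincare_bound_def by metis
  qed
  have grad: "ennreal A * (\<integral>\<^sup>+x\<in>B. ennreal (s\<^sup>2 * grad_sq n f (scale_n n s x)) \<partial>lborel_n n)
    = ennreal (s\<^sup>2 * A) * (\<integral>\<^sup>+x\<in>B. ennreal (grad_sq n f (scale_n n s x)) \<partial>lborel_n n)"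
  proof -
    have "(\<integral>\<^sup>+x\<in>B. ennreal (s\<^sup>2 * grad_sq n f (scale_n n s x)) \<partial>lborel_n n)
      = (\<integral>\<^sup>+x. ennreal (s\<^sup>2) * (ennreal (grad_sq n f (scale_n n s x)) * indicator B x) \<partial>lborel_n n)"
      by (intro nn_integral_cong) (simp add: ennreal_mult mult.assoc)
    also have "\<dots> = ennreal (s\<^sup>2) * (\<integral>\<^sup>+x\<in>B. ennreal (grad_sq n f (scale_n n s x)) \<partial>lborel_n n)"
      by (rule nn_integral_cmult) measurable
    finally show ?thesis using A(2) by (simp add: ennreal_mult mult.assoc[symmetric] mult.commute)
  qed
  have "(\<integral>\<^sup>+x\<in>B. ennreal ((?g x - c)\<^sup>2) \<partial>lborel_n n)
    = (\<integral>\<^sup>+x\<in>B. ennreal ((?g x - M)\<^sup>2) \<partial>lborel_n n) + ennreal (vol * (M - c)\<^sup>2)"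
    by (rule square_deviation_split[OF _ _ Mg]) (use K in auto)
  also have "ennreal (vol * (M - c)\<^sup>2) \<le> (\<integral>\<^sup>+x\<in>B. ennreal ((?u x - c)\<^sup>2) \<partial>lborel_n n)"
    by (subst square_deviation_split[OF _ _ Mu, of K]) (use K in auto)
  finally have "(\<integral>\<^sup>+x\<in>B. ennreal ((?g x - c)\<^sup>2) \<partial>lborel_n n)
    \<le> ennreal (s\<^sup>2 * A) * (\<integral>\<^sup>+x\<in>B. ennreal (grad_sq n f (scale_n n s x)) \<partial>lborel_n n) + (\<integral>\<^sup>+x\<in>B. ennreal ((?u x - c)\<^sup>2) \<partial>lborel_n n)"
    using var unfolding grad by (meson add_left_mono add_right_mono order_trans)
  then have le: "ennreal (s ^ n) * (\<integral>\<^sup>+x\<in>B. ennreal ((?g x - c)\<^sup>2) \<partial>lborel_n n)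
    \<le> ennreal (s ^ n) * (ennreal (s\<^sup>2 * A) * (\<integral>\<^sup>+x\<in>B. ennreal (grad_sq n f (scale_n n s x)) \<partial>lborel_n n) + (\<integral>\<^sup>+x\<in>B. ennreal ((?u x - c)\<^sup>2) \<partial>lborel_n n))"
    by (rule mult_left_mono) simp
  have g: "(\<integral>\<^sup>+x. indicator {..s} (gauge x) * G x \<partial>lborel_n n) = ennreal (s ^ n) * (\<integral>\<^sup>+x\<in>B. G (scale_n n s x) \<partial>lborel_n n)"
    if "G \<in> borel_measurable (lborel_n n)" for G
    by (rule nn_integral_gauge_le[OF s that])
  have "(\<integral>\<^sup>+x. indicator {..s} (gauge x) * ennreal ((radial_mean f (gauge x) - c)\<^sup>2) \<partial>lborel_n n)
    = ennreal (s ^ n) * (\<integral>\<^sup>+x\<in>B. ennreal ((?u x - c)\<^sup>2) \<partial>lborel_n n)"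
    by (subst g) (use s in \<open>auto simp: gauge_scale\<close>)
  moreover have "(\<integral>\<^sup>+x. indicator {..s} (gauge x) * ennreal ((f x - c)\<^sup>2) \<partial>lborel_n n)
    = ennreal (s ^ n) * (\<integral>\<^sup>+x\<in>B. ennreal ((?g x - c)\<^sup>2) \<partial>lborel_n n)"
    by (rule g) measurable
  moreover have "(\<integral>\<^sup>+x. indicator {..s} (gauge x) * ennreal (grad_sq n f x) \<partial>lborel_n n)
    = ennreal (s ^ n) * (\<integral>\<^sup>+x\<in>B. ennreal (grad_sq n f (scale_n n s x)) \<partial>lborel_n n)"
    by (rule g) measurable
  ultimately show ?thesis using le by (simp add: distrib_left mult.left_commute)
qed

lemma gauge_level_null: "AE x in lborel_n n. gauge x \<noteq> s"
proof -
  have "(\<integral>\<^sup>+x. indicator {s} (gauge x) * 1 \<partial>lborel_n n)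
    = (\<integral>\<^sup>+t\<in>{0<..}. ennreal (real n * t ^ (n - 1)) * indicator {s} t * (\<integral>\<^sup>+y\<in>B. 1 \<partial>lborel_n n) \<partial>lborel)"
    by (rule polar_radial) measurable
  also have "\<dots> = (\<integral>\<^sup>+t. 0 \<partial>(lborel :: real measure))"
    using AE_lborel_singleton[of s] by (intro nn_integral_cong_AE) (auto elim!: eventually_mono)
  finally have "(\<integral>\<^sup>+x. indicator {s} (gauge x) \<partial>lborel_n n) = 0" by simp
  then have "AE x in lborel_n n. indicator {s} (gauge x) = (0::ennreal)"
    by (subst (asm) nn_integral_0_iff_AE) auto
  then show ?thesis by (auto elim!: eventually_mono simp: indicator_def split: if_splits)
qed

end

section \<open>Centre and tail of the radial density\<close>

context log_concave_profile begin

text \<open>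
  Up to normalisation the density of \<open>|X|\<^sub>B\<close> for \<open>X\<close> of law \<open>\<mu>\<close>. The maximum only makes the function
  measurable on the whole line, as nothing is known about \<open>\<rho>\<close> on negative numbers.
\<close>

definition radial_density :: "nat \<Rightarrow> real \<Rightarrow> real" where
  "radial_density n t = t ^ (n - 1) * \<rho> (max 0 t)"

lemma radial_density_measurable [measurable]: "radial_density n \<in> borel_measurable borel"
  unfolding radial_density_def by measurable

lemma radial_density_nonneg: "0 \<le> t \<Longrightarrow> 0 \<le> radial_density n t"
  unfolding radial_density_def using nonneg[of t] by simp

lemma radial_density_le: "0 \<le> t \<Longrightarrow> t \<le> b \<Longrightarrow> radial_density n t \<le> b ^ (n - 1) * \<rho> 0"
  unfolding radial_density_def using antimonoD[of 0 t] nonneg[of t]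
  by (intro mult_mono power_mono) auto

text \<open>
  The Gaussian bound has width \<open>s / \<surd>(n - 1)\<close>, and for \<open>n = 1\<close>, where it degenerates, the length \<open>s\<close> of the
  interval does the same service.
\<close>

lemma radial_centre:
  assumes n: "1 \<le> n" and s: "0 < s"
  obtains c where "c \<in> {0..s}"
    "\<And>w. w \<in> {c<..s} \<Longrightarrow> (\<integral>\<^sup>+u\<in>{w..s}. ennreal (radial_density n u) \<partial>lborel) \<le> ennreal (2 * s / sqrt n * radial_density n w)"
    "\<And>w. w \<in> {0..<c} \<Longrightarrow> (\<integral>\<^sup>+u\<in>{0..w}. ennreal (radial_density n u) \<partial>lborel) \<le> ennreal (2 * s / sqrt n * radial_density n w)"
proof (rule dichotomy_centre)
  show "0 \<le> s" using s by simp
  fix w assume w: "w \<in> {0<..s}"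
  define k where "k = n - 1"
  define G where "G u = exp (- real k * (u - w)\<^sup>2 / (2 * s\<^sup>2))" for u
  have gauss: "(\<integral>\<^sup>+u\<in>{a..b}. ennreal (G u) \<partial>lborel) \<le> ennreal (2 * s / sqrt n)"
    if ab: "0 \<le> a" "b \<le> s" "w \<in> {a..b}" "a = w \<or> b = w" for a b
  proof (cases "k = 0")
    case True
    then have n1: "n = 1" using n by (simp add: k_def)
    have "(\<integral>\<^sup>+u\<in>{a..b}. ennreal (G u) \<partial>lborel) = (\<integral>\<^sup>+u. indicator {a..b} u \<partial>lborel)"
      by (intro nn_integral_cong) (simp add: G_def True)
    also have "\<dots> = ennreal (b - a)" using ab by simp
    also have "\<dots> \<le> ennreal (2 * s / sqrt n)"
      using ab s by (intro ennreal_leI) (simp add: n1)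
    finally show ?thesis .
  next
    case False
    then have n2: "2 \<le> n" "0 < k" by (auto simp: k_def)
    \<comment> \<open>the constant \<open>2\<close> in front of \<open>s / \<surd>n\<close> absorbs both \<open>\<pi> \<le> 4\<close> and \<open>n \<le> 2 (n - 1)\<close>\<close>
    define K where "K = 2 * s\<^sup>2 / real k"
    have K: "0 < K" using n2 s by (simp add: K_def)
    have "(\<integral>\<^sup>+u\<in>{a..b}. ennreal (G u) \<partial>lborel) = (\<integral>\<^sup>+u\<in>{a..b}. ennreal (exp (- (u - w)\<^sup>2 / K)) \<partial>lborel)"
      using n2 s by (simp add: G_def K_def mult.commute)
    also have "\<dots> \<le> ennreal (sqrt (pi * K) / 2)"
      by (rule nn_integral_gaussian_Icc[OF K]) (use ab in auto)
    also have "\<dots> \<le> ennreal (2 * s / sqrt n)"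
    proof (intro ennreal_leI)
      have "pi * n \<le> 4 * (2 * real k)"
      proof -
        have "pi * real n \<le> 4 * real n" using pi_less_4 by (intro mult_right_mono) auto
        also have "\<dots> \<le> 4 * (2 * real k)" using n2 by (simp add: k_def)
        finally show ?thesis .
      qed
      then have "pi * K / 4 \<le> (2 * s)\<^sup>2 / n"
        using n2 s by (simp add: K_def divide_simps power_mult_distrib)
      then have "sqrt (pi * K / 4) \<le> sqrt ((2 * s)\<^sup>2 / n)" by (rule real_sqrt_le_mono)
      then show "sqrt (pi * K) / 2 \<le> 2 * s / sqrt n"
        using s by (simp add: real_sqrt_divide real_sqrt_mult)
    qed
    finally show ?thesis .
  qed
  have bound: "(\<integral>\<^sup>+u\<in>{a..b}. ennreal (radial_density n u) \<partial>lborel) \<le> ennreal (2 * s / sqrt n * radial_density n w)"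
    if ab: "0 \<le> a" "b \<le> s" "w \<in> {a..b}" "a = w \<or> b = w"
      and dom: "\<And>u. u \<in> {a..b} \<Longrightarrow> radial_density n u \<le> radial_density n w * G u" for a b
  proof -
    have pw: "0 \<le> radial_density n w" using w by (intro radial_density_nonneg) auto
    have "(\<integral>\<^sup>+u\<in>{a..b}. ennreal (radial_density n u) \<partial>lborel)
      \<le> (\<integral>\<^sup>+u. ennreal (radial_density n w) * (ennreal (G u) * indicator {a..b} u) \<partial>lborel)"
      using dom pw by (intro nn_integral_mono) (auto simp: indicator_def ennreal_mult[symmetric] G_def intro!: ennreal_leI)
    also have "\<dots> = ennreal (radial_density n w) * (\<integral>\<^sup>+u\<in>{a..b}. ennreal (G u) \<partial>lborel)"
      unfolding G_def by (rule nn_integral_cmult) measurable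
    also have "\<dots> \<le> ennreal (radial_density n w) * ennreal (2 * s / sqrt n)"
      by (intro mult_left_mono gauss ab) simp
    also have "\<dots> = ennreal (2 * s / sqrt n * radial_density n w)"
      using pw s by (simp add: ennreal_mult[symmetric] mult.commute)
    finally show ?thesis .
  qed
  have G0: "G w = 1" by (simp add: G_def)
  have w': "0 < w" "w \<le> s" using w by auto
  from radial_density_gaussian_bound[OF n w']
  show "(\<integral>\<^sup>+u\<in>{w..s}. ennreal (radial_density n u) \<partial>lborel) \<le> ennreal (2 * s / sqrt n * radial_density n w)
      \<or> (\<integral>\<^sup>+u\<in>{0..w}. ennreal (radial_density n u) \<partial>lborel) \<le> ennreal (2 * s / sqrt n * radial_density n w)"
  proof (elim disjE)
    assume R: "\<forall>u. w < u \<and> u \<le> s \<longrightarrow> u ^ (n - 1) * \<rho> u \<le> w ^ (n - 1) * \<rho> w * exp (- real (n - 1) * (u - w)\<^sup>2 / (2 * s\<^sup>2))"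
    have "radial_density n u \<le> radial_density n w * G u" if u: "u \<in> {w..s}" for u
    proof (cases "u = w")
      case False
      then have "w < u \<and> u \<le> s" using u by auto
      then show ?thesis using spec[OF R, of u] w by (simp add: radial_density_def G_def k_def)
    qed (simp add: G0)
    then show ?thesis using w by (intro disjI1 bound) auto
  next
    assume L: "\<forall>u. 0 \<le> u \<and> u < w \<longrightarrow> u ^ (n - 1) * \<rho> u \<le> w ^ (n - 1) * \<rho> w * exp (- real (n - 1) * (u - w)\<^sup>2 / (2 * s\<^sup>2))"
    have "radial_density n u \<le> radial_density n w * G u" if u: "u \<in> {0..w}" for u
    proof (cases "u = w")
      case False
      then have "0 \<le> u \<and> u < w" using u by auto
      then show ?thesis using spec[OF L, of u] w by (simp add: radial_density_def G_def k_def)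
    qed (simp add: G0)
    then show ?thesis using w by (intro disjI2 bound) auto
  qed
qed (rule that)

text \<open>
  Half of the decay rate \<open>2 n / r\<close> of the profile is spent on the growth of \<open>t\<^sup>n\<^sup>-\<^sup>1\<close>.
\<close>

lemma radial_density_decay:
  assumes n: "1 \<le> n" and r: "0 < r" and dec: "\<forall>u>r. \<rho> u \<le> \<rho> r * exp (- (2 * real n / r) * (u - r))"
    and w: "r \<le> w" "w \<le> u"
  shows "radial_density n u \<le> radial_density n w * exp (- (real n / r) * (u - w))"
proof (cases "w = u")
  case False
  then have wu: "w < u" using w by simp
  have rho: "\<rho> u \<le> \<rho> w * exp (- (2 * real n / r) * (u - w))"
  proof (cases "r = w")
    case True
    then show ?thesis using dec wu by simp
  next
    case False
    then have rw: "r < w" using w by simp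
    have "\<rho> w \<le> \<rho> r * exp (- (2 * real n / r) * (w - r))" by (rule dec[rule_format, OF rw])
    then have "\<rho> w * exp (2 * real n / r * (w - r)) \<le> \<rho> r * exp (- (2 * real n / r) * (w - r)) * exp (2 * real n / r * (w - r))"
      by (rule mult_right_mono) simp
    also have "\<dots> = \<rho> r" by (simp add: mult.assoc exp_add[symmetric])
    finally show ?thesis using r rw wu by (intro decay_rate_propagates[of r w u "2 * real n / r"]) auto
  qed
  have "u / w \<le> exp ((u - w) / r)"
  proof -
    have "u / w = 1 + (u - w) / w" using r w by (simp add: field_simps)
    also have "\<dots> \<le> 1 + (u - w) / r" using r w by (intro add_left_mono divide_left_mono) auto
    also have "\<dots> \<le> exp ((u - w) / r)" by (rule exp_ge_add_one_self)
    finally show ?thesis .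
  qed
  then have "u \<le> w * exp ((u - w) / r)" using r w by (simp add: divide_le_eq mult.commute)
  then have "u ^ (n - 1) \<le> (w * exp ((u - w) / r)) ^ (n - 1)" using r w by (intro power_mono) auto
  also have "\<dots> = w ^ (n - 1) * exp (real (n - 1) * ((u - w) / r))" by (simp only: power_mult_distrib exp_of_nat_mult)
  also have "\<dots> \<le> w ^ (n - 1) * exp (real n * ((u - w) / r))"
  proof -
    have "real (n - 1) * ((u - w) / r) \<le> real n * ((u - w) / r)" using r w by (intro mult_right_mono) auto
    then show ?thesis using r w by (intro mult_left_mono) (auto simp only: exp_le_cancel_iff zero_le_power)
  qed
  finally have pw: "u ^ (n - 1) \<le> w ^ (n - 1) * exp (real n * ((u - w) / r))" .
  have "u ^ (n - 1) * \<rho> u \<le> (w ^ (n - 1) * exp (real n * ((u - w) / r))) * (\<rho> w * exp (- (2 * real n / r) * (u - w)))"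
    using pw rho r w nonneg[of u] by (intro mult_mono) auto
  also have "\<dots> = w ^ (n - 1) * \<rho> w * (exp (real n * ((u - w) / r)) * exp (- (2 * real n / r) * (u - w)))"
    by (simp only: mult_ac)
  also have "exp (real n * ((u - w) / r)) * exp (- (2 * real n / r) * (u - w)) = exp (- (real n / r) * (u - w))"
    unfolding exp_add[symmetric] by (rule arg_cong[of _ _ exp]) (simp add: field_simps)
  finally show ?thesis using r w by (simp add: radial_density_def max_def)
qed simp

text \<open>
  Start the Hardy inequality at any \<open>a\<close> between \<open>r\<close> and \<open>2 r\<close>; the boundary term is a multiple of \<open>h(a)\<^sup>2 p(a)\<close>.
  Averaging over \<open>a\<close> turns it into an integral over \<open>[r, 2 r]\<close>. Truncation at \<open>N\<close> keeps the integrals finite.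
\<close>

lemma radial_tail_hardy:
  fixes h h' :: "real \<Rightarrow> real"
  assumes n: "1 \<le> n" and r: "0 < r" and dec: "\<forall>u>r. \<rho> u \<le> \<rho> r * exp (- (2 * real n / r) * (u - r))"
    and deriv: "\<And>x. (h has_real_derivative h' x) (at x)" and cont: "continuous_on UNIV h'"
  shows "(\<integral>\<^sup>+t\<in>{2 * r<..}. ennreal ((h t)\<^sup>2 * radial_density n t) \<partial>lborel)
    \<le> ennreal (8 * (r / real n)\<^sup>2) * (\<integral>\<^sup>+t\<in>{0<..}. ennreal ((h' t)\<^sup>2 * radial_density n t) \<partial>lborel)
      + ennreal 2 * (\<integral>\<^sup>+t\<in>{0<..2 * r}. ennreal ((h t)\<^sup>2 * radial_density n t) \<partial>lborel)"
proof -
  let ?p = "radial_density n"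
  have conth: "continuous_on UNIV h"
    using deriv by (meson DERIV_isCont continuous_at_imp_continuous_on)
  note [measurable] = borel_measurable_continuous_onI[OF conth] borel_measurable_continuous_onI[OF cont]
  define J where "J = (\<integral>\<^sup>+t\<in>{0<..}. ennreal ((h' t)\<^sup>2 * ?p t) \<partial>lborel)"
  define T where "T = (\<integral>\<^sup>+t\<in>{2 * r<..}. ennreal ((h t)\<^sup>2 * ?p t) \<partial>lborel)"
  have p0: "0 \<le> ?p t" if "0 \<le> t" for t using that by (rule radial_density_nonneg)
  have tail: "(\<integral>\<^sup>+u\<in>{w..N}. ennreal (?p u) \<partial>lborel) \<le> ennreal (r / real n * ?p w)" if w: "r \<le> w" for w N
  proof -
    have pw: "0 \<le> ?p w" using w r by (intro p0) auto
    have "(\<integral>\<^sup>+u\<in>{w..N}. ennreal (?p u) \<partial>lborel) \<le> (\<integral>\<^sup>+u. ennreal (?p w) * (ennreal (exp (- (real n / r) * (u - w))) * indicator {w..N} u) \<partial>lborel)"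
      using radial_density_decay[OF n r dec w] pw
      by (intro nn_integral_mono) (auto simp: indicator_def ennreal_mult[symmetric] intro!: ennreal_leI)
    also have "\<dots> = ennreal (?p w) * (\<integral>\<^sup>+u\<in>{w..N}. ennreal (exp (- (real n / r) * (u - w))) \<partial>lborel)"
      by (rule nn_integral_cmult) measurable
    also have "\<dots> \<le> ennreal (?p w) * ennreal (1 / (real n / r))"
      using n r by (intro mult_left_mono nn_integral_exp_decay_Icc) auto
    also have "\<dots> = ennreal (r / real n * ?p w)" using pw r by (simp add: ennreal_mult[symmetric] mult.commute)
    finally show ?thesis .
  qed
  have trunc: "(\<integral>\<^sup>+t\<in>{2 * r<..N}. ennreal ((h t)\<^sup>2 * ?p t) \<partial>lborel)
      \<le> ennreal (8 * (r / real n)\<^sup>2) * J + ennreal (2 * (r / real n)) * ennreal ((h a)\<^sup>2 * ?p a)"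
    if a: "r \<le> a" "a \<le> 2 * r" and N: "2 * r \<le> N" for a N
  proof -
    have d': "((\<lambda>t. h t - h a) has_real_derivative h' x) (at x)" for x
      using DERIV_diff[OF deriv DERIV_const] by simp
    have hardy: "(\<integral>\<^sup>+u\<in>{a..N}. ennreal ((h u - h a)\<^sup>2 * ?p u) \<partial>lborel)
      \<le> ennreal (4 * (r / real n)\<^sup>2) * (\<integral>\<^sup>+u\<in>{a..N}. ennreal ((h' u)\<^sup>2 * ?p u) \<partial>lborel)"
    proof (rule hardy_right[OF d' cont])
      show "0 \<le> ?p x" "?p x \<le> N ^ (n - 1) * \<rho> 0" if "x \<in> {a..N}" for x
        using that a r by (intro p0 radial_density_le; simp)+
      show "(\<integral>\<^sup>+u\<in>{w..N}. ennreal (?p u) \<partial>lborel) \<le> ennreal (r / real n * ?p w)" if "w \<in> {a<..N}" for w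
        using that a by (intro tail) simp
    qed (use r in auto)
    have "(\<integral>\<^sup>+t\<in>{2 * r<..N}. ennreal ((h t)\<^sup>2 * ?p t) \<partial>lborel)
      \<le> (\<integral>\<^sup>+u. ennreal 2 * (ennreal ((h u - h a)\<^sup>2 * ?p u) * indicator {a..N} u) + ennreal (2 * (h a)\<^sup>2) * (ennreal (?p u) * indicator {a..N} u) \<partial>lborel)"
    proof (intro nn_integral_mono)
      fix u
      show "ennreal ((h u)\<^sup>2 * ?p u) * indicator {2 * r<..N} u
        \<le> ennreal 2 * (ennreal ((h u - h a)\<^sup>2 * ?p u) * indicator {a..N} u) + ennreal (2 * (h a)\<^sup>2) * (ennreal (?p u) * indicator {a..N} u)"
      proof (cases "u \<in> {2 * r<..N}")
        case True
        then have u: "0 \<le> ?p u" "u \<in> {a..N}" using a r by (auto intro!: p0)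
        have "(h u)\<^sup>2 \<le> 2 * (h u - h a)\<^sup>2 + 2 * (h a)\<^sup>2"
          using sum_squares_bound[of "h u - h a" "h a"] by (simp add: power2_eq_square algebra_simps)
        then have "(h u)\<^sup>2 * ?p u \<le> (2 * (h u - h a)\<^sup>2 + 2 * (h a)\<^sup>2) * ?p u" using u by (intro mult_right_mono)
        also have "\<dots> = 2 * ((h u - h a)\<^sup>2 * ?p u) + 2 * (h a)\<^sup>2 * ?p u" by (simp add: algebra_simps)
        finally have "ennreal ((h u)\<^sup>2 * ?p u) \<le> ennreal (2 * ((h u - h a)\<^sup>2 * ?p u) + 2 * (h a)\<^sup>2 * ?p u)"
          by (rule ennreal_leI)
        also have "\<dots> = ennreal (2 * ((h u - h a)\<^sup>2 * ?p u)) + ennreal (2 * (h a)\<^sup>2 * ?p u)"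
          using u by (intro ennreal_plus) auto
        also have "\<dots> = ennreal 2 * ennreal ((h u - h a)\<^sup>2 * ?p u) + ennreal (2 * (h a)\<^sup>2) * ennreal (?p u)"
          using u by (intro arg_cong2[of _ _ _ _ "(+)"] ennreal_mult) auto
        finally show ?thesis using True u by simp
      qed simp
    qed
    also have "\<dots> = ennreal 2 * (\<integral>\<^sup>+u\<in>{a..N}. ennreal ((h u - h a)\<^sup>2 * ?p u) \<partial>lborel) + ennreal (2 * (h a)\<^sup>2) * (\<integral>\<^sup>+u\<in>{a..N}. ennreal (?p u) \<partial>lborel)"
      by (subst nn_integral_add, measurable, subst (1 2) nn_integral_cmult, measurable)
    also have "\<dots> \<le> ennreal 2 * (ennreal (4 * (r / real n)\<^sup>2) * J) + ennreal (2 * (h a)\<^sup>2) * ennreal (r / real n * ?p a)"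
    proof (intro add_mono mult_left_mono tail a order_trans[OF hardy])
      show "(\<integral>\<^sup>+u\<in>{a..N}. ennreal ((h' u)\<^sup>2 * ?p u) \<partial>lborel) \<le> J"
        unfolding J_def using a r by (intro nn_integral_mono) (auto simp: indicator_def)
    qed auto
    also have "ennreal 2 * (ennreal (4 * (r / real n)\<^sup>2) * J) = ennreal (8 * (r / real n)\<^sup>2) * J"
      by (subst mult.assoc[symmetric], subst ennreal_mult[symmetric]) auto
    also have "ennreal (2 * (h a)\<^sup>2) * ennreal (r / real n * ?p a) = ennreal (2 * (r / real n)) * ennreal ((h a)\<^sup>2 * ?p a)"
      using r p0[of a] a by (simp add: ennreal_mult[symmetric] mult_ac)
    finally show ?thesis .
  qed
  have full: "T \<le> ennreal (8 * (r / real n)\<^sup>2) * J + ennreal (2 * (r / real n)) * ennreal ((h a)\<^sup>2 * ?p a)"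
    if a: "r \<le> a" "a \<le> 2 * r" for a
  proof -
    have "T = (\<integral>\<^sup>+t. (SUP N. ennreal ((h t)\<^sup>2 * ?p t) * indicator {2 * r<..2 * r + real N} t) \<partial>lborel)"
      unfolding T_def
    proof (intro nn_integral_cong antisym)
      fix t
      obtain N :: nat where "t - 2 * r \<le> real N" using real_arch_simple by blast
      then have "ennreal ((h t)\<^sup>2 * ?p t) * indicator {2 * r<..} t \<le> ennreal ((h t)\<^sup>2 * ?p t) * indicator {2 * r<..2 * r + real N} t"
        by (auto simp: indicator_def)
      then show "ennreal ((h t)\<^sup>2 * ?p t) * indicator {2 * r<..} t \<le> (SUP N. ennreal ((h t)\<^sup>2 * ?p t) * indicator {2 * r<..2 * r + real N} t)"
        by (rule SUP_upper2[OF UNIV_I])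
      show "(SUP N. ennreal ((h t)\<^sup>2 * ?p t) * indicator {2 * r<..2 * r + real N} t) \<le> ennreal ((h t)\<^sup>2 * ?p t) * indicator {2 * r<..} t"
        by (intro SUP_least) (auto simp: indicator_def)
    qed
    also have "\<dots> = (SUP N. \<integral>\<^sup>+t\<in>{2 * r<..2 * r + real N}. ennreal ((h t)\<^sup>2 * ?p t) \<partial>lborel)"
      by (rule nn_integral_monotone_convergence_SUP) (auto simp: incseq_def le_fun_def indicator_def)
    also have "\<dots> \<le> ennreal (8 * (r / real n)\<^sup>2) * J + ennreal (2 * (r / real n)) * ennreal ((h a)\<^sup>2 * ?p a)"
      by (intro SUP_least trunc a) simp
    finally show ?thesis .
  qed
  have "ennreal r * T = (\<integral>\<^sup>+a. T * indicator {r..2 * r} a \<partial>lborel)"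
    using r by (subst nn_integral_cmult_indicator) (auto simp: mult.commute)
  also have "\<dots> \<le> (\<integral>\<^sup>+a. (ennreal (8 * (r / real n)\<^sup>2) * J) * indicator {r..2 * r} a + ennreal (2 * (r / real n)) * (ennreal ((h a)\<^sup>2 * ?p a) * indicator {0<..2 * r} a) \<partial>lborel)"
    using full r by (intro nn_integral_mono) (auto simp: indicator_def)
  also have "\<dots> = (\<integral>\<^sup>+a. (ennreal (8 * (r / real n)\<^sup>2) * J) * indicator {r..2 * r} a \<partial>lborel) + (\<integral>\<^sup>+a. ennreal (2 * (r / real n)) * (ennreal ((h a)\<^sup>2 * ?p a) * indicator {0<..2 * r} a) \<partial>lborel)"
    by (rule nn_integral_add) measurable
  also have "(\<integral>\<^sup>+a. (ennreal (8 * (r / real n)\<^sup>2) * J) * indicator {r..2 * r} a \<partial>lborel) = ennreal r * (ennreal (8 * (r / real n)\<^sup>2) * J)"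
    using r by (subst nn_integral_cmult_indicator) (auto simp: mult.commute)
  also have "(\<integral>\<^sup>+a. ennreal (2 * (r / real n)) * (ennreal ((h a)\<^sup>2 * ?p a) * indicator {0<..2 * r} a) \<partial>lborel)
    = ennreal (2 * (r / real n)) * (\<integral>\<^sup>+t\<in>{0<..2 * r}. ennreal ((h t)\<^sup>2 * ?p t) \<partial>lborel)"
    by (rule nn_integral_cmult) measurable
  also have "\<dots> \<le> ennreal r * (ennreal 2 * (\<integral>\<^sup>+t\<in>{0<..2 * r}. ennreal ((h t)\<^sup>2 * ?p t) \<partial>lborel))"
  proof -
    have "2 * (r / real n) \<le> r * 2" using r n by (simp add: divide_le_eq)
    then have "ennreal (2 * (r / real n)) \<le> ennreal r * ennreal 2"
      using r by (subst ennreal_mult[symmetric]) (auto intro: ennreal_leI)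
    then show ?thesis unfolding mult.assoc[symmetric] by (rule mult_right_mono) simp
  qed
  finally have "ennreal r * T \<le> ennreal r * (ennreal (8 * (r / real n)\<^sup>2) * J + ennreal 2 * (\<integral>\<^sup>+t\<in>{0<..2 * r}. ennreal ((h t)\<^sup>2 * ?p t) \<partial>lborel))"
    by (simp add: distrib_left)
  then show ?thesis
    using r unfolding T_def J_def by (subst (asm) ennreal_mult_le_mult_iff) auto
qed

end

section \<open>Bulk and tail of the gauge measure\<close>

locale body_with_profile = isotropic_convex_body n B + log_concave_profile \<rho>
  for n B \<rho>
begin

definition weight :: "(nat \<Rightarrow> real) \<Rightarrow> ennreal" where
  "weight x = ennreal (\<rho> (max 0 (gauge x)))"

lemma weight_measurable [measurable]: "weight \<in> borel_measurable (lborel_n n)"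
  unfolding weight_def by measurable

lemma weight_eq: "weight x = ennreal (\<rho> (gauge x))"
  unfolding weight_def using gauge_nonneg[of x] by (simp add: max_def)

text \<open>
  The superlevel sets of a non-increasing profile are dilates of \<open>B\<close>, so this formula exhibits the measure as a
  mixture of uniform measures on dilates.
\<close>

lemma layer_cake:
  assumes F[measurable]: "F \<in> borel_measurable (lborel_n n)"
  shows "(\<integral>\<^sup>+x. indicator {..s} (gauge x) * weight x * F x \<partial>lborel_n n)
    = (\<integral>\<^sup>+\<tau>\<in>{0..}. (\<integral>\<^sup>+x. (if gauge x \<le> s \<and> \<tau> < \<rho> (max 0 (gauge x)) then F x else 0) \<partial>lborel_n n) \<partial>lborel)"
proof -
  interpret P: pair_sigma_finite "lborel :: real measure" "lborel_n n" ..
  have "(\<integral>\<^sup>+x. indicator {..s} (gauge x) * weight x * F x \<partial>lborel_n n)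
    = (\<integral>\<^sup>+x. (\<integral>\<^sup>+\<tau>. indicator {0..} \<tau> * (if gauge x \<le> s \<and> \<tau> < \<rho> (max 0 (gauge x)) then F x else 0) \<partial>lborel) \<partial>lborel_n n)"
  proof (rule nn_integral_cong)
    fix x
    let ?c = "\<rho> (max 0 (gauge x))"
    have "(\<integral>\<^sup>+\<tau>. indicator {0..} \<tau> * (if gauge x \<le> s \<and> \<tau> < ?c then F x else 0) \<partial>lborel)
      = (\<integral>\<^sup>+\<tau>. (indicator {..s} (gauge x) * F x) * indicator {0..<?c} \<tau> \<partial>lborel)"
      by (intro nn_integral_cong) (auto simp: indicator_def)
    also have "\<dots> = (indicator {..s} (gauge x) * F x) * emeasure lborel {0..<?c}"
      by (rule nn_integral_cmult_indicator) simp
    also have "emeasure lborel {0..<?c} = weight x"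
      unfolding weight_def using nonneg[of "max 0 (gauge x)"] by simp
    finally show "indicator {..s} (gauge x) * weight x * F x
      = (\<integral>\<^sup>+\<tau>. indicator {0..} \<tau> * (if gauge x \<le> s \<and> \<tau> < ?c then F x else 0) \<partial>lborel)"
      by (simp add: mult_ac)
  qed
  also have "\<dots> = (\<integral>\<^sup>+\<tau>. (\<integral>\<^sup>+x. indicator {0..} \<tau> * (if gauge x \<le> s \<and> \<tau> < \<rho> (max 0 (gauge x)) then F x else 0) \<partial>lborel_n n) \<partial>lborel)"
    by (rule P.Fubini'[where f="\<lambda>\<tau> x. indicator {0..} \<tau> * (if gauge x \<le> s \<and> \<tau> < \<rho> (max 0 (gauge x)) then F x else 0)"]) measurable
  also have "\<dots> = (\<integral>\<^sup>+\<tau>\<in>{0..}. (\<integral>\<^sup>+x. (if gauge x \<le> s \<and> \<tau> < \<rho> (max 0 (gauge x)) then F x else 0) \<partial>lborel_n n) \<partial>lborel)"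
    by (intro nn_integral_cong) (simp add: indicator_def)
  finally show ?thesis .
qed

text \<open>
  An interval \<open>[0, q)\<close> or \<open>[0, q]\<close> of values of the gauge; the difference is a null set.
\<close>

lemma superlevel_set:
  obtains "AE x in lborel_n n. \<not> (gauge x \<le> s \<and> \<tau> < \<rho> (max 0 (gauge x)))"
  | q where "0 < q" "q \<le> s" "AE x in lborel_n n. (gauge x \<le> s \<and> \<tau> < \<rho> (max 0 (gauge x))) = (gauge x \<le> q)"
proof -
  define R where "R = {t. 0 \<le> t \<and> t \<le> s \<and> \<tau> < \<rho> t}"
  have iff: "(gauge x \<le> s \<and> \<tau> < \<rho> (max 0 (gauge x))) \<longleftrightarrow> gauge x \<in> R" for x
    using gauge_nonneg[of x] by (simp add: R_def max_def)
  have down: "t' \<in> R" if "t \<in> R" "0 \<le> t'" "t' \<le> t" for t t'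
    using that antimonoD[of t' t] by (auto simp: R_def)
  have bdd: "bdd_above R" by (auto simp: R_def)
  show thesis
  proof (cases "R = {} \<or> Sup R \<le> 0")
    case True
    have "AE x in lborel_n n. gauge x \<notin> R"
      using gauge_pos_AE
    proof eventually_elim
      case (elim x)
      show ?case
      proof
        assume x: "gauge x \<in> R"
        then have "gauge x \<le> Sup R" by (rule cSup_upper[OF _ bdd])
        then show False using True x elim by auto
      qed
    qed
    then show thesis by (intro that(1)) (simp only: iff)
  next
    case False
    then have ne: "R \<noteq> {}" and pos: "0 < Sup R" by auto
    have "Sup R \<le> s" by (rule cSup_least[OF ne]) (simp add: R_def)
    moreover have "AE x in lborel_n n. (gauge x \<in> R) = (gauge x \<le> Sup R)"
      using gauge_level_null[of "Sup R"]
    proof eventually_elim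
      case (elim x)
      show ?case
      proof
        assume "gauge x \<in> R"
        then show "gauge x \<le> Sup R" by (rule cSup_upper[OF _ bdd])
      next
        assume "gauge x \<le> Sup R"
        then have "gauge x < Sup R" using elim by simp
        then obtain t where "t \<in> R" "gauge x < t" using less_cSup_iff[OF ne bdd] by blast
        then show "gauge x \<in> R" using down[of t "gauge x"] gauge_nonneg[of x] by simp
      qed
    qed
    ultimately show thesis using pos by (intro that(2)[of "Sup R"]) (simp_all only: iff)
  qed
qed

lemma poincare_mixture:
  assumes A: "poincare_bound A" "0 \<le> A" and f: "smooth n f" and s: "0 < s"
  shows "(\<integral>\<^sup>+x. indicator {..s} (gauge x) * weight x * ennreal ((f x - c)\<^sup>2) \<partial>lborel_n n)
    \<le> ennreal (s\<^sup>2 * A) * (\<integral>\<^sup>+x. indicator {..s} (gauge x) * weight x * ennreal (grad_sq n f x) \<partial>lborel_n n)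
      + (\<integral>\<^sup>+x. indicator {..s} (gauge x) * weight x * ennreal ((radial_mean f (gauge x) - c)\<^sup>2) \<partial>lborel_n n)"
proof -
  have [measurable]: "f \<in> borel_measurable (lborel_n n)" by (rule measurable_continuous_map[OF smooth_continuous[OF f]])
  note [measurable] = radial_mean_measurable[OF f] grad_sq_measurable[OF f]
  define L where "L F \<tau> = (\<integral>\<^sup>+x. (if gauge x \<le> s \<and> \<tau> < \<rho> (max 0 (gauge x)) then F x else 0) \<partial>lborel_n n)"
    for F :: "(nat \<Rightarrow> real) \<Rightarrow> ennreal" and \<tau>
  have Lm: "L F \<in> borel_measurable borel" if [measurable]: "F \<in> borel_measurable (lborel_n n)" for F
    unfolding L_def by measurable
  let ?D = "\<lambda>x. ennreal ((f x - c)\<^sup>2)" and ?G = "\<lambda>x. ennreal (grad_sq n f x)"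
    and ?M = "\<lambda>x. ennreal ((radial_mean f (gauge x) - c)\<^sup>2)"
  have lc: "(\<integral>\<^sup>+x. indicator {..s} (gauge x) * weight x * F x \<partial>lborel_n n) = (\<integral>\<^sup>+\<tau>\<in>{0..}. L F \<tau> \<partial>lborel)"
    if "F \<in> borel_measurable (lborel_n n)" for F
    unfolding L_def by (rule layer_cake[OF that])
  have level: "L ?D \<tau> \<le> ennreal (s\<^sup>2 * A) * L ?G \<tau> + L ?M \<tau>" for \<tau>
  proof (rule superlevel_set[of s \<tau>])
    assume ae: "AE x in lborel_n n. \<not> (gauge x \<le> s \<and> \<tau> < \<rho> (max 0 (gauge x)))"
    have "L ?D \<tau> = (\<integral>\<^sup>+x. 0 \<partial>lborel_n n)"
      unfolding L_def by (rule nn_integral_cong_AE) (use ae in \<open>auto elim!: eventually_mono\<close>)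
    then show ?thesis by simp
  next
    fix q assume q: "0 < q" "q \<le> s"
      and ae: "AE x in lborel_n n. (gauge x \<le> s \<and> \<tau> < \<rho> (max 0 (gauge x))) = (gauge x \<le> q)"
    have Lq: "L F \<tau> = (\<integral>\<^sup>+x. indicator {..q} (gauge x) * F x \<partial>lborel_n n)" for F
      unfolding L_def by (rule nn_integral_cong_AE, use ae in eventually_elim) (simp add: indicator_def)
    have "ennreal (q\<^sup>2 * A) \<le> ennreal (s\<^sup>2 * A)"
      using q A(2) by (intro ennreal_leI mult_right_mono power_mono) auto
    then show ?thesis
      unfolding Lq by (intro order_trans[OF poincare_on_dilate[OF A f q(1)]] add_right_mono mult_right_mono) auto
  qed
  have "(\<integral>\<^sup>+\<tau>\<in>{0..}. L ?D \<tau> \<partial>lborel)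
    \<le> (\<integral>\<^sup>+\<tau>. ennreal (s\<^sup>2 * A) * (L ?G \<tau> * indicator {0..} \<tau>) + L ?M \<tau> * indicator {0..} \<tau> \<partial>lborel)"
    using level by (intro nn_integral_mono) (auto simp: indicator_def)
  also have "\<dots> = ennreal (s\<^sup>2 * A) * (\<integral>\<^sup>+\<tau>\<in>{0..}. L ?G \<tau> \<partial>lborel) + (\<integral>\<^sup>+\<tau>\<in>{0..}. L ?M \<tau> \<partial>lborel)"
    using Lm[of ?G] Lm[of ?M] by (subst nn_integral_add, simp, simp, subst nn_integral_cmult) auto
  finally show ?thesis by (subst (1 2 3) lc) measurable
qed

text \<open>
  The centre \<open>c\<close> depends on the profile and on \<open>s\<close> only. The Hardy constant is \<open>l = 2 s / \<surd>n\<close>, and the factor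
  \<open>1 / n\<close> in its square turns \<open>E|\<theta>|\<^sup>2\<close> into the variance of a single coordinate.
\<close>

lemma radial_mean_concentration:
  assumes s: "0 < s"
  obtains c where "\<forall>f. smooth n f \<longrightarrow>
      (\<integral>\<^sup>+x. indicator {..s} (gauge x) * weight x * ennreal ((radial_mean f (gauge x) - radial_mean f c)\<^sup>2) \<partial>lborel_n n)
      \<le> ennreal (48 * s\<^sup>2 * second_moment / n) * (\<integral>\<^sup>+x. indicator {..s} (gauge x) * weight x * ennreal (grad_sq n f x) \<partial>lborel_n n)"
proof -
  let ?p = "radial_density n"
  obtain c where c: "c \<in> {0..s}"
    "\<And>w. w \<in> {c<..s} \<Longrightarrow> (\<integral>\<^sup>+u\<in>{w..s}. ennreal (?p u) \<partial>lborel) \<le> ennreal (2 * s / sqrt n * ?p w)"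
    "\<And>w. w \<in> {0..<c} \<Longrightarrow> (\<integral>\<^sup>+u\<in>{0..w}. ennreal (?p u) \<partial>lborel) \<le> ennreal (2 * s / sqrt n * ?p w)"
    by (rule radial_centre[OF n s]) blast
  show thesis
  proof (rule that[of c], intro allI impI)
    fix f assume f: "smooth n f"
    have [measurable]: "f \<in> borel_measurable (lborel_n n)" by (rule measurable_continuous_map[OF smooth_continuous[OF f]])
    note [measurable] = radial_mean_measurable[OF f] grad_sq_measurable[OF f]
      borel_measurable_continuous_onI[OF radial_mean_slope_continuous[OF f]]
    let ?h = "radial_mean f" and ?h' = "radial_mean_slope f"
    let ?G = "\<lambda>t. (\<integral>\<^sup>+y\<in>B. ennreal (grad_sq n f (scale_n n t (proj y))) \<partial>lborel_n n)"
    define l where "l = 2 * s / sqrt n"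
    have l: "0 \<le> l" "4 * l\<^sup>2 * (3 * second_moment) = 48 * s\<^sup>2 * second_moment / n"
      using s n by (auto simp: l_def power_divide power_mult_distrib)
    have hardy: "(\<integral>\<^sup>+u\<in>{0..s}. ennreal ((?h u - ?h c)\<^sup>2 * ?p u) \<partial>lborel)
      \<le> ennreal (4 * l\<^sup>2) * (\<integral>\<^sup>+u\<in>{0..s}. ennreal ((?h' u)\<^sup>2 * ?p u) \<partial>lborel)"
    proof (rule hardy_centred[OF radial_mean_deriv[OF f] radial_mean_slope_continuous[OF f] radial_density_measurable])
      show "0 \<le> ?p x" "?p x \<le> s ^ (n - 1) * \<rho> 0" if "x \<in> {0..s}" for x
        using that by (intro radial_density_nonneg radial_density_le; simp)+
    qed (use c l in \<open>auto simp: l_def\<close>)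
    have G_meas: "?G \<in> borel_measurable borel" by measurable
    have polar: "(\<integral>\<^sup>+x. indicator {..s} (gauge x) * weight x * F x \<partial>lborel_n n)
      = (\<integral>\<^sup>+t\<in>{0..s}. ennreal n * (ennreal (?p t) * (\<integral>\<^sup>+y\<in>B. F (scale_n n t (proj y)) \<partial>lborel_n n)) \<partial>lborel)"
      if [measurable]: "F \<in> borel_measurable (lborel_n n)" for F
    proof -
      have "(\<integral>\<^sup>+x. indicator {..s} (gauge x) * weight x * F x \<partial>lborel_n n)
        = (\<integral>\<^sup>+x. (\<lambda>t. indicator {..s} t * ennreal (\<rho> (max 0 t))) (gauge x) * F x \<partial>lborel_n n)"
        by (simp add: weight_def)
      also have "\<dots> = (\<integral>\<^sup>+t\<in>{0<..}. ennreal (real n * t ^ (n - 1)) * (indicator {..s} t * ennreal (\<rho> (max 0 t))) * (\<integral>\<^sup>+y\<in>B. F (scale_n n t (proj y)) \<partial>lborel_n n) \<partial>lborel)"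
        by (rule polar_radial) measurable
      also have "\<dots> = (\<integral>\<^sup>+t\<in>{0..s}. ennreal n * (ennreal (?p t) * (\<integral>\<^sup>+y\<in>B. F (scale_n n t (proj y)) \<partial>lborel_n n)) \<partial>lborel)"
        using AE_lborel_singleton[of "0::real"]
      proof (intro nn_integral_cong_AE, eventually_elim)
        case (elim t)
        have "ennreal (real n * t ^ (n - 1)) * ennreal (\<rho> (max 0 t)) = ennreal n * ennreal (?p t)" if "0 < t"
          using that nonneg[of "max 0 t"] by (simp add: ennreal_mult[symmetric] radial_density_def)
        then show ?case using elim by (auto simp: indicator_def mult.assoc[symmetric])
      qed
      finally show ?thesis .
    qed
    have "(\<integral>\<^sup>+x. indicator {..s} (gauge x) * weight x * ennreal ((?h (gauge x) - ?h c)\<^sup>2) \<partial>lborel_n n)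
      = (\<integral>\<^sup>+t\<in>{0..s}. ennreal n * (ennreal (?p t) * (\<integral>\<^sup>+y\<in>B. ennreal ((?h (gauge (scale_n n t (proj y))) - ?h c)\<^sup>2) \<partial>lborel_n n)) \<partial>lborel)"
      by (rule polar) measurable
    also have "\<dots> = (\<integral>\<^sup>+t. ennreal (n * vol) * (ennreal ((?h t - ?h c)\<^sup>2 * ?p t) * indicator {0..s} t) \<partial>lborel)"
      using AE_lborel_singleton[of "0::real"]
    proof (intro nn_integral_cong_AE, eventually_elim)
      case (elim t)
      show ?case
      proof (cases "0 < t \<and> t \<le> s")
        case True
        have "(\<integral>\<^sup>+y\<in>B. ennreal ((?h (gauge (scale_n n t (proj y))) - ?h c)\<^sup>2) \<partial>lborel_n n) = (\<integral>\<^sup>+y. ennreal ((?h t - ?h c)\<^sup>2) * indicator B y \<partial>lborel_n n)"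
          using gauge_pos_AE
          by (intro nn_integral_cong_AE, eventually_elim) (use True in \<open>simp add: gauge_scale_proj\<close>)
        also have "\<dots> = ennreal ((?h t - ?h c)\<^sup>2) * ennreal vol"
          by (subst nn_integral_cmult_indicator) (auto simp: emeasure_B)
        finally show ?thesis
          using True vol_pos radial_density_nonneg[of t n]
          by (simp add: ennreal_mult[symmetric] mult_ac)
      qed (use elim in \<open>auto simp: indicator_def\<close>)
    qed
    also have "\<dots> = ennreal (n * vol) * (\<integral>\<^sup>+t\<in>{0..s}. ennreal ((?h t - ?h c)\<^sup>2 * ?p t) \<partial>lborel)"
      by (rule nn_integral_cmult) measurable
    also have "\<dots> \<le> ennreal (n * vol) * (ennreal (4 * l\<^sup>2) * (\<integral>\<^sup>+t\<in>{0..s}. ennreal ((?h' t)\<^sup>2 * ?p t) \<partial>lborel))"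
      by (intro mult_left_mono hardy) simp
    also have "\<dots> = ennreal (4 * l\<^sup>2) * (ennreal (n * vol) * (\<integral>\<^sup>+t\<in>{0..s}. ennreal ((?h' t)\<^sup>2 * ?p t) \<partial>lborel))"
      by (simp only: mult_ac)
    also have "ennreal (n * vol) * (\<integral>\<^sup>+t\<in>{0..s}. ennreal ((?h' t)\<^sup>2 * ?p t) \<partial>lborel)
      = (\<integral>\<^sup>+t. ennreal (n * vol) * (ennreal ((?h' t)\<^sup>2 * ?p t) * indicator {0..s} t) \<partial>lborel)"
      by (rule nn_integral_cmult[symmetric]) measurable
    also have "\<dots> \<le> (\<integral>\<^sup>+t. ennreal (3 * second_moment) * (ennreal n * (ennreal (?p t) * ?G t) * indicator {0..s} t) \<partial>lborel)"
    proof (intro nn_integral_mono)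
      fix t
      show "ennreal (n * vol) * (ennreal ((?h' t)\<^sup>2 * ?p t) * indicator {0..s} t)
        \<le> ennreal (3 * second_moment) * (ennreal n * (ennreal (?p t) * ?G t) * indicator {0..s} t)"
      proof (cases "t \<in> {0..s}")
        case True
        then have p0: "0 \<le> ?p t" by (intro radial_density_nonneg) simp
        have "ennreal (n * vol) * ennreal ((?h' t)\<^sup>2 * ?p t) = ennreal (n * ?p t) * (ennreal vol * ennreal ((?h' t)\<^sup>2))"
          using p0 vol_pos by (simp add: ennreal_mult[symmetric] mult_ac)
        also have "\<dots> \<le> ennreal (n * ?p t) * (ennreal (3 * second_moment) * ?G t)"
          by (intro mult_left_mono radial_mean_slope_sq[OF f]) simp
        also have "\<dots> = ennreal (3 * second_moment) * (ennreal n * (ennreal (?p t) * ?G t))"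
          using p0 by (simp add: ennreal_mult mult_ac)
        finally show ?thesis using True by simp
      qed simp
    qed
    also have "\<dots> = ennreal (3 * second_moment) * (\<integral>\<^sup>+t\<in>{0..s}. ennreal n * (ennreal (?p t) * ?G t) \<partial>lborel)"
      by (rule nn_integral_cmult) measurable
    also have "(\<integral>\<^sup>+t\<in>{0..s}. ennreal n * (ennreal (?p t) * ?G t) \<partial>lborel)
      = (\<integral>\<^sup>+x. indicator {..s} (gauge x) * weight x * ennreal (grad_sq n f x) \<partial>lborel_n n)"
      by (rule polar[symmetric]) measurable
    finally have "(\<integral>\<^sup>+x. indicator {..s} (gauge x) * weight x * ennreal ((?h (gauge x) - ?h c)\<^sup>2) \<partial>lborel_n n)
      \<le> ennreal (4 * l\<^sup>2) * (ennreal (3 * second_moment) * (\<integral>\<^sup>+x. indicator {..s} (gauge x) * weight x * ennreal (grad_sq n f x) \<partial>lborel_n n))"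
      by (simp add: mult_left_mono)
    then show "(\<integral>\<^sup>+x. indicator {..s} (gauge x) * weight x * ennreal ((?h (gauge x) - ?h c)\<^sup>2) \<partial>lborel_n n)
      \<le> ennreal (48 * s\<^sup>2 * second_moment / n) * (\<integral>\<^sup>+x. indicator {..s} (gauge x) * weight x * ennreal (grad_sq n f x) \<partial>lborel_n n)"
      using second_moment_nonneg unfolding l(2)[symmetric] by (subst ennreal_mult) (auto simp: mult.assoc)
  qed
qed

text \<open>
  The Hardy inequality along each ray, with the derivative bounded through the diameter: the factors \<open>1 / n\<^sup>2\<close>
  and \<open>8 n\<close> combine to \<open>8 / n\<close>.
\<close>

lemma tail_bound:
  assumes r: "0 < r" and dec: "\<forall>u>r. \<rho> u \<le> \<rho> r * exp (- (2 * real n / r) * (u - r))" and f: "smooth n f"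
  shows "(\<integral>\<^sup>+x. indicator {2 * r<..} (gauge x) * weight x * ennreal ((f x - c)\<^sup>2) \<partial>lborel_n n)
    \<le> ennreal (64 * r\<^sup>2 * second_moment / n) * (\<integral>\<^sup>+x. weight x * ennreal (grad_sq n f x) \<partial>lborel_n n)
      + ennreal 2 * (\<integral>\<^sup>+x. indicator {..2 * r} (gauge x) * weight x * ennreal ((f x - c)\<^sup>2) \<partial>lborel_n n)"
proof -
  let ?p = "radial_density n"
  have [measurable]: "f \<in> borel_measurable (lborel_n n)" by (rule measurable_continuous_map[OF smooth_continuous[OF f]])
  note [measurable] = grad_sq_measurable[OF f]
  have polar: "(\<integral>\<^sup>+x. indicator S (gauge x) * weight x * ennreal (F x) \<partial>lborel_n n)
    = (\<integral>\<^sup>+y\<in>B. ennreal n * (\<integral>\<^sup>+t\<in>S \<inter> {0<..}. ennreal (F (scale_n n t (proj y)) * ?p t) \<partial>lborel) \<partial>lborel_n n)"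
    if [measurable]: "F \<in> borel_measurable (lborel_n n)" "S \<in> sets borel" and F0: "\<And>x. 0 \<le> F x" for F S
  proof -
    have "(\<integral>\<^sup>+x. indicator S (gauge x) * weight x * ennreal (F x) \<partial>lborel_n n)
      = (\<integral>\<^sup>+y\<in>B. (\<integral>\<^sup>+t\<in>{0<..}. ennreal (real n * t ^ (n - 1)) * (indicator S (gauge (scale_n n t (proj y))) * weight (scale_n n t (proj y)) * ennreal (F (scale_n n t (proj y)))) \<partial>lborel) \<partial>lborel_n n)"
      by (rule polar_coordinates) measurable
    also have "\<dots> = (\<integral>\<^sup>+y\<in>B. ennreal n * (\<integral>\<^sup>+t\<in>S \<inter> {0<..}. ennreal (F (scale_n n t (proj y)) * ?p t) \<partial>lborel) \<partial>lborel_n n)"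
      using gauge_pos_AE
    proof (intro nn_integral_cong_AE, eventually_elim)
      case (elim y)
      have m: "(\<lambda>t. F (scale_n n t (proj y))) \<in> borel_measurable borel"
        by (rule measurable_compose[OF _ that(1)], rule measurable_affine_n) auto
      have "(\<integral>\<^sup>+t\<in>{0<..}. ennreal (real n * t ^ (n - 1)) * (indicator S (gauge (scale_n n t (proj y))) * weight (scale_n n t (proj y)) * ennreal (F (scale_n n t (proj y)))) \<partial>lborel)
        = (\<integral>\<^sup>+t. ennreal n * (ennreal (F (scale_n n t (proj y)) * ?p t) * indicator (S \<inter> {0<..}) t) \<partial>lborel)"
      proof (intro nn_integral_cong)
        fix t
        have "ennreal (real n * t ^ (n - 1)) * (ennreal (\<rho> (max 0 t)) * ennreal (F (scale_n n t (proj y)))) = ennreal n * ennreal (F (scale_n n t (proj y)) * ?p t)"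
          if "0 < t"
          using that nonneg[of "max 0 t"] F0 by (simp add: ennreal_mult[symmetric] radial_density_def mult_ac)
        then show "ennreal (real n * t ^ (n - 1)) * (indicator S (gauge (scale_n n t (proj y))) * weight (scale_n n t (proj y)) * ennreal (F (scale_n n t (proj y)))) * indicator {0<..} t
          = ennreal n * (ennreal (F (scale_n n t (proj y)) * ?p t) * indicator (S \<inter> {0<..}) t)"
          using elim by (cases "0 < t") (auto simp: weight_def gauge_scale_proj indicator_def)
      qed
      also have "\<dots> = ennreal n * (\<integral>\<^sup>+t\<in>S \<inter> {0<..}. ennreal (F (scale_n n t (proj y)) * ?p t) \<partial>lborel)"
        using m by (intro nn_integral_cmult) measurable
      finally show ?case by simp
    qed
    finally show ?thesis .
  qed
  define T where "T y = (\<integral>\<^sup>+t\<in>{2 * r<..} \<inter> {0<..}. ennreal ((f (scale_n n t (proj y)) - c)\<^sup>2 * ?p t) \<partial>lborel)" for y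
  define J where "J y = (\<integral>\<^sup>+t\<in>UNIV \<inter> {0<..}. ennreal (grad_sq n f (scale_n n t (proj y)) * ?p t) \<partial>lborel)" for y
  define H where "H y = (\<integral>\<^sup>+t\<in>{..2 * r} \<inter> {0<..}. ennreal ((f (scale_n n t (proj y)) - c)\<^sup>2 * ?p t) \<partial>lborel)" for y
  have [measurable]: "J \<in> borel_measurable (lborel_n n)" "H \<in> borel_measurable (lborel_n n)"
    unfolding J_def H_def by measurable
  have ray: "T y \<le> ennreal (64 * r\<^sup>2 * second_moment / n) * J y + ennreal 2 * H y" if y: "y \<in> B" for y
  proof -
    let ?h = "\<lambda>t. f (scale_n n t (proj y)) - c" and ?h' = "\<lambda>t. radial_slope f t y"
    have d: "(?h has_real_derivative ?h' t) (at t)" for t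
      using DERIV_diff[OF radial_slope_deriv[OF f] DERIV_const] by simp
    have [measurable]: "(\<lambda>t. grad_sq n f (scale_n n t (proj y))) \<in> borel_measurable borel"
      by (intro borel_measurable_continuous_onI continuous_on_scale_ray continuous_map_grad_sq f)
    have sets: "{2 * r<..} \<inter> {0<..} = {2 * r<..}" "{..2 * r} \<inter> {0<..} = {0<..2 * r}" using r by auto
    have "T y \<le> ennreal (8 * (r / real n)\<^sup>2) * (\<integral>\<^sup>+t\<in>{0<..}. ennreal ((?h' t)\<^sup>2 * ?p t) \<partial>lborel) + ennreal 2 * H y"
      unfolding T_def H_def sets
      by (rule radial_tail_hardy[OF n r dec d radial_slope_continuous[OF f]])
    also have "(\<integral>\<^sup>+t\<in>{0<..}. ennreal ((?h' t)\<^sup>2 * ?p t) \<partial>lborel)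
      \<le> (\<integral>\<^sup>+t. ennreal (8 * n * second_moment) * (ennreal (grad_sq n f (scale_n n t (proj y)) * ?p t) * indicator {0<..} t) \<partial>lborel)"
    proof (intro nn_integral_mono)
      fix t
      show "ennreal ((?h' t)\<^sup>2 * ?p t) * indicator {0<..} t
        \<le> ennreal (8 * n * second_moment) * (ennreal (grad_sq n f (scale_n n t (proj y)) * ?p t) * indicator {0<..} t)"
      proof (cases "0 < t")
        case True
        then have p0: "0 \<le> ?p t" by (intro radial_density_nonneg) simp
        have "(?h' t)\<^sup>2 \<le> (8 * n * second_moment) * grad_sq n f (scale_n n t (proj y))"
          using radial_slope_sq[of f t y] diameter_bound[OF proj_mem[OF y]]
          by (meson mult_right_mono order_trans zero_le_power2)
        then have "(?h' t)\<^sup>2 * ?p t \<le> (8 * n * second_moment) * (grad_sq n f (scale_n n t (proj y)) * ?p t)"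
          using p0 by (simp only: mult.assoc[symmetric] mult_right_mono)
        then show ?thesis using True p0 second_moment_nonneg
          by (simp add: ennreal_mult[symmetric] ennreal_leI)
      qed simp
    qed
    also have "\<dots> = ennreal (8 * n * second_moment) * J y"
      unfolding J_def by (subst nn_integral_cmult) auto
    finally have "T y \<le> ennreal (8 * (r / real n)\<^sup>2) * (ennreal (8 * n * second_moment) * J y) + ennreal 2 * H y"
      by (simp add: add_right_mono mult_left_mono)
    also have "ennreal (8 * (r / real n)\<^sup>2) * (ennreal (8 * n * second_moment) * J y) = ennreal (64 * r\<^sup>2 * second_moment / n) * J y"
    proof -
      have "8 * (r / real n)\<^sup>2 * (8 * n * second_moment) = 64 * r\<^sup>2 * second_moment / n"
        using n by (simp add: power2_eq_square field_simps)
      then show ?thesis using second_moment_nonneg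
        by (simp add: mult.assoc[symmetric] ennreal_mult[symmetric])
    qed
    finally show ?thesis .
  qed
  have "(\<integral>\<^sup>+x. indicator {2 * r<..} (gauge x) * weight x * ennreal ((f x - c)\<^sup>2) \<partial>lborel_n n) = (\<integral>\<^sup>+y\<in>B. ennreal n * T y \<partial>lborel_n n)"
    unfolding T_def by (rule polar) auto
  also have "\<dots> \<le> (\<integral>\<^sup>+y. ennreal (64 * r\<^sup>2 * second_moment / n) * (ennreal n * J y * indicator B y) + ennreal 2 * (ennreal n * H y * indicator B y) \<partial>lborel_n n)"
  proof (intro nn_integral_mono)
    fix y
    show "ennreal n * T y * indicator B y
      \<le> ennreal (64 * r\<^sup>2 * second_moment / n) * (ennreal n * J y * indicator B y) + ennreal 2 * (ennreal n * H y * indicator B y)"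
    proof (cases "y \<in> B")
      case True
      have "ennreal n * T y \<le> ennreal n * (ennreal (64 * r\<^sup>2 * second_moment / n) * J y + ennreal 2 * H y)"
        by (intro mult_left_mono ray True) simp
      also have "\<dots> = ennreal (64 * r\<^sup>2 * second_moment / n) * (ennreal n * J y) + ennreal 2 * (ennreal n * H y)"
        by (simp only: distrib_left mult_ac)
      finally show ?thesis using True by simp
    qed simp
  qed
  also have "\<dots> = ennreal (64 * r\<^sup>2 * second_moment / n) * (\<integral>\<^sup>+y\<in>B. ennreal n * J y \<partial>lborel_n n) + ennreal 2 * (\<integral>\<^sup>+y\<in>B. ennreal n * H y \<partial>lborel_n n)"
    by (subst nn_integral_add, measurable, subst (1 2) nn_integral_cmult, measurable)
  also have "(\<integral>\<^sup>+y\<in>B. ennreal n * J y \<partial>lborel_n n) = (\<integral>\<^sup>+x. indicator UNIV (gauge x) * weight x * ennreal (grad_sq n f x) \<partial>lborel_n n)"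
    unfolding J_def by (rule polar[symmetric]) auto
  also have "(\<integral>\<^sup>+y\<in>B. ennreal n * H y \<partial>lborel_n n) = (\<integral>\<^sup>+x. indicator {..2 * r} (gauge x) * weight x * ennreal ((f x - c)\<^sup>2) \<partial>lborel_n n)"
    unfolding H_def by (rule polar[symmetric]) auto
  finally show ?thesis by simp
qed

end

section \<open>Coordinate functions as test functions\<close>

lemma Ck_const: "Ck n k (\<lambda>_. c)"
proof (induction k arbitrary: c)
  case (Suc k)
  have "partial_deriv i (\<lambda>_::nat \<Rightarrow> real. c) = (\<lambda>_. 0)" for i
    by (simp add: partial_deriv_def fun_eq_iff)
  then show ?case using Suc by simp
qed simp

lemma partial_deriv_coordinate: "partial_deriv j (\<lambda>x. x i) = (\<lambda>_. if j = i then 1 else 0)"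
  by (auto simp: partial_deriv_def fun_eq_iff)

lemma smooth_coordinate:
  assumes i: "i < n" shows "smooth n (\<lambda>x. x i)"
  unfolding smooth_def
proof
  fix k
  show "Ck n k (\<lambda>x. x i)"
  proof (cases k)
    case 0
    then show ?thesis using continuous_map_nth[OF i] by simp
  next
    case (Suc l)
    have "(\<lambda>t. (x(j := t)) i) differentiable at (x j)" for j and x :: "nat \<Rightarrow> real"
      by (cases "j = i") auto
    moreover have "Ck n l (partial_deriv j (\<lambda>x. x i))" for j
      unfolding partial_deriv_coordinate by (rule Ck_const)
    ultimately show ?thesis using continuous_map_nth[OF i] Suc by simp
  qed
qed

lemma grad_sq_coordinate: "i < n \<Longrightarrow> grad_sq n (\<lambda>x. x i) x = 1"
  unfolding grad_sq_sum partial_deriv_coordinate by (simp add: if_distrib[of "\<lambda>z. z\<^sup>2"] cong: if_cong)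

text \<open>
  The mean minimises the quadratic deviation. Square integrability may fail, and then the right-hand side is
  infinite.
\<close>

lemma (in prob_space) variance_le_deviation:
  fixes f :: "'a \<Rightarrow> real"
  assumes f: "integrable M f"
  shows "(\<integral>\<^sup>+x. ennreal ((f x - (\<integral>y. f y \<partial>M))\<^sup>2) \<partial>M) \<le> (\<integral>\<^sup>+x. ennreal ((f x - c)\<^sup>2) \<partial>M)"
proof (cases "(\<integral>\<^sup>+x. ennreal ((f x - c)\<^sup>2) \<partial>M) = \<infinity>")
  case False
  note [measurable] = borel_measurable_integrable[OF f]
  define m where "m = (\<integral>y. f y \<partial>M)"
  have g: "integrable M (\<lambda>x. (f x - c)\<^sup>2)"
    using False by (intro integrableI_nonneg) (auto simp: less_top)
  have e: "(f x - m)\<^sup>2 = (f x - c)\<^sup>2 - (2 * (m - c) * (f x - m) + (m - c)\<^sup>2)" for x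
    by (simp add: power2_eq_square algebra_simps)
  have fm: "integrable M (\<lambda>x. f x - m)" "(\<integral>x. f x - m \<partial>M) = 0"
    using f by (auto simp: m_def prob_space)
  have lin: "integrable M (\<lambda>x. 2 * (m - c) * (f x - m) + (m - c)\<^sup>2)"
    "(\<integral>x. 2 * (m - c) * (f x - m) + (m - c)\<^sup>2 \<partial>M) = (m - c)\<^sup>2"
    using fm by (auto simp: prob_space)
  have i: "integrable M (\<lambda>x. (f x - m)\<^sup>2)" unfolding e by (intro Bochner_Integration.integrable_diff g lin)
  have "(\<integral>x. (f x - m)\<^sup>2 \<partial>M) = (\<integral>x. (f x - c)\<^sup>2 \<partial>M) - (m - c)\<^sup>2"
    unfolding e by (subst Bochner_Integration.integral_diff[OF g lin(1)]) (simp only: lin(2))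
  then have "(\<integral>x. (f x - m)\<^sup>2 \<partial>M) \<le> (\<integral>x. (f x - c)\<^sup>2 \<partial>M)" by simp
  then show ?thesis
    unfolding m_def[symmetric] by (simp add: nn_integral_eq_integral[OF i] nn_integral_eq_integral[OF g] ennreal_leI)
qed simp

context isotropic_convex_body begin

lemma coordinate_variance:
  assumes i: "i < n"
  shows "variance_of (uniform_on_body n B) (\<lambda>x. x i) = ennreal (second_moment / n)"
    "energy n (uniform_on_body n B) (\<lambda>x. x i) = 1" "integrable (uniform_on_body n B) (\<lambda>x. x i)"
proof -
  note [measurable] = measurable_nth_lborel_n[OF i]
  obtain K where K: "0 < K" "\<forall>x\<in>B. \<forall>i<n. \<bar>x i\<bar> \<le> K" by (rule convex_body_bounded[OF body])
  have mean: "(\<integral>x. x i \<partial>uniform_on_body n B) = 0"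
    using isotropic i by (auto simp: isotropic_body_def isotropic_def)
  let ?e = "\<lambda>j\<in>{..<n}. if j = i then 1 else (0::real)"
  have e1: "(norm_n n ?e)\<^sup>2 = 1" unfolding norm_n_sq_sum using i by (simp add: if_distrib[of "\<lambda>z. z\<^sup>2"] cong: if_cong)
  have inn: "inner_n n x ?e = x i" for x using i by (simp add: inner_n_def if_distrib[of "\<lambda>z. _ * z"] cong: if_cong)
  have val: "(\<integral>x. indicator B x * (x i)\<^sup>2 \<partial>lborel_n n) = vol * (second_moment / n)"
    using second_moment_inner[of ?e] by (simp add: e1 inn)
  have sqb: "\<bar>(x i)\<^sup>2\<bar> \<le> K\<^sup>2" if "x \<in> B" for x
  proof -
    have "\<bar>x i\<bar> \<le> K" using K(2) that i by blast
    then have "\<bar>x i\<bar>\<^sup>2 \<le> K\<^sup>2" by (intro power_mono) auto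
    then show ?thesis by simp
  qed
  have i2: "integrable (lborel_n n) (\<lambda>x. indicator B x * (x i)\<^sup>2)"
    by (rule integrable_on_body[OF _ sqb]) measurable
  have nn: "(\<integral>\<^sup>+x\<in>B. ennreal ((x i)\<^sup>2) \<partial>lborel_n n) = ennreal (vol * (second_moment / n))"
  proof -
    have "(\<integral>\<^sup>+x\<in>B. ennreal ((x i)\<^sup>2) \<partial>lborel_n n) = (\<integral>\<^sup>+x. ennreal (indicator B x * (x i)\<^sup>2) \<partial>lborel_n n)"
      by (intro nn_integral_cong) (simp add: indicator_def)
    also have "\<dots> = ennreal (\<integral>x. indicator B x * (x i)\<^sup>2 \<partial>lborel_n n)"
      by (rule nn_integral_eq_integral[OF i2]) auto
    finally show ?thesis by (simp only: val)
  qed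
  have "variance_of (uniform_on_body n B) (\<lambda>x. x i) = (\<integral>\<^sup>+x\<in>B. ennreal ((x i)\<^sup>2) \<partial>lborel_n n) / ennreal vol"
    unfolding variance_of_def mean vol_def diff_zero by (rule nn_integral_uniform_on_body[OF body]) measurable
  also have "\<dots> = ennreal (second_moment / n)"
    unfolding nn using vol_pos second_moment_nonneg by (subst divide_ennreal) auto
  finally show "variance_of (uniform_on_body n B) (\<lambda>x. x i) = ennreal (second_moment / n)" .
  have "energy n (uniform_on_body n B) (\<lambda>x. x i) = (\<integral>\<^sup>+x. 1 \<partial>uniform_on_body n B)"
    unfolding energy_def grad_sq_coordinate[OF i] by simp
  also have "\<dots> = (\<integral>\<^sup>+x\<in>B. 1 \<partial>lborel_n n) / ennreal vol"
    unfolding vol_def by (rule nn_integral_uniform_on_body[OF body]) measurable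
  also have "\<dots> = 1" using vol_pos by (simp add: emeasure_B ennreal_divide_self)
  finally show "energy n (uniform_on_body n B) (\<lambda>x. x i) = 1" .
  have "integrable (lborel_n n) (\<lambda>x. indicator B x * x i)"
    using K i by (intro integrable_on_body[where K=K]) auto
  then show "integrable (uniform_on_body n B) (\<lambda>x. x i)"
    unfolding uniform_on_body_density[OF body] vol_def[symmetric] using vol_pos
    by (subst integrable_density) (auto simp: mult.commute)
qed

text \<open>
  Coordinates have variance \<open>E|Y|\<^sup>2 / n\<close> and energy \<open>1\<close>, which forces \<open>C \<ge> 1\<close>. The factor \<open>2\<close> provides a
  constant strictly above the infimum, so that an admissible one lies below it.
\<close>

lemma KLS_imp_poincare_bound:
  assumes "satisfies_KLS n (uniform_on_body n B) C"
  shows "1 \<le> C" "poincare_bound (2 * C * second_moment / n)"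
proof -
  let ?S = "{A. \<forall>f. smooth n f \<and> integrable (uniform_on_body n B) f \<longrightarrow>
    variance_of (uniform_on_body n B) f \<le> A * energy n (uniform_on_body n B) f}"
  have i: "0 < n" using n by simp
  have "ennreal (second_moment / n) \<le> A" if "A \<in> ?S" for A
    using that smooth_coordinate[OF i] coordinate_variance[OF i] by (auto dest!: spec[of _ "\<lambda>x. x 0"])
  then have "ennreal (second_moment / n) \<le> Inf ?S" by (rule Inf_greatest)
  then have "enn2ereal (ennreal (second_moment / n)) \<le> enn2ereal (poincare_constant n (uniform_on_body n B))"
    unfolding poincare_constant_def by (simp only: less_eq_ennreal.rep_eq)
  also have le: "enn2ereal (poincare_constant n (uniform_on_body n B)) \<le> ereal (C * second_moment / n)"
    using assms by (simp add: satisfies_KLS_def second_moment_def)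
  finally have "second_moment / n \<le> C * second_moment / n"
    using second_moment_nonneg by (simp add: enn2ereal_ennreal)
  then have "1 * (second_moment / n) \<le> C * (second_moment / n)" by simp
  moreover have "0 < second_moment / n" using second_moment_pos i by simp
  ultimately show C: "1 \<le> C" by (rule mult_right_le_imp_le)
  define b where "b = 2 * C * second_moment / n"
  have cb: "0 \<le> C * second_moment / n" "C * second_moment / n < b"
    using C second_moment_pos i by (auto simp: b_def field_simps)
  have "poincare_constant n (uniform_on_body n B) \<le> ennreal (C * second_moment / n)"
    using le cb by (simp only: less_eq_ennreal.rep_eq enn2ereal_ennreal)
  also have "\<dots> < ennreal b" using cb by (simp add: ennreal_less_iff)
  finally obtain A where A: "A \<in> ?S" "A < ennreal b"
    unfolding poincare_constant_def Inf_less_iff by blast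
  show "poincare_bound (2 * C * second_moment / n)"
    unfolding poincare_bound_def b_def[symmetric]
  proof (intro allI impI)
    fix f assume "smooth n f \<and> integrable (uniform_on_body n B) f"
    then have "variance_of (uniform_on_body n B) f \<le> A * energy n (uniform_on_body n B) f" using A(1) by blast
    also have "\<dots> \<le> ennreal b * energy n (uniform_on_body n B) f"
      using A(2) by (intro mult_right_mono) auto
    finally show "variance_of (uniform_on_body n B) f \<le> ennreal b * energy n (uniform_on_body n B) f" .
  qed
qed

end

section \<open>The typical scale of the gauge measure\<close>

lemma exp_quarter_power_le: "exp (real m / 4) \<le> (4 / 3) ^ m"
proof -
  have "exp (1 / 4 :: real) ^ Suc 3 = exp 1" by (simp add: exp_of_nat_mult[symmetric])
  also have "\<dots> \<le> (4 / 3) ^ Suc 3" using exp_le by (simp add: power_divide)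
  finally have "exp (1 / 4 :: real) \<le> 4 / 3" by (rule power_le_imp_le_base) simp
  then have "exp (1 / 4 :: real) ^ m \<le> (4 / 3) ^ m" by (intro power_mono) auto
  then show ?thesis by (simp add: exp_of_nat_mult[symmetric])
qed

locale body_with_probability_profile = body_with_profile +
  assumes total: "(\<integral>\<^sup>+x. weight x \<partial>lborel_n n) = 1"
begin

definition outer_mass :: "real \<Rightarrow> ennreal" where
  "outer_mass r = (\<integral>\<^sup>+x. indicator {r..} (gauge x) * weight x \<partial>lborel_n n)"

definition inner_mass :: "real \<Rightarrow> ennreal" where
  "inner_mass r = (\<integral>\<^sup>+x. indicator {..<r} (gauge x) * weight x \<partial>lborel_n n)"

lemma inner_plus_outer: "inner_mass r + outer_mass r = 1"
proof -
  have "inner_mass r + outer_mass r = (\<integral>\<^sup>+x. indicator {..<r} (gauge x) * weight x + indicator {r..} (gauge x) * weight x \<partial>lborel_n n)"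
    unfolding inner_mass_def outer_mass_def by (rule nn_integral_add[symmetric]) measurable
  also have "\<dots> = (\<integral>\<^sup>+x. weight x \<partial>lborel_n n)" by (intro nn_integral_cong) (auto simp: indicator_def)
  finally show ?thesis by (simp add: total)
qed

lemma mass_split:
  obtains a b where "0 \<le> a" "0 \<le> b" "inner_mass r = ennreal a" "outer_mass r = ennreal b" "a + b = 1"
proof -
  have "inner_mass r \<noteq> top" "outer_mass r \<noteq> top" using inner_plus_outer[of r] by auto
  then obtain a b where ab: "0 \<le> a" "0 \<le> b" "inner_mass r = ennreal a" "outer_mass r = ennreal b"
    by (cases "inner_mass r"; cases "outer_mass r") auto
  then have "ennreal (a + b) = ennreal 1" using inner_plus_outer[of r] by simp
  then have "a + b = 1" using ab by (subst (asm) ennreal_inj) auto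
  then show thesis using ab that by blast
qed

lemma inner_mass_mono: "r \<le> s \<Longrightarrow> inner_mass r \<le> inner_mass s"
  unfolding inner_mass_def by (intro nn_integral_mono) (auto simp: indicator_def)

lemma exists_inner_mass_gt:
  assumes "q < 1" shows "\<exists>j::nat. q < inner_mass (real j)"
proof -
  have "(\<integral>\<^sup>+x. weight x \<partial>lborel_n n) = (\<integral>\<^sup>+x. (SUP j::nat. indicator {..<real j} (gauge x) * weight x) \<partial>lborel_n n)"
  proof (intro nn_integral_cong antisym)
    fix x
    obtain j :: nat where "gauge x < real j" using reals_Archimedean2 by blast
    then have "weight x \<le> indicator {..<real j} (gauge x) * weight x" by simp
    then show "weight x \<le> (SUP j::nat. indicator {..<real j} (gauge x) * weight x)" by (rule SUP_upper2[OF UNIV_I])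
    show "(SUP j::nat. indicator {..<real j} (gauge x) * weight x) \<le> weight x"
      by (intro SUP_least) (auto simp: indicator_def)
  qed
  also have "\<dots> = (SUP j::nat. inner_mass (real j))"
    unfolding inner_mass_def
    by (rule nn_integral_monotone_convergence_SUP) (auto simp: incseq_def le_fun_def indicator_def)
  finally have "q < (SUP j::nat. inner_mass (real j))" using assms total by simp
  then show ?thesis by (auto simp: less_SUP_iff)
qed

lemma exists_outer_mass_gt:
  assumes "q < 1" shows "\<exists>r>0. q < outer_mass r"
proof -
  have "(\<integral>\<^sup>+x. weight x \<partial>lborel_n n) = (\<integral>\<^sup>+x. (SUP j::nat. indicator {1 / Suc j..} (gauge x) * weight x) \<partial>lborel_n n)"
    using gauge_pos_AE
  proof (intro nn_integral_cong_AE, eventually_elim)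
    case (elim x)
    then obtain j :: nat where "1 / Suc j < gauge x" using nat_approx_posE by blast
    then have "weight x \<le> indicator {1 / Suc j..} (gauge x) * weight x" by simp
    then have "weight x \<le> (SUP j::nat. indicator {1 / Suc j..} (gauge x) * weight x)" by (rule SUP_upper2[OF UNIV_I])
    moreover have "(SUP j::nat. indicator {1 / Suc j..} (gauge x) * weight x) \<le> weight x"
      by (intro SUP_least) (auto simp: indicator_def)
    ultimately show ?case by (rule antisym)
  qed
  also have "\<dots> = (SUP j::nat. outer_mass (1 / Suc j))"
    unfolding outer_mass_def
  proof (rule nn_integral_monotone_convergence_SUP)
    show "incseq (\<lambda>(j::nat) x. indicator {1 / Suc j..} (gauge x) * weight x)"
    proof (intro incseq_SucI le_funI)
      fix j :: nat and x
      have "1 / real (Suc (Suc j)) \<le> 1 / real (Suc j)" by (intro divide_left_mono) auto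
      then show "indicator {1 / Suc j..} (gauge x) * weight x \<le> indicator {1 / Suc (Suc j)..} (gauge x) * weight x"
        by (auto simp: indicator_def)
    qed
  qed measurable
  finally have "q < (SUP j::nat. outer_mass (1 / Suc j))" using assms total by simp
  then obtain j :: nat where "q < outer_mass (1 / Suc j)" by (auto simp: less_SUP_iff)
  then show ?thesis by (intro exI[of _ "1 / Suc j"]) auto
qed

text \<open>
  Start with a radius \<open>q\<close> so small that its outer mass exceeds \<open>1/3\<close> and double it until the inner mass
  exceeds \<open>2/3\<close>. The last radius before that has outer mass at least \<open>1/3\<close>.
\<close>

lemma typical_scale:
  obtains r where "0 < r" "ennreal (2 / 3) < inner_mass r" "ennreal (1 / 3) \<le> outer_mass (r / 2)"
proof -
  have third: "ennreal (1 / 3) < 1" "ennreal (2 / 3) < 1" by (simp_all add: ennreal_less_one_iff)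
  obtain q where q: "0 < q" "ennreal (1 / 3) < outer_mass q" using exists_outer_mass_gt[OF third(1)] by blast
  obtain j :: nat where j: "ennreal (2 / 3) < inner_mass (real j)" using exists_inner_mass_gt[OF third(2)] by blast
  define P where "P k \<longleftrightarrow> ennreal (2 / 3) < inner_mass (q * 2 ^ k)" for k :: nat
  have "\<exists>k. P k"
  proof -
    obtain k :: nat where "real j / q < 2 ^ k" using real_arch_pow[of 2 "real j / q"] by auto
    then have "real j \<le> q * 2 ^ k" using q(1) by (simp add: pos_divide_less_eq mult.commute)
    then show ?thesis unfolding P_def using j inner_mass_mono by (meson less_le_trans)
  qed
  define k where "k = (LEAST k. P k)"
  have Pk: "P k" unfolding k_def using \<open>\<exists>k. P k\<close> by (rule LeastI_ex)
  have conv: "ennreal (1 / 3) \<le> outer_mass r" if "\<not> ennreal (2 / 3) < inner_mass r" for r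
  proof -
    obtain a b where ab: "0 \<le> a" "0 \<le> b" "inner_mass r = ennreal a" "outer_mass r = ennreal b" "a + b = 1"
      by (rule mass_split)
    then have "\<not> 2 / 3 < a" using that by (simp add: ennreal_less_iff)
    then have "1 / 3 \<le> b" using ab(5) by simp
    then show ?thesis unfolding ab(4) by (rule ennreal_leI)
  qed
  have no0: "\<not> P 0"
  proof
    assume "P 0"
    obtain a b where ab: "0 \<le> a" "0 \<le> b" "inner_mass q = ennreal a" "outer_mass q = ennreal b" "a + b = 1"
      by (rule mass_split)
    have "2 / 3 < a" using \<open>P 0\<close> ab by (simp add: P_def ennreal_less_iff)
    moreover have "1 / 3 < b" using q(2) ab by (simp add: ennreal_less_iff)
    ultimately show False using ab(5) by simp
  qed
  then obtain l where l: "k = Suc l" using Pk by (cases k) auto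
  then have "\<not> P l" using not_less_Least[of l P] by (simp add: k_def)
  then have "ennreal (1 / 3) \<le> outer_mass (q * 2 ^ k / 2)" by (intro conv) (simp add: P_def l)
  then show thesis using that[of "q * 2 ^ k"] Pk q(1) by (simp add: P_def)
qed

text \<open>
  Otherwise \<open>log \<rho>\<close> has slope at least \<open>- n / (4 r)\<close> on all of \<open>[0, 8 r]\<close>, so \<open>\<rho>(w) \<le> e\<^sup>n\<^sup>/\<^sup>4 \<rho>(2 w)\<close> for \<open>w < r\<close>. A
  dilation by \<open>2\<close> multiplies volumes by \<open>2\<^sup>n\<close>, so \<open>rB\<close> would carry at most the fraction
  \<open>(e\<^sup>1\<^sup>/\<^sup>4 / 2)\<^sup>n \<le> 2/3\<close> of the mass of \<open>2rB\<close>.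
\<close>

lemma decay_beyond_typical_scale:
  assumes r: "0 < r" and mass: "ennreal (2 / 3) < inner_mass r"
  shows "\<forall>u>8 * r. \<rho> u \<le> \<rho> (8 * r) * exp (- (2 * real n / (8 * r)) * (u - 8 * r))"
proof (rule ccontr)
  define k where "k = 2 * real n / (8 * r)"
  assume "\<not> ?thesis"
  then obtain u where u: "8 * r < u" "\<not> \<rho> u \<le> \<rho> (8 * r) * exp (- k * (u - 8 * r))" by (auto simp: k_def)
  \<comment> \<open>a faster decay between \<open>w\<close> and \<open>2 w\<close> would propagate to \<open>8 r\<close> and beyond\<close>
  have slow: "\<rho> w \<le> exp (real n / 4) * \<rho> (2 * w)" if w: "0 < w" "w < r" for w
  proof (rule ccontr)
    assume neg: "\<not> ?thesis"
    have "k * (2 * w - w) \<le> real n / 4" using w r n by (simp add: k_def divide_simps)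
    then have "\<rho> (2 * w) * exp (k * (2 * w - w)) \<le> \<rho> (2 * w) * exp (real n / 4)"
      using nonneg[of "2 * w"] w by (intro mult_left_mono) auto
    also have "\<dots> \<le> \<rho> w" using neg by (simp add: mult.commute)
    finally have "\<rho> (8 * r) \<le> \<rho> (2 * w) * exp (- k * (8 * r - 2 * w))"
      using w r by (intro decay_rate_propagates[of w "2 * w" "8 * r" k]) auto
    then have "\<rho> (8 * r) * exp (k * (8 * r - 2 * w)) \<le> \<rho> (2 * w) * exp (- k * (8 * r - 2 * w)) * exp (k * (8 * r - 2 * w))"
      by (rule mult_right_mono) simp
    also have "\<dots> = \<rho> (2 * w)" by (simp add: mult.assoc exp_add[symmetric])
    finally have "\<rho> u \<le> \<rho> (8 * r) * exp (- k * (u - 8 * r))"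
      using w r u(1) by (intro decay_rate_propagates[of "2 * w" "8 * r" u k]) auto
    then show False using u(2) by simp
  qed
  let ?I = "\<integral>\<^sup>+x. indicator {..<r} (gauge x) * ennreal (\<rho> (max 0 (2 * gauge x))) \<partial>lborel_n n"
  have "inner_mass r \<le> (\<integral>\<^sup>+x. ennreal (exp (real n / 4)) * (indicator {..<r} (gauge x) * ennreal (\<rho> (max 0 (2 * gauge x)))) \<partial>lborel_n n)"
    unfolding inner_mass_def using gauge_pos_AE
  proof (intro nn_integral_mono_AE, eventually_elim)
    case (elim x)
    then show ?case
      using slow[of "gauge x"] nonneg[of "2 * gauge x"]
      by (auto simp: indicator_def weight_eq ennreal_mult[symmetric] max_def intro!: ennreal_leI)
  qed
  also have "\<dots> = ennreal (exp (real n / 4)) * ?I" by (rule nn_integral_cmult) measurable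
  finally have "ennreal (2 ^ n) * inner_mass r \<le> ennreal (2 ^ n) * (ennreal (exp (real n / 4)) * ?I)"
    by (rule mult_left_mono) simp
  also have "\<dots> = ennreal (exp (real n / 4)) * (ennreal (\<bar>2\<bar> ^ n) * ?I)" by (simp add: mult_ac)
  also have "ennreal (\<bar>2\<bar> ^ n) * ?I = inner_mass (2 * r)"
  proof -
    have "inner_mass (2 * r) = ennreal (\<bar>2\<bar> ^ n) * (\<integral>\<^sup>+x. indicator {..<2 * r} (gauge (scale_n n 2 x)) * weight (scale_n n 2 x) \<partial>lborel_n n)"
      unfolding inner_mass_def by (rule nn_integral_affine_n[where a="\<lambda>_. 0"]) auto
    also have "(\<integral>\<^sup>+x. indicator {..<2 * r} (gauge (scale_n n 2 x)) * weight (scale_n n 2 x) \<partial>lborel_n n) = ?I"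
      by (intro nn_integral_cong) (simp add: weight_def gauge_scale indicator_def)
    finally show ?thesis by simp
  qed
  also have "inner_mass (2 * r) \<le> 1"
    by (rule mass_split[of "2 * r"]) simp
  finally have le: "ennreal (2 ^ n) * inner_mass r \<le> ennreal (exp (real n / 4))" by (simp add: mult_left_mono)
  obtain d where d: "0 \<le> d" "inner_mass r = ennreal d"
    by (rule mass_split[of r])
  have "2 ^ n * d \<le> exp (real n / 4)" using le d by (simp add: ennreal_mult[symmetric])
  also have "\<dots> \<le> (4 / 3) ^ n" by (rule exp_quarter_power_le)
  also have "\<dots> = 2 ^ n * (2 / 3) ^ n" by (simp add: power_mult_distrib[symmetric])
  finally have "d \<le> (2 / 3) ^ n" by simp
  also have "\<dots> \<le> (2 / 3) ^ 1" using n by (intro power_decreasing) auto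
  finally show False using mass d by (simp add: ennreal_less_iff)
qed

text \<open>
  On the set where the gauge is at least \<open>r / 2\<close>, \<open>|x|\<^sup>2\<close> is at least \<open>(r / 2)\<^sup>2 |\<theta>|\<^sup>2\<close>.
\<close>

lemma second_moment_lower_bound:
  assumes r: "0 < r" and mass: "ennreal (1 / 3) \<le> outer_mass (r / 2)"
  shows "ennreal (r\<^sup>2 * second_moment / 12) \<le> (\<integral>\<^sup>+x. weight x * ennreal ((norm_n n x)\<^sup>2) \<partial>lborel_n n)"
proof -
  let ?\<phi> = "\<lambda>t. indicator {r / 2..} t * ennreal (\<rho> (max 0 t))"
  have "ennreal (r\<^sup>2 * second_moment / 12) = ennreal (r\<^sup>2 / 4 * second_moment) * ennreal (1 / 3)"
    using second_moment_nonneg by (subst ennreal_mult[symmetric]) auto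
  also have "\<dots> \<le> ennreal (r\<^sup>2 / 4 * second_moment) * outer_mass (r / 2)"
    by (intro mult_left_mono mass) simp
  also have "outer_mass (r / 2) = (\<integral>\<^sup>+x. ?\<phi> (gauge x) * 1 \<partial>lborel_n n)"
    unfolding outer_mass_def weight_def by simp
  also have "\<dots> = (\<integral>\<^sup>+t\<in>{0<..}. ennreal (real n * t ^ (n - 1)) * ?\<phi> t * (\<integral>\<^sup>+y\<in>B. 1 \<partial>lborel_n n) \<partial>lborel)"
    by (rule polar_radial) measurable
  also have "ennreal (r\<^sup>2 / 4 * second_moment) * \<dots>
    = (\<integral>\<^sup>+t. ennreal (r\<^sup>2 / 4 * second_moment) * (ennreal (real n * t ^ (n - 1)) * ?\<phi> t * (\<integral>\<^sup>+y\<in>B. 1 \<partial>lborel_n n) * indicator {0<..} t) \<partial>lborel)"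
    by (rule nn_integral_cmult[symmetric]) measurable
  also have "\<dots> \<le> (\<integral>\<^sup>+t\<in>{0<..}. ennreal (real n * t ^ (n - 1)) * ?\<phi> t * (\<integral>\<^sup>+y\<in>B. ennreal ((norm_n n (scale_n n t (proj y)))\<^sup>2) \<partial>lborel_n n) \<partial>lborel)"
  proof (intro nn_integral_mono)
    fix t
    show "ennreal (r\<^sup>2 / 4 * second_moment) * (ennreal (real n * t ^ (n - 1)) * ?\<phi> t * (\<integral>\<^sup>+y\<in>B. 1 \<partial>lborel_n n) * indicator {0<..} t)
      \<le> ennreal (real n * t ^ (n - 1)) * ?\<phi> t * (\<integral>\<^sup>+y\<in>B. ennreal ((norm_n n (scale_n n t (proj y)))\<^sup>2) \<partial>lborel_n n) * indicator {0<..} t"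
    proof (cases "r / 2 \<le> t")
      case True
      have "ennreal (r\<^sup>2 / 4 * second_moment) * (\<integral>\<^sup>+y\<in>B. 1 \<partial>lborel_n n) = ennreal (r\<^sup>2 / 4) * ennreal (vol * second_moment)"
        using vol_pos second_moment_nonneg by (simp add: emeasure_B ennreal_mult[symmetric] mult_ac)
      also have "\<dots> \<le> ennreal (t\<^sup>2) * ennreal (vol * second_moment * (n + 2) / n)"
      proof (intro mult_mono ennreal_leI)
        have "(r / 2)\<^sup>2 \<le> t\<^sup>2" using True r by (intro power_mono) auto
        then show "r\<^sup>2 / 4 \<le> t\<^sup>2" by (simp add: power_divide)
        show "vol * second_moment \<le> vol * second_moment * (n + 2) / n"
          using vol_pos second_moment_nonneg n by (simp add: le_divide_eq mult_left_mono)
      qed auto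
      also have "\<dots> = (\<integral>\<^sup>+y. ennreal (t\<^sup>2) * (ennreal ((norm_n n (proj y))\<^sup>2) * indicator B y) \<partial>lborel_n n)"
        unfolding second_moment_direction[symmetric] by (rule nn_integral_cmult[symmetric]) measurable
      also have "\<dots> = (\<integral>\<^sup>+y\<in>B. ennreal ((norm_n n (scale_n n t (proj y)))\<^sup>2) \<partial>lborel_n n)"
        by (intro nn_integral_cong) (simp add: norm_sq_scale ennreal_mult mult.assoc)
      finally have "(ennreal (real n * t ^ (n - 1)) * ?\<phi> t * indicator {0<..} t) * (ennreal (r\<^sup>2 / 4 * second_moment) * (\<integral>\<^sup>+y\<in>B. 1 \<partial>lborel_n n))
        \<le> (ennreal (real n * t ^ (n - 1)) * ?\<phi> t * indicator {0<..} t) * (\<integral>\<^sup>+y\<in>B. ennreal ((norm_n n (scale_n n t (proj y)))\<^sup>2) \<partial>lborel_n n)"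
        by (rule mult_left_mono) simp
      then show ?thesis by (simp only: mult_ac)
    qed simp
  qed
  also have "\<dots> = (\<integral>\<^sup>+x. ?\<phi> (gauge x) * ennreal ((norm_n n x)\<^sup>2) \<partial>lborel_n n)"
    by (rule polar_radial[symmetric]) measurable
  also have "\<dots> \<le> (\<integral>\<^sup>+x. weight x * ennreal ((norm_n n x)\<^sup>2) \<partial>lborel_n n)"
    unfolding weight_def by (intro nn_integral_mono) (auto simp: indicator_def)
  finally show ?thesis .
qed

section \<open>The KLS inequality for the gauge measure\<close>

text \<open>
  The tail estimate starts at \<open>8 r\<close>, where the decay of the profile is guaranteed, so the bulk extends to
  \<open>16 r\<close>. The constant \<open>c\<close> stands in for the mean, so that the inequality makes sense for every smooth \<open>f\<close>;
  for the coordinates it yields the second moments of \<open>\<mu>\<close>.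
\<close>

lemma deviation_bound:
  assumes A: "poincare_bound A" "0 \<le> A" and r: "0 < r" "ennreal (2 / 3) < inner_mass r" and f: "smooth n f"
  shows "\<exists>c. (\<integral>\<^sup>+x. weight x * ennreal ((f x - c)\<^sup>2) \<partial>lborel_n n)
    \<le> ennreal (64 * r\<^sup>2 * (12 * A + 640 * second_moment / n)) * (\<integral>\<^sup>+x. weight x * ennreal (grad_sq n f x) \<partial>lborel_n n)"
proof -
  have [measurable]: "f \<in> borel_measurable (lborel_n n)" by (rule measurable_continuous_map[OF smooth_continuous[OF f]])
  note [measurable] = grad_sq_measurable[OF f]
  let ?R = "8 * r"
  have R: "0 < ?R" "0 < 2 * ?R" using r by auto
  obtain c0 where c0: "\<forall>f. smooth n f \<longrightarrow>
      (\<integral>\<^sup>+x. indicator {..2 * ?R} (gauge x) * weight x * ennreal ((radial_mean f (gauge x) - radial_mean f c0)\<^sup>2) \<partial>lborel_n n)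
      \<le> ennreal (48 * (2 * ?R)\<^sup>2 * second_moment / n) * (\<integral>\<^sup>+x. indicator {..2 * ?R} (gauge x) * weight x * ennreal (grad_sq n f x) \<partial>lborel_n n)"
    by (rule radial_mean_concentration[OF R(2)])
  define c where "c = radial_mean f c0"
  define E where "E = (\<integral>\<^sup>+x. weight x * ennreal (grad_sq n f x) \<partial>lborel_n n)"
  define E0 where "E0 = (\<integral>\<^sup>+x. indicator {..2 * ?R} (gauge x) * weight x * ennreal (grad_sq n f x) \<partial>lborel_n n)"
  have E0: "E0 \<le> E" unfolding E0_def E_def by (intro nn_integral_mono) (auto simp: indicator_def)
  define \<beta> where "\<beta> = (\<integral>\<^sup>+x. indicator {..2 * ?R} (gauge x) * weight x * ennreal ((f x - c)\<^sup>2) \<partial>lborel_n n)"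
  define \<tau> where "\<tau> = (\<integral>\<^sup>+x. indicator {2 * ?R<..} (gauge x) * weight x * ennreal ((f x - c)\<^sup>2) \<partial>lborel_n n)"
  define a where "a = (2 * ?R)\<^sup>2 * A"
  define b where "b = 48 * (2 * ?R)\<^sup>2 * second_moment / n"
  define d where "d = 64 * ?R\<^sup>2 * second_moment / n"
  have abd: "0 \<le> a" "0 \<le> b" "0 \<le> d" using A(2) second_moment_nonneg by (auto simp: a_def b_def d_def)
  have "\<beta> \<le> ennreal a * E0 + ennreal b * E0"
    unfolding \<beta>_def a_def b_def E0_def
    by (rule order_trans[OF poincare_mixture[OF A f R(2)] add_left_mono]) (unfold c_def, rule c0[rule_format, OF f])
  also have "\<dots> \<le> ennreal a * E + ennreal b * E" by (intro add_mono mult_left_mono E0) auto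
  also have "\<dots> = ennreal (a + b) * E" using abd by (simp add: distrib_right)
  finally have \<beta>: "\<beta> \<le> ennreal (a + b) * E" .
  have \<tau>: "\<tau> \<le> ennreal d * E + ennreal 2 * \<beta>"
    unfolding \<tau>_def \<beta>_def d_def E_def by (rule tail_bound[OF R(1) decay_beyond_typical_scale[OF r] f])
  have "(\<integral>\<^sup>+x. weight x * ennreal ((f x - c)\<^sup>2) \<partial>lborel_n n)
    = (\<integral>\<^sup>+x. indicator {..2 * ?R} (gauge x) * weight x * ennreal ((f x - c)\<^sup>2) + indicator {2 * ?R<..} (gauge x) * weight x * ennreal ((f x - c)\<^sup>2) \<partial>lborel_n n)"
    by (intro nn_integral_cong) (auto simp: indicator_def)
  also have "\<dots> = \<beta> + \<tau>" unfolding \<beta>_def \<tau>_def by (rule nn_integral_add) measurable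
  also have "\<dots> \<le> \<beta> + (ennreal d * E + ennreal 2 * \<beta>)" by (intro add_left_mono \<tau>)
  also have "\<dots> \<le> ennreal (a + b) * E + (ennreal d * E + ennreal 2 * (ennreal (a + b) * E))"
    by (intro add_mono mult_left_mono \<beta>) auto
  also have "\<dots> = (ennreal (a + b) + (ennreal d + ennreal 2 * ennreal (a + b))) * E"
    by (simp only: distrib_right mult.assoc)
  also have "ennreal (a + b) + (ennreal d + ennreal 2 * ennreal (a + b)) = ennreal ((a + b) + (d + 2 * (a + b)))"
    using abd by (simp only: ennreal_plus ennreal_mult add_nonneg_nonneg mult_nonneg_nonneg zero_le_numeral)
  also have "(a + b) + (d + 2 * (a + b)) = 64 * r\<^sup>2 * (12 * A + 640 * second_moment / n)"
    by (simp add: a_def b_def d_def power_mult_distrib algebra_simps)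
  finally show ?thesis unfolding E_def by blast
qed

lemma KLS_transfer:
  assumes C: "satisfies_KLS n (uniform_on_body n B) C"
  shows "satisfies_KLS n (gauge_measure n B \<rho>) (509952 * C)"
proof -
  define \<mu> where "\<mu> = gauge_measure n B \<rho>"
  have \<mu>: "\<mu> = density (lborel_n n) weight"
    unfolding \<mu>_def gauge_measure_def by (intro arg_cong[of _ _ "density (lborel_n n)"] ext) (simp add: weight_eq)
  have nn: "(\<integral>\<^sup>+x. F x \<partial>\<mu>) = (\<integral>\<^sup>+x. weight x * F x \<partial>lborel_n n)" if "F \<in> borel_measurable (lborel_n n)" for F
    unfolding \<mu> using that by (intro nn_integral_density) measurable
  have sets_\<mu>: "sets \<mu> = sets (lborel_n n)" by (simp add: \<mu>)
  interpret P: prob_space \<mu>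
  proof
    have "emeasure \<mu> (space \<mu>) = (\<integral>\<^sup>+x. 1 \<partial>\<mu>)" by simp
    also have "\<dots> = 1" by (subst nn) (auto simp: total)
    finally show "emeasure \<mu> (space \<mu>) = 1" .
  qed
  obtain r where r: "0 < r" "ennreal (2 / 3) < inner_mass r" "ennreal (1 / 3) \<le> outer_mass (r / 2)"
    by (rule typical_scale)
  \<comment> \<open>an admissible Poincare constant of \<open>B\<close>\<close>
  define A where "A = 2 * C * second_moment / n"
  have C1: "1 \<le> C" and A: "poincare_bound A" using KLS_imp_poincare_bound[OF C] by (auto simp: A_def)
  have A0: "0 \<le> A" using C1 second_moment_nonneg by (simp add: A_def)
  define K where "K = 64 * r\<^sup>2 * (12 * A + 640 * second_moment / n)"
  have K0: "0 \<le> K" using A0 second_moment_nonneg by (simp add: K_def)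
  have dev: "\<exists>c. (\<integral>\<^sup>+x. ennreal ((f x - c)\<^sup>2) \<partial>\<mu>) \<le> ennreal K * energy n \<mu> f" if f: "smooth n f" for f
  proof -
    have [measurable]: "f \<in> borel_measurable (lborel_n n)" by (rule measurable_continuous_map[OF smooth_continuous[OF f]])
    note [measurable] = grad_sq_measurable[OF f]
    have en: "energy n \<mu> f = (\<integral>\<^sup>+x. weight x * ennreal (grad_sq n f x) \<partial>lborel_n n)"
      unfolding energy_def by (rule nn) measurable
    obtain c where c: "(\<integral>\<^sup>+x. weight x * ennreal ((f x - c)\<^sup>2) \<partial>lborel_n n)
      \<le> ennreal K * (\<integral>\<^sup>+x. weight x * ennreal (grad_sq n f x) \<partial>lborel_n n)"
      using deviation_bound[OF A A0 r(1,2) f] unfolding K_def by blast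
    have "(\<integral>\<^sup>+x. ennreal ((f x - c)\<^sup>2) \<partial>\<mu>) = (\<integral>\<^sup>+x. weight x * ennreal ((f x - c)\<^sup>2) \<partial>lborel_n n)"
      by (rule nn) measurable
    then show ?thesis using c unfolding en by (intro exI[of _ c]) simp
  qed
  \<comment> \<open>without this the integral of \<open>|x|\<^sup>2\<close> on the right-hand side of the claim could have the default value \<open>0\<close>\<close>
  have coord: "integrable \<mu> (\<lambda>x. (x i)\<^sup>2)" if i: "i < n" for i
  proof -
    note [measurable] = measurable_nth_lborel_n[OF i]
    have [measurable]: "(\<lambda>x. x i) \<in> borel_measurable \<mu>"
      using measurable_nth_lborel_n[OF i] by (simp add: measurable_cong_sets[OF sets_\<mu> refl])
    obtain c where c: "(\<integral>\<^sup>+x. ennreal ((x i - c)\<^sup>2) \<partial>\<mu>) \<le> ennreal K * energy n \<mu> (\<lambda>x. x i)"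
      using dev[OF smooth_coordinate[OF i]] by blast
    have "energy n \<mu> (\<lambda>x. x i) = 1"
      unfolding energy_def grad_sq_coordinate[OF i] using P.emeasure_space_1 by simp
    then have "(\<integral>\<^sup>+x. ennreal ((x i - c)\<^sup>2) \<partial>\<mu>) < \<infinity>" using c by (simp add: order_le_less_trans)
    then have i1: "integrable \<mu> (\<lambda>x. (x i - c)\<^sup>2)" by (intro integrableI_nonneg) auto
    show ?thesis
    proof (rule Bochner_Integration.integrable_bound)
      show "integrable \<mu> (\<lambda>x. 2 * (x i - c)\<^sup>2 + 2 * c\<^sup>2)" using i1 by simp
      have "(y::real)\<^sup>2 \<le> 2 * (y - c)\<^sup>2 + 2 * c\<^sup>2" for y
        using sum_squares_bound[of "y - c" c] by (simp add: power2_eq_square algebra_simps)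
      then show "AE x in \<mu>. norm ((x i)\<^sup>2) \<le> norm (2 * (x i - c)\<^sup>2 + 2 * c\<^sup>2)" by auto
    qed measurable
  qed
  have int: "integrable \<mu> (\<lambda>x. (norm_n n x)\<^sup>2)"
    unfolding norm_n_sq_sum using coord by (intro Bochner_Integration.integrable_sum) auto
  define Q where "Q = (\<integral>x. (norm_n n x)\<^sup>2 \<partial>\<mu>)"
  have Q0: "0 \<le> Q" unfolding Q_def by (intro integral_nonneg_AE) simp
  have "ennreal (r\<^sup>2 * second_moment / 12) \<le> (\<integral>\<^sup>+x. ennreal ((norm_n n x)\<^sup>2) \<partial>\<mu>)"
    using second_moment_lower_bound[OF r(1,3)] by (subst nn) auto
  also have "\<dots> = ennreal Q" unfolding Q_def by (rule nn_integral_eq_integral[OF int]) simp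
  finally have rQ: "r\<^sup>2 * second_moment \<le> 12 * Q" using Q0 by simp
  \<comment> \<open>\<open>509952 = 64 \<cdot> 664 \<cdot> 12\<close>: the dilation by \<open>8\<close>, the bulk and tail constants with \<open>C \<ge> 1\<close>, and the lower bound on \<open>Q\<close>\<close>
  have KQ: "K \<le> 509952 * C * Q / n"
  proof -
    define q where "q = second_moment / n"
    have "1 * q \<le> C * q" using C1 second_moment_nonneg by (intro mult_right_mono) (auto simp: q_def)
    moreover have "A = 2 * (C * q)" "640 * second_moment / n = 640 * q" "664 * C * second_moment / n = 664 * (C * q)"
      by (simp_all add: A_def q_def)
    ultimately have "12 * A + 640 * second_moment / n \<le> 664 * C * second_moment / n" by linarith
    then have "K \<le> 64 * r\<^sup>2 * (664 * C * second_moment / n)"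
      unfolding K_def by (intro mult_left_mono) auto
    also have "\<dots> = 42496 * C / n * (r\<^sup>2 * second_moment)" by simp
    also have "\<dots> \<le> 42496 * C / n * (12 * Q)" using rQ C1 by (intro mult_left_mono) auto
    finally show ?thesis by (simp add: algebra_simps)
  qed
  have "poincare_constant n \<mu> \<le> ennreal (509952 * C * Q / n)"
    unfolding poincare_constant_def
  proof (rule Inf_lower, intro CollectI allI impI)
    fix f assume f: "smooth n f \<and> integrable \<mu> f"
    then obtain c where c: "(\<integral>\<^sup>+x. ennreal ((f x - c)\<^sup>2) \<partial>\<mu>) \<le> ennreal K * energy n \<mu> f" using dev by blast
    have "variance_of \<mu> f \<le> (\<integral>\<^sup>+x. ennreal ((f x - c)\<^sup>2) \<partial>\<mu>)"
      unfolding variance_of_def using f by (intro P.variance_le_deviation) simp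
    also note c
    also have "ennreal K * energy n \<mu> f \<le> ennreal (509952 * C * Q / n) * energy n \<mu> f"
      by (intro mult_right_mono ennreal_leI KQ) simp
    finally show "variance_of \<mu> f \<le> ennreal (509952 * C * Q / n) * energy n \<mu> f" .
  qed
  then have "enn2ereal (poincare_constant n \<mu>) \<le> enn2ereal (ennreal (509952 * C * Q / n))"
    by (simp only: less_eq_ennreal.rep_eq)
  also have "\<dots> = ereal (509952 * C * Q / n)" using C1 Q0 by (intro enn2ereal_ennreal) simp
  finally show ?thesis by (simp add: satisfies_KLS_def \<mu>_def[symmetric] Q_def)
qed

end

theorem proposition4:
  shows "\<exists>\<alpha>::real. \<alpha> > 0 \<and>
    (\<forall>(n::nat) (B :: (nat \<Rightarrow> real) set) (C::real) (\<rho> :: real \<Rightarrow> real).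
       n \<ge> 1 \<longrightarrow>
       convex_body n B \<longrightarrow>
       isotropic_body n B \<longrightarrow>
       satisfies_KLS n (uniform_on_body n B) C \<longrightarrow>
       (\<forall>t\<ge>0. \<rho> t \<ge> 0) \<longrightarrow>
       log_concave_on {0..} \<rho> \<longrightarrow>
       antimono_on {0..} \<rho> \<longrightarrow>
       prob_space (gauge_measure n B \<rho>) \<longrightarrow>
       satisfies_KLS n (gauge_measure n B \<rho>) (\<alpha> * C))"
proof (intro exI[of _ 509952] conjI allI impI)
  fix n :: nat and B :: "(nat \<Rightarrow> real) set" and C :: real and \<rho> :: "real \<Rightarrow> real"
  assume n: "n \<ge> 1" and body: "convex_body n B" and iso: "isotropic_body n B"
    and KLS: "satisfies_KLS n (uniform_on_body n B) C"
    and nonneg: "\<forall>t\<ge>0. \<rho> t \<ge> 0" and lc: "log_concave_on {0..} \<rho>" and anti: "antimono_on {0..} \<rho>"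
    and prob: "prob_space (gauge_measure n B \<rho>)"
  interpret body_with_profile n B \<rho>
    by unfold_locales (use n body iso nonneg lc anti in auto)
  have "(\<integral>\<^sup>+x. weight x \<partial>lborel_n n) = emeasure (gauge_measure n B \<rho>) (space (gauge_measure n B \<rho>))"
  proof -
    have "gauge_measure n B \<rho> = density (lborel_n n) weight"
      unfolding gauge_measure_def by (intro arg_cong[of _ _ "density (lborel_n n)"] ext) (simp add: weight_eq)
    moreover have "emeasure (density (lborel_n n) weight) (space (lborel_n n)) = (\<integral>\<^sup>+x. weight x * indicator (space (lborel_n n)) x \<partial>lborel_n n)"
      by (rule emeasure_density[OF weight_measurable sets.top])
    moreover have "\<dots> = (\<integral>\<^sup>+x. weight x \<partial>lborel_n n)"
      by (intro nn_integral_cong) (simp add: indicator_def)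
    ultimately show ?thesis by simp
  qed
  also have "\<dots> = 1" by (rule prob_space.emeasure_space_1[OF prob])
  finally interpret body_with_probability_profile n B \<rho> by unfold_locales
  show "satisfies_KLS n (gauge_measure n B \<rho>) (509952 * C)" by (rule KLS_transfer[OF KLS])
qed simp

end
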